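(* Let $\mathbb{B}$ be the weighted adjacency matrix of the line graph of a countable, simple, locally finite, weighted directed graph with edge index set $J$. Then the flow problem with all velocities equal to $1$ and no absorption, $$\begin{cases}\frac{\partial}{\partial t}u_j(x,t)=\frac{\partial}{\partial x}u_j(x,t),& x\in(0,1),\ t\ge0,\\ u_j(1,t)=\sum_{k\in J}\mathbb{B}_{jk}u_k(0,t),& t\ge0,\\ u_j(x,0)=f_j(x),& x\in(0,1),\end{cases}\qquad j\in J,$$ is well-posed on $X=L^\infty([0,1],\ell^1)$; that is, the abstract Cauchy problem on $X$ for the operator $A=\mathrm{diag}\left(\frac{d}{dx}\right)$ with domain $D(A)=\{v\in W^{1,\infty}([0,1],\ell^1)\mid v(1)=\mathbb{B}v(0)\}$ is well-posed with respect to the weak$^*$-topology.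
   Context: **Graph.** $G=(V,E)$ is a directed graph with vertices $V=\{v_i\mid i\in I\}$ and edges $E=\{e_j\mid j\in J\}\subseteq V\times V$, where $I,J\subseteq\mathbb{N}$. For an edge $(v_i,v_k)$, $v_i$ is its tail and $v_k$ its head. $G$ is simple (no loops or multiple edges) and locally finite (each vertex is incident with only finitely many edges). It carries weights $0\le w_{ij}\le 1$ ($i,j\in J$), with $w_{ij}\ne 0$ only if the head of $e_j$ is the tail of $e_i$, such that $\sum_{i\in J}w_{ij}=1$ for all $j\in J$. The matrix $\mathbb{B}=(\mathbb{B}_{ij})_{i,j\in J}$ is defined by $\mathbb{B}_{ij}=w_{ij}$ if the head of $e_j$ is the tail of $e_i$, and $\mathbb{B}_{ij}=0$ otherwise. It acts as a (column-)stochastic operator on $\ell^1=\ell^1(J)$. **Space.** $X=L^\infty([0,1],\ell^1)$ (Bochner space) has norm $\|f\|_X=\operatorname{ess\,sup}_{s\in[0,1]}\|f(s)\|_{\ell^1}$. It is identified with the dual of $L^1([0,1],c_0)$, $c_0=c_0(J)$, via $\langle f,g\rangle=\int_0^1\langle f(s),g(s)\rangle\,ds$; the weak$^*$-topology on $X$ is the one induced by this duality. $W^{1,\infty}([0,1],\ell^1)$ is the Sobolev space of functions in $X$ with weak derivative in $X$, evaluated at points through continuous representatives. $\mathrm{diag}(d/dx)$ differentiates each component. **Well-posedness.** Let $\tau$ denote the weak$^*$-topology. The abstract Cauchy problem $\dot u(t)=Au(t)$ ($t\ge0$), $u(0)=f\in D(A)$, is well-posed in $X$ if: (i) for every $f\in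 D(A)$ there is a solution $u(t)=u(t,f)$ with $u\in B_{loc}(\mathbb{R}_+,X)\cap C^1(\mathbb{R}_+,(X,\tau))$ and $\dot u\in B_{loc}(\mathbb{R}_+,X)$; (ii) the solution is unique; (iii) if $(f_n)\subseteq D(A)$ is norm-bounded and $\tau$-convergent to $0$, then the solutions $u(t,f_n)$ converge to $0$ in $\tau$ uniformly for $t$ in compact intervals $[0,t_0]$. Here $B_{loc}(\mathbb{R}_+,X)$ is the space of functions that are norm-bounded on each compact subset of $\mathbb{R}_+$, and differentiation is understood in the vector-valued sense with respect to $\tau$. *)

theory Defs
  imports "HOL-Probability.Essential_Supremum" "Graph_Theory.Digraph"
begin

section \<open>The sequence spaces\<close>

text \<open>The library requires the values of a Bochner integrable function to lie in a
  \<^class>\<open>second_countable_topology\<close>, hence the separability proofs below.\<close>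

lemma countable_dense_imp_subbasis:
  fixes D :: "'a::metric_space set"
  assumes "countable D" and dense: "\<And>x e. e > 0 \<Longrightarrow> \<exists>d\<in>D. dist d x < e"
  shows "\<exists>B::'a set set. countable B \<and> open = generate_topology B"
proof -
  define B where "B = (\<lambda>(d, n::nat). ball d (1 / real (Suc n))) ` (D \<times> UNIV)"
  have "countable B"
    unfolding B_def using \<open>countable D\<close> by (intro countable_image countable_SIGMA) auto
  moreover have "topological_basis B"
  proof (rule topological_basisI)
    show "open U" if "U \<in> B" for U
      using that unfolding B_def by auto
    fix U :: "'a set" and x
    assume "open U" "x \<in> U"
    then obtain e where e: "e > 0" "ball x e \<subseteq> U"
      using open_contains_ball by blast
    obtain n where n: "1 / real (Suc n) < e / 2"
      using nat_approx_posE[of "e / 2"] e(1) by auto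
    obtain d where d: "d \<in> D" "dist d x < 1 / real (Suc n)"
      using dense[of "1 / real (Suc n)" x] by auto
    have "ball d (1 / real (Suc n)) \<subseteq> U"
    proof
      fix y assume "y \<in> ball d (1 / real (Suc n))"
      then have "dist d y < 1 / real (Suc n)" by simp
      then have "dist x y < e"
        using d(2) n dist_triangle3[of x y d] by linarith
      then show "y \<in> U" using e(2) by auto
    qed
    then show "\<exists>V\<in>B. x \<in> V \<and> V \<subseteq> U"
      using d by (intro bexI[of _ "ball d (1 / real (Suc n))"]) (auto simp: B_def)
  qed
  ultimately show ?thesis
    using topological_basis_imp_subbasis by blast
qed

typedef (overloaded) 'a ell1 = "{x :: nat \<Rightarrow> 'a::real_normed_vector. summable (\<lambda>i. norm (x i))}"
  morphisms ell1_nth Abs_ell1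
  by (rule exI[of _ "\<lambda>_. 0"]) simp

setup_lifting type_definition_ell1

lemma ell1_nth_summable: "summable (\<lambda>i. norm (ell1_nth x i))"
  using ell1_nth[of x] by simp

lemma ell1_eqI: "(\<And>i. ell1_nth x i = ell1_nth y i) \<Longrightarrow> x = y"
  by transfer auto

instantiation ell1 :: (real_normed_vector) real_vector
begin

lift_definition zero_ell1 :: "'a ell1" is "\<lambda>_. 0" by simp

lift_definition plus_ell1 :: "'a ell1 \<Rightarrow> 'a ell1 \<Rightarrow> 'a ell1" is "\<lambda>x y i. x i + y i"
  subgoal for x y
    by (rule summable_comparison_test'[where g = "\<lambda>i. norm (x i) + norm (y i)"])
      (simp_all add: summable_add norm_triangle_ineq)
  done

lift_definition uminus_ell1 :: "'a ell1 \<Rightarrow> 'a ell1" is "\<lambda>x i. - x i" by simp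

lift_definition minus_ell1 :: "'a ell1 \<Rightarrow> 'a ell1 \<Rightarrow> 'a ell1" is "\<lambda>x y i. x i - y i"
  subgoal for x y
    by (rule summable_comparison_test'[where g = "\<lambda>i. norm (x i) + norm (y i)"])
      (simp_all add: summable_add norm_triangle_ineq4)
  done

lift_definition scaleR_ell1 :: "real \<Rightarrow> 'a ell1 \<Rightarrow> 'a ell1" is "\<lambda>c x i. c *\<^sub>R x i"
  by (simp add: summable_mult)

instance
  by standard (transfer; simp add: algebra_simps)+

end

instantiation ell1 :: (real_normed_vector) real_normed_vector
begin

lift_definition norm_ell1 :: "'a ell1 \<Rightarrow> real" is "\<lambda>x. \<Sum>i. norm (x i)" .

definition dist_ell1 :: "'a ell1 \<Rightarrow> 'a ell1 \<Rightarrow> real"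
  where "dist_ell1 x y = norm (x - y)"

definition sgn_ell1 :: "'a ell1 \<Rightarrow> 'a ell1"
  where "sgn_ell1 x = x /\<^sub>R norm x"

definition uniformity_ell1 :: "('a ell1 \<times> 'a ell1) filter"
  where "uniformity_ell1 = (INF e\<in>{0<..}. principal {(x, y). dist x y < e})"

definition open_ell1 :: "'a ell1 set \<Rightarrow> bool"
  where "open_ell1 U = (\<forall>x\<in>U. eventually (\<lambda>(x', y). x' = x \<longrightarrow> y \<in> U) uniformity)"

instance
proof
  fix x y :: "'a ell1" and a b :: real
  show "(norm x = 0) = (x = 0)"
  proof
    assume "norm x = 0"
    then have "(\<Sum>i. norm (ell1_nth x i)) = 0" by (simp add: norm_ell1.rep_eq)
    then have "norm (ell1_nth x i) = 0" for i
      using suminf_eq_zero_iff[OF ell1_nth_summable[of x]] by simp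
    then show "x = 0" by (intro ell1_eqI) (simp add: zero_ell1.rep_eq)
  qed (simp add: norm_ell1.rep_eq zero_ell1.rep_eq)
  show "norm (x + y) \<le> norm x + norm y"
    unfolding norm_ell1.rep_eq suminf_add[OF ell1_nth_summable ell1_nth_summable]
    by (intro suminf_le ell1_nth_summable summable_add) (simp add: plus_ell1.rep_eq norm_triangle_ineq)
  show "norm (a *\<^sub>R x) = \<bar>a\<bar> * norm x"
    by (simp add: norm_ell1.rep_eq scaleR_ell1.rep_eq suminf_mult ell1_nth_summable)
qed (simp_all add: dist_ell1_def sgn_ell1_def uniformity_ell1_def open_ell1_def)

end

lemma norm_ell1_nth_le: "norm (ell1_nth x i) \<le> norm x"
  unfolding norm_ell1.rep_eq
  using sum_le_suminf[OF ell1_nth_summable, of "{i}" x] by simp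

lemma sum_norm_ell1_nth_le: "(\<Sum>i<n. norm (ell1_nth x i)) \<le> norm x"
  unfolding norm_ell1.rep_eq by (intro sum_le_suminf ell1_nth_summable) auto

instance ell1 :: (banach) banach
proof
  fix X :: "nat \<Rightarrow> 'a ell1"
  assume X: "Cauchy X"
  have "Cauchy (\<lambda>n. ell1_nth (X n) i)" for i
  proof (rule metric_CauchyI)
    fix e :: real assume "e > 0"
    then obtain M where M: "\<And>m n. m \<ge> M \<Longrightarrow> n \<ge> M \<Longrightarrow> dist (X m) (X n) < e"
      using metric_CauchyD[OF X] by blast
    have "dist (ell1_nth (X m) i) (ell1_nth (X n) i) \<le> dist (X m) (X n)" for m n
      using norm_ell1_nth_le[of "X m - X n" i] by (simp add: dist_norm minus_ell1.rep_eq)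
    then show "\<exists>M. \<forall>m\<ge>M. \<forall>n\<ge>M. dist (ell1_nth (X m) i) (ell1_nth (X n) i) < e"
      using M by (meson le_less_trans)
  qed
  then have "\<exists>y. \<forall>i. (\<lambda>n. ell1_nth (X n) i) \<longlonglongrightarrow> y i"
    by (intro choice allI) (simp add: Cauchy_convergent convergentD)
  then obtain y where y: "\<And>i. (\<lambda>n. ell1_nth (X n) i) \<longlonglongrightarrow> y i" by blast
  have est: "\<exists>M. \<forall>m\<ge>M. \<forall>N. (\<Sum>i<N. norm (ell1_nth (X m) i - y i)) \<le> e" if "e > 0" for e :: real
  proof -
    obtain M where M: "\<And>m n. m \<ge> M \<Longrightarrow> n \<ge> M \<Longrightarrow> dist (X m) (X n) < e"
      using metric_CauchyD[OF X \<open>e > 0\<close>] by blast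
    have "(\<Sum>i<N. norm (ell1_nth (X m) i - y i)) \<le> e" if "m \<ge> M" for m N
    proof (rule LIMSEQ_le_const2)
      show "(\<lambda>n. \<Sum>i<N. norm (ell1_nth (X m) i - ell1_nth (X n) i))
          \<longlonglongrightarrow> (\<Sum>i<N. norm (ell1_nth (X m) i - y i))"
        by (intro tendsto_intros y)
      have "(\<Sum>i<N. norm (ell1_nth (X m) i - ell1_nth (X n) i)) \<le> e" if "n \<ge> M" for n
        using sum_norm_ell1_nth_le[of "X m - X n" N] M[OF \<open>m \<ge> M\<close> that]
        by (simp add: dist_norm minus_ell1.rep_eq)
      then show "\<exists>k. \<forall>n\<ge>k. (\<Sum>i<N. norm (ell1_nth (X m) i - ell1_nth (X n) i)) \<le> e"
        by blast
    qed
    then show ?thesis by blast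
  qed
  have "summable (\<lambda>i. norm (y i))"
  proof -
    obtain M where M: "\<And>N. (\<Sum>i<N. norm (ell1_nth (X M) i - y i)) \<le> 1"
      using est[of 1] by auto
    have "(\<Sum>i\<le>N. norm (ell1_nth (X M) i - y i)) \<le> 1" for N
      using M[of "Suc N"] by (simp only: lessThan_Suc_atMost)
    then have "summable (\<lambda>i. norm (ell1_nth (X M) i - y i))"
      by (rule bounded_imp_summable[where B = 1, rotated]) simp
    then have "summable (\<lambda>i. norm (ell1_nth (X M) i - y i) + norm (ell1_nth (X M) i))"
      by (rule summable_add[OF _ ell1_nth_summable])
    then show ?thesis
    proof (rule summable_comparison_test')
      show "norm (norm (y i)) \<le> norm (ell1_nth (X M) i - y i) + norm (ell1_nth (X M) i)" for i
        using norm_triangle_sub[of "y i" "ell1_nth (X M) i"]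
        by (simp add: norm_minus_commute add.commute)
    qed
  qed
  then obtain z where z: "\<And>i. ell1_nth z i = y i"
    using Abs_ell1_inverse[of y] by (metis mem_Collect_eq)
  have "X \<longlonglongrightarrow> z"
  proof (rule metric_LIMSEQ_I)
    fix e :: real assume "e > 0"
    then obtain M where M: "\<And>m N. m \<ge> M \<Longrightarrow> (\<Sum>i<N. norm (ell1_nth (X m) i - y i)) \<le> e / 2"
      using est[of "e / 2"] by auto
    have "dist (X m) z < e" if "m \<ge> M" for m
    proof -
      have "norm (X m - z) \<le> e / 2"
        unfolding norm_ell1.rep_eq
        by (intro suminf_le_const ell1_nth_summable) (use M[OF that] in \<open>simp add: minus_ell1.rep_eq z\<close>)
      then show ?thesis using \<open>e > 0\<close> by (simp add: dist_norm)
    qed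
    then show "\<exists>M. \<forall>m\<ge>M. dist (X m) z < e" by blast
  qed
  then show "convergent X" by (rule convergentI)
qed

instance ell1 :: ("{real_normed_vector, second_countable_topology}") second_countable_topology
proof
  obtain D :: "'a set" where D: "countable D" "\<And>U. open U \<Longrightarrow> U \<noteq> {} \<Longrightarrow> \<exists>d\<in>D. d \<in> U"
    using countable_dense_setE by blast
  define F where "F = (\<lambda>xs. Abs_ell1 (\<lambda>i. if i < length xs then xs ! i else (0::'a))) ` lists D"
  have F_nth: "ell1_nth (Abs_ell1 (\<lambda>i. if i < length xs then xs ! i else (0::'a)))
      = (\<lambda>i. if i < length xs then xs ! i else 0)" for xs
    by (rule Abs_ell1_inverse, simp, rule summable_finite[of "{..<length xs}"]) auto
  have "countable F" unfolding F_def using D(1) by (intro countable_image countable_lists)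
  moreover have "\<exists>d\<in>F. dist d x < e" if e: "e > 0" for x :: "'a ell1" and e :: real
  proof -
    obtain N where N: "norm (\<Sum>i. norm (ell1_nth x (i + N))) < e / 2"
      using suminf_exist_split[OF half_gt_zero[OF e] ell1_nth_summable[of x]] by blast
    define r where "r = e / (2 * real (Suc N))"
    have "r > 0" using that by (simp add: r_def)
    have "\<exists>d\<in>D. dist (ell1_nth x i) d < r" for i
      using D(2)[of "ball (ell1_nth x i) r"] \<open>r > 0\<close> by auto
    then obtain d where d: "\<And>i. d i \<in> D" "\<And>i. dist (ell1_nth x i) (d i) < r"
      unfolding Bex_def by atomize_elim (simp flip: all_conj_distrib, intro choice, blast)
    define z where "z = Abs_ell1 (\<lambda>i. if i < length (map d [0..<N]) then map d [0..<N] ! i else 0)"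
    have z: "ell1_nth z i = (if i < N then d i else 0)" for i
      unfolding z_def F_nth by simp
    have "z \<in> F" unfolding F_def z_def by (rule imageI) (use d(1) in auto)
    moreover have "dist z x < e"
    proof -
      have "norm (x - z) = (\<Sum>i. norm (ell1_nth (x - z) (i + N))) + (\<Sum>i<N. norm (ell1_nth (x - z) i))"
        unfolding norm_ell1.rep_eq by (rule suminf_split_initial_segment[OF ell1_nth_summable])
      also have "(\<Sum>i. norm (ell1_nth (x - z) (i + N))) = (\<Sum>i. norm (ell1_nth x (i + N)))"
        by (simp add: minus_ell1.rep_eq z)
      also have "(\<Sum>i<N. norm (ell1_nth (x - z) i)) \<le> (\<Sum>i<N. r)"
        by (intro sum_mono) (use d(2) in \<open>auto simp: minus_ell1.rep_eq z dist_norm less_imp_le\<close>)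
      also have "(\<Sum>i<N. r) \<le> e / 2"
        using that by (simp add: r_def field_simps)
      finally show ?thesis using N by (simp add: dist_norm norm_minus_commute[of z])
    qed
    ultimately show ?thesis by blast
  qed
  ultimately show "\<exists>B::'a ell1 set set. countable B \<and> open = generate_topology B"
    by (rule countable_dense_imp_subbasis)
qed

typedef (overloaded) 'a c0 = "{x :: nat \<Rightarrow> 'a::real_normed_vector. x \<longlonglongrightarrow> 0}"
  morphisms c0_nth Abs_c0
  by (rule exI[of _ "\<lambda>_. 0"]) simp

setup_lifting type_definition_c0

lemma c0_nth_tendsto: "c0_nth x \<longlonglongrightarrow> 0"
  using c0_nth[of x] by simp

lemma c0_nth_bdd: "bdd_above (range (\<lambda>i. norm (c0_nth x i)))"
  using convergent_imp_Bseq[OF convergentI[OF c0_nth_tendsto[of x]]]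
  by (auto simp: Bseq_def bdd_above_def)

lemma c0_eqI: "(\<And>i. c0_nth x i = c0_nth y i) \<Longrightarrow> x = y"
  by transfer auto

instantiation c0 :: (real_normed_vector) real_vector
begin

lift_definition zero_c0 :: "'a c0" is "\<lambda>_. 0" by simp

lift_definition plus_c0 :: "'a c0 \<Rightarrow> 'a c0 \<Rightarrow> 'a c0" is "\<lambda>x y i. x i + y i"
  by (rule tendsto_add_zero)

lift_definition uminus_c0 :: "'a c0 \<Rightarrow> 'a c0" is "\<lambda>x i. - x i"
  using tendsto_minus by fastforce

lift_definition minus_c0 :: "'a c0 \<Rightarrow> 'a c0 \<Rightarrow> 'a c0" is "\<lambda>x y i. x i - y i"
  using tendsto_diff by fastforce

lift_definition scaleR_c0 :: "real \<Rightarrow> 'a c0 \<Rightarrow> 'a c0" is "\<lambda>c x i. c *\<^sub>R x i"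
  using tendsto_scaleR[OF tendsto_const] by fastforce

instance
  by standard (transfer; simp add: algebra_simps)+

end

instantiation c0 :: (real_normed_vector) real_normed_vector
begin

lift_definition norm_c0 :: "'a c0 \<Rightarrow> real" is "\<lambda>x. SUP i. norm (x i)" .

definition dist_c0 :: "'a c0 \<Rightarrow> 'a c0 \<Rightarrow> real"
  where "dist_c0 x y = norm (x - y)"

definition sgn_c0 :: "'a c0 \<Rightarrow> 'a c0"
  where "sgn_c0 x = x /\<^sub>R norm x"

definition uniformity_c0 :: "('a c0 \<times> 'a c0) filter"
  where "uniformity_c0 = (INF e\<in>{0<..}. principal {(x, y). dist x y < e})"

definition open_c0 :: "'a c0 set \<Rightarrow> bool"
  where "open_c0 U = (\<forall>x\<in>U. eventually (\<lambda>(x', y). x' = x \<longrightarrow> y \<in> U) uniformity)"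

instance
proof
  fix x y :: "'a c0" and a b :: real
  have le: "norm (c0_nth z i) \<le> norm z" for z :: "'a c0" and i
    unfolding norm_c0.rep_eq by (rule cSUP_upper[OF UNIV_I c0_nth_bdd])
  show "(norm x = 0) = (x = 0)"
  proof
    assume "norm x = 0"
    then show "x = 0" using le[of x] by (intro c0_eqI) (simp add: zero_c0.rep_eq)
  qed (simp add: norm_c0.rep_eq zero_c0.rep_eq)
  show "norm (x + y) \<le> norm x + norm y"
    unfolding norm_c0.rep_eq[of "x + y"]
    by (rule cSUP_least) (auto simp: plus_c0.rep_eq intro: norm_triangle_le add_mono le)
  have "(SUP i. \<bar>a\<bar> * norm (c0_nth x i)) = \<bar>a\<bar> * (SUP i. norm (c0_nth x i))"
  proof -
    have "continuous (at_left r) ((*) \<bar>a\<bar>)" for r :: real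
      by (intro continuous_mult continuous_const continuous_ident)
    then have "\<bar>a\<bar> * (SUP i. norm (c0_nth x i))
        = Sup ((*) \<bar>a\<bar> ` range (\<lambda>i. norm (c0_nth x i)))"
      by (intro continuous_at_Sup_mono c0_nth_bdd) (simp_all add: mono_def mult_left_mono)
    then show ?thesis by (simp only: image_image)
  qed
  then show "norm (a *\<^sub>R x) = \<bar>a\<bar> * norm x"
    by (simp add: norm_c0.rep_eq scaleR_c0.rep_eq)
qed (simp_all add: dist_c0_def sgn_c0_def uniformity_c0_def open_c0_def)

end

lemma norm_c0_nth_le: "norm (c0_nth x i) \<le> norm x"
  unfolding norm_c0.rep_eq by (rule cSUP_upper[OF UNIV_I c0_nth_bdd])

instance c0 :: ("{real_normed_vector, second_countable_topology}") second_countable_topology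
proof
  obtain D :: "'a set" where D: "countable D" "\<And>U. open U \<Longrightarrow> U \<noteq> {} \<Longrightarrow> \<exists>d\<in>D. d \<in> U"
    using countable_dense_setE by blast
  define F where "F = (\<lambda>xs. Abs_c0 (\<lambda>i. if i < length xs then xs ! i else (0::'a))) ` lists D"
  have F_nth: "c0_nth (Abs_c0 (\<lambda>i. if i < length xs then xs ! i else (0::'a)))
      = (\<lambda>i. if i < length xs then xs ! i else 0)" for xs
  proof (rule Abs_c0_inverse, simp, rule tendsto_eventually)
    show "\<forall>\<^sub>F i in sequentially. (if i < length xs then xs ! i else 0) = 0"
      using eventually_ge_at_top[of "length xs"] by eventually_elim simp
  qed
  have "countable F" unfolding F_def using D(1) by (intro countable_image countable_lists)
  moreover have "\<exists>d\<in>F. dist d x < e" if e: "e > 0" for x :: "'a c0" and e :: real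
  proof -
    obtain N where N: "\<And>i. i \<ge> N \<Longrightarrow> norm (c0_nth x i) < e / 2"
      using LIMSEQ_D[OF c0_nth_tendsto[of x] half_gt_zero[OF e]] by auto
    have "\<exists>d\<in>D. dist (c0_nth x i) d < e / 2" for i
      using D(2)[of "ball (c0_nth x i) (e / 2)"] e by auto
    then obtain d where d: "\<And>i. d i \<in> D" "\<And>i. dist (c0_nth x i) (d i) < e / 2"
      unfolding Bex_def by atomize_elim (simp flip: all_conj_distrib, intro choice, blast)
    define z where "z = Abs_c0 (\<lambda>i. if i < length (map d [0..<N]) then map d [0..<N] ! i else 0)"
    have z: "c0_nth z i = (if i < N then d i else 0)" for i
      unfolding z_def F_nth by simp
    have "z \<in> F" unfolding F_def z_def by (rule imageI) (use d(1) in auto)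
    moreover have "norm (x - z) \<le> e / 2"
      unfolding norm_c0.rep_eq
      by (rule cSUP_least) (use d(2) N in \<open>auto simp: minus_c0.rep_eq z dist_norm less_imp_le\<close>)
    then have "dist z x < e"
      using that by (simp add: dist_norm norm_minus_commute[of z])
    ultimately show ?thesis by blast
  qed
  ultimately show "\<exists>B::'a c0 set set. countable B \<and> open = generate_topology B"
    by (rule countable_dense_imp_subbasis)
qed

text \<open>For an index set \<open>J \<subseteq> \<nat>\<close>, the spaces \<open>\<ell>\<^sup>1(J)\<close> and \<open>c\<^sub>0(J)\<close> are realised
  isometrically as the sequences on \<open>\<nat>\<close> that vanish off \<open>J\<close>.\<close>

definition ell1_on :: "nat set \<Rightarrow> 'a::real_normed_vector ell1 set"
  where "ell1_on J = {x. \<forall>i. i \<notin> J \<longrightarrow> ell1_nth x i = 0}"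

definition c0_on :: "nat set \<Rightarrow> 'a::real_normed_vector c0 set"
  where "c0_on J = {x. \<forall>i. i \<notin> J \<longrightarrow> c0_nth x i = 0}"

definition ell1_c0_pairing :: "'a::real_normed_field ell1 \<Rightarrow> 'a c0 \<Rightarrow> 'a"
  where "ell1_c0_pairing x y = (\<Sum>j. ell1_nth x j * c0_nth y j)"


section \<open>Function spaces on the unit interval\<close>

text \<open>Elements of Bochner spaces are handled through representatives: every notion below is
  invariant under modification on a Lebesgue null set, and equality in the space is almost
  everywhere equality. The topology \<open>weak_star J\<close> is accordingly one on
  representatives. The type class \<open>{real_normed_field, euclidean_space}\<close> leaves
  exactly the real and the complex scalar field.\<close>

abbreviation unit_interval :: "real measure"
  where "unit_interval \<equiv> lebesgue_on {0..1}"

definition Linf_norm :: "(real \<Rightarrow> 'a::{real_normed_field, euclidean_space} ell1) \<Rightarrow> ereal"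
  where "Linf_norm f = esssup unit_interval (\<lambda>s. ereal (norm (f s)))"

definition Linf :: "nat set \<Rightarrow> (real \<Rightarrow> 'a::{real_normed_field, euclidean_space} ell1) set"
  where "Linf J = {f \<in> borel_measurable unit_interval.
    (AE s in unit_interval. f s \<in> ell1_on J) \<and> Linf_norm f < \<infinity>}"

definition L1_c0 :: "nat set \<Rightarrow> (real \<Rightarrow> 'a::{real_normed_field, euclidean_space} c0) set"
  where "L1_c0 J = {g. integrable unit_interval g \<and> (AE s in unit_interval. g s \<in> c0_on J)}"

definition Linf_pairing ::
    "(real \<Rightarrow> 'a::{real_normed_field, euclidean_space} ell1) \<Rightarrow> (real \<Rightarrow> 'a c0) \<Rightarrow> 'a"
  where "Linf_pairing f g = (LINT s|unit_interval. ell1_c0_pairing (f s) (g s))"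

definition weak_star ::
    "nat set \<Rightarrow> (real \<Rightarrow> 'a::{real_normed_field, euclidean_space} ell1) topology"
  where "weak_star J = topology_generated_by
    {{f \<in> Linf J. Linf_pairing f g \<in> U} | g U. g \<in> L1_c0 J \<and> open U}"

definition test_function :: "(real \<Rightarrow> real) \<Rightarrow> bool"
  where "test_function \<phi> \<longleftrightarrow>
    (\<forall>n x. (deriv ^^ n) \<phi> field_differentiable at x) \<and> closure {x. \<phi> x \<noteq> 0} \<subseteq> {0<..<1}"

definition is_weak_deriv ::
    "nat set \<Rightarrow> (real \<Rightarrow> 'a::{real_normed_field, euclidean_space} ell1) \<Rightarrow> (real \<Rightarrow> 'a ell1) \<Rightarrow> bool"
  where "is_weak_deriv J f g \<longleftrightarrow> g \<in> Linf J \<and> (\<forall>\<phi>. test_function \<phi> \<longrightarrow>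
    (LINT s|unit_interval. deriv \<phi> s *\<^sub>R f s) = - (LINT s|unit_interval. \<phi> s *\<^sub>R g s))"

definition W1inf :: "nat set \<Rightarrow> (real \<Rightarrow> 'a::{real_normed_field, euclidean_space} ell1) set"
  where "W1inf J = {f \<in> Linf J. \<exists>g. is_weak_deriv J f g}"

definition continuous_rep ::
    "(real \<Rightarrow> 'a::{real_normed_field, euclidean_space} ell1) \<Rightarrow> (real \<Rightarrow> 'a ell1) \<Rightarrow> bool"
  where "continuous_rep f c \<longleftrightarrow> continuous_on {0..1} c \<and> (AE s in unit_interval. f s = c s)"


section \<open>Well-posedness with respect to the weak-star topology\<close>

text \<open>\<open>D\<close> is the domain of the operator \<open>A\<close>, whose values are representatives.
  The condition \<open>u t \<in> D\<close> is implicit in the equation \<open>\<dot>u(t) = A u(t)\<close>. At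
  \<open>t = 0\<close> the derivative is one-sided.\<close>

definition weak_star_deriv ::
    "nat set \<Rightarrow> (real \<Rightarrow> real \<Rightarrow> 'a::{real_normed_field, euclidean_space} ell1)
      \<Rightarrow> (real \<Rightarrow> real \<Rightarrow> 'a ell1) \<Rightarrow> bool"
  where "weak_star_deriv J u u' \<longleftrightarrow> (\<forall>t\<ge>0.
    limitin (weak_star J) (\<lambda>r s. (u r s - u t s) /\<^sub>R (r - t)) (u' t) (at t within {0..}))"

definition locally_norm_bounded ::
    "(real \<Rightarrow> real \<Rightarrow> 'a::{real_normed_field, euclidean_space} ell1) \<Rightarrow> bool"
  where "locally_norm_bounded u \<longleftrightarrow>
    (\<forall>K. compact K \<and> K \<subseteq> {0..} \<longrightarrow> (\<exists>C::real. \<forall>t\<in>K. Linf_norm (u t) \<le> ereal C))"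

definition is_solution ::
    "nat set \<Rightarrow> (real \<Rightarrow> 'a::{real_normed_field, euclidean_space} ell1) set
      \<Rightarrow> ((real \<Rightarrow> 'a ell1) \<Rightarrow> (real \<Rightarrow> 'a ell1))
      \<Rightarrow> (real \<Rightarrow> 'a ell1) \<Rightarrow> (real \<Rightarrow> real \<Rightarrow> 'a ell1) \<Rightarrow> bool"
  where "is_solution J D A f u \<longleftrightarrow>
    (\<forall>t\<ge>0. u t \<in> D) \<and> (AE s in unit_interval. u 0 s = f s) \<and> locally_norm_bounded u \<and>
    continuous_map (top_of_set {0..}) (weak_star J) u \<and>
    (\<exists>u'. weak_star_deriv J u u' \<and> continuous_map (top_of_set {0..}) (weak_star J) u' \<and>
      locally_norm_bounded u' \<and> (\<forall>t\<ge>0. AE s in unit_interval. u' t s = A (u t) s))"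

text \<open>Uniform convergence to 0 on \<open>[0, t\<^sub>0]\<close> is the one of the vector topology
  \<open>weak_star J\<close>, i.e. expressed by neighbourhoods of 0.\<close>

definition well_posed ::
    "nat set \<Rightarrow> (real \<Rightarrow> 'a::{real_normed_field, euclidean_space} ell1) set
      \<Rightarrow> ((real \<Rightarrow> 'a ell1) \<Rightarrow> (real \<Rightarrow> 'a ell1)) \<Rightarrow> bool"
  where "well_posed J D A \<longleftrightarrow>
    (\<forall>f\<in>D. \<exists>u. is_solution J D A f u) \<and>
    (\<forall>f\<in>D. \<forall>u v. is_solution J D A f u \<and> is_solution J D A f v \<longrightarrow>
      (\<forall>t\<ge>0. AE s in unit_interval. u t s = v t s)) \<and>
    (\<forall>f u. (\<forall>n::nat. f n \<in> D) \<and> (\<exists>C::real. \<forall>n. Linf_norm (f n) \<le> ereal C) \<and>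
      limitin (weak_star J) f (\<lambda>_. 0) sequentially \<and> (\<forall>n. is_solution J D A (f n) (u n)) \<longrightarrow>
      (\<forall>t\<^sub>0\<ge>0. \<forall>U. openin (weak_star J) U \<and> (\<lambda>_. 0) \<in> U \<longrightarrow>
        (\<forall>\<^sub>F n in sequentially. \<forall>t\<in>{0..t\<^sub>0}. u n t \<in> U)))"


section \<open>The network and the flow operator\<close>

text \<open>Vertices and edges are identified with their indices: for \<open>G :: (nat, nat) pre_digraph\<close>
  the index sets are \<open>I = verts G\<close> and \<open>J = arcs G\<close>.\<close>

definition locally_finite :: "('v, 'e) pre_digraph \<Rightarrow> bool"
  where "locally_finite G \<longleftrightarrow>
    (\<forall>v\<in>verts G. finite {e \<in> arcs G. tail G e = v \<or> head G e = v})"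

definition edge_weights :: "('v, nat) pre_digraph \<Rightarrow> (nat \<Rightarrow> nat \<Rightarrow> real) \<Rightarrow> bool"
  where "edge_weights G w \<longleftrightarrow>
    (\<forall>i\<in>arcs G. \<forall>j\<in>arcs G. 0 \<le> w i j \<and> w i j \<le> 1 \<and> (w i j \<noteq> 0 \<longrightarrow> head G j = tail G i)) \<and>
    (\<forall>j\<in>arcs G. ((\<lambda>i. w i j) has_sum 1) (arcs G))"

definition line_adjacency ::
    "('v, nat) pre_digraph \<Rightarrow> (nat \<Rightarrow> nat \<Rightarrow> real) \<Rightarrow> nat \<Rightarrow> nat \<Rightarrow> real"
  where "line_adjacency G w i j = (if head G j = tail G i then w i j else 0)"

definition flow_domain ::
    "nat set \<Rightarrow> (nat \<Rightarrow> nat \<Rightarrow> real) \<Rightarrow> (real \<Rightarrow> 'a::{real_normed_field, euclidean_space} ell1) set"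
  where "flow_domain J B = {v \<in> W1inf J. \<exists>c. continuous_rep v c \<and>
    (\<forall>j\<in>J. ell1_nth (c 1) j = (\<Sum>\<^sub>\<infinity>k\<in>J. B j k *\<^sub>R ell1_nth (c 0) k))}"

text \<open>A weak derivative is unique up to null sets. The derivative in \<open>\<ell>\<^sup>1\<close> acts
  componentwise since coordinate functionals commute with the Bochner integral, so this is
  \<open>diag(d/dx)\<close>.\<close>

definition flow_operator ::
    "nat set \<Rightarrow> (real \<Rightarrow> 'a::{real_normed_field, euclidean_space} ell1) \<Rightarrow> (real \<Rightarrow> 'a ell1)"
  where "flow_operator J v = (SOME g. is_weak_deriv J v g)"

end

theory Submission
  imports Defs "HOL-Real_Asymp.Real_Asymp"
begin

text \<open>
  The problem is solved by the method of characteristics. An element \<open>f\<close> of the domain is almost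
  everywhere equal to a primitive \<open>a + \<integral>\<^sub>0\<^sup>s g\<close>, where \<open>g\<close> is its weak derivative, and the boundary
  condition says that the value of this primitive at 1 is \<open>B a\<close>. Extend \<open>g\<close> to a function \<open>G\<close> on the
  half line by \<open>G(x + 1) = B G(x)\<close>. Then \<open>F(x) = a + \<integral>\<^sub>0\<^sup>x G\<close> satisfies \<open>F(x + 1) = B F(x)\<close>, and the
  solution is the translate \<open>u(t)(s) = F(t + s)\<close>, with derivative \<open>G(t + s)\<close>
  (lemma \<open>flow_solution_exists\<close>).

  All weak-star statements are reduced to calculus for the coordinates: on norm-bounded families,
  weak-star convergence can be tested on the functions \<open>1\<^bsub>[0,b]\<^esub> e\<^sub>j\<close>
  (lemma \<open>tendsto_Linf_pairing_zero\<close>), and the pairing of \<open>F(t + \<cdot>)\<close> with such a function is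
  \<open>P\<^sub>j(t + b) - P\<^sub>j(t)\<close>, where \<open>P\<^sub>j\<close> is a primitive of the continuous function \<open>F\<^sub>j\<close>.

  For uniqueness, let \<open>u\<close> be any solution, let \<open>c\<^sub>t\<close> be the continuous representative of \<open>u(t)\<close>, and fix
  a coordinate \<open>j\<close>. The means \<open>\<Phi>(t,x) = \<integral>\<^sub>0\<^sup>x c\<^sub>t\<^sub>,\<^sub>j\<close> satisfy \<open>\<partial>\<^sub>x \<Phi>(t,x) = c\<^sub>t\<^sub>,\<^sub>j(x)\<close> and
  \<open>\<partial>\<^sub>t \<Phi>(t,x) = c\<^sub>t\<^sub>,\<^sub>j(x) - c\<^sub>t\<^sub>,\<^sub>j(0)\<close>, so that \<open>\<Phi>(t,x) - \<Phi>(t,y)\<close> is constant along the characteristics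
  \<open>(t + h, x - h)\<close>, \<open>(t + h, y - h)\<close>. This gives \<open>c\<^sub>t(x) = c\<^sub>t\<^sub>+\<^sub>x(0)\<close>, and with the boundary condition
  the function \<open>t \<mapsto> c\<^sub>t(0)\<close> obeys the same recursion as \<open>F\<close>. Hence every solution is the translate of
  \<open>F\<close> (lemma \<open>solution_eq_translate\<close>).

  For continuous dependence, local finiteness enters: the rows of the matrix \<open>B\<close> are finitely
  supported, so \<open>F\<^sub>j(x + 1)\<close> is a finite combination of the \<open>F\<^sub>k(x)\<close>. If the initial data tend to 0, the
  primitives \<open>P\<^sub>j\<close> therefore tend to 0 at every point of the half line, by induction on the integer
  part. They are equi-Lipschitz because \<open>B\<close> is a contraction, so the convergence is uniform on
  compact intervals (lemma \<open>flow_weak_star_continuous_dependence\<close>).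

  The identification of the weak derivative with the density of a primitive rests on du
  Bois-Reymond's lemma (\<open>AE_constant_if_weak_deriv_zero\<close>), for which bump functions are
  constructed, and on integration by parts (\<open>integral_by_parts_antideriv\<close>).
\<close>

section \<open>Lebesgue and Borel measurable functions on the unit interval\<close>

lemma norm_integral_le_AE:
  fixes f :: "'a \<Rightarrow> 'b::{banach, second_countable_topology}"
  assumes "integrable M f" "integrable M g" "AE x in M. norm (f x) \<le> g x"
  shows "norm (integral\<^sup>L M f) \<le> integral\<^sup>L M g"
  using integral_norm_bound[of M f] integral_mono_AE[OF integrable_norm[OF assms(1)] assms(2,3)]
  by linarith

lemma lebesgue_borel_representative:
  fixes f :: "'a::euclidean_space \<Rightarrow> 'b::{banach, second_countable_topology}"
  assumes "f \<in> borel_measurable lebesgue"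
  obtains g where "g \<in> borel_measurable borel" "AE x in lborel. f x = g x"
proof -
  obtain F where F: "\<And>i. simple_function lebesgue (F i)" "\<And>x. (\<lambda>i. F i x) \<longlonglongrightarrow> f x"
    using borel_measurable_implies_sequence_metric[OF assms, of 0] by auto
  have "\<exists>F'. simple_function lborel F' \<and> (AE x in lborel. F i x = F' x)" for i
    using completion_ex_simple_function[OF F(1)] .
  then obtain F' where F': "\<And>i. simple_function lborel (F' i)" "\<And>i. AE x in lborel. F i x = F' i x"
    by metis
  have meas [measurable]: "F' i \<in> borel_measurable borel" for i
    using borel_measurable_simple_function[OF F'(1)] by simp
  define g where "g x = lim (\<lambda>i. F' i x)" for x
  have "AE x in lborel. \<forall>i. F i x = F' i x"
    using F'(2) by (simp add: AE_all_countable)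
  then have "AE x in lborel. f x = g x"
  proof eventually_elim
    case (elim x)
    then have "(\<lambda>i. F' i x) \<longlonglongrightarrow> f x" using F(2)[of x] by simp
    then show ?case by (simp add: g_def limI)
  qed
  moreover have "g \<in> borel_measurable borel"
    unfolding g_def[abs_def] by measurable
  ultimately show ?thesis using that by blast
qed

lemma unit_interval_measurable_iff:
  fixes f :: "real \<Rightarrow> 'b::real_normed_vector"
  shows "f \<in> borel_measurable unit_interval \<longleftrightarrow>
    (\<lambda>s. indicator {0..1} s *\<^sub>R f s) \<in> borel_measurable lebesgue"
  by (rule borel_measurable_restrict_space_iff) simp

lemma AE_unit_interval_iff: "(AE s in unit_interval. P s) \<longleftrightarrow> (AE s in lborel. s \<in> {0..1} \<longrightarrow> P s)"
  by (subst AE_restrict_space_iff) (simp_all add: AE_completion_iff)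

lemma AE_unit_intervalI: "(\<And>s. 0 \<le> s \<Longrightarrow> s \<le> 1 \<Longrightarrow> P s) \<Longrightarrow> AE s in unit_interval. P s"
  by (rule AE_I2) (simp add: space_restrict_space)

lemma unit_interval_borel_representative:
  fixes f :: "real \<Rightarrow> 'b::{banach, second_countable_topology}"
  assumes "f \<in> borel_measurable unit_interval"
  obtains g where "g \<in> borel_measurable borel" "AE s in unit_interval. f s = g s"
proof -
  obtain g where g: "g \<in> borel_measurable borel"
      "AE x in lborel. indicator {0..1} x *\<^sub>R f x = g x"
    using lebesgue_borel_representative assms unit_interval_measurable_iff by metis
  from g(2) have "AE s in unit_interval. f s = g s"
    unfolding AE_unit_interval_iff by eventually_elim auto
  with g(1) show ?thesis using that by blast
qed

lemma borel_measurable_unit_interval: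
  fixes f :: "real \<Rightarrow> 'b::{banach, second_countable_topology}"
  assumes [measurable]: "f \<in> borel_measurable borel"
  shows "f \<in> borel_measurable unit_interval"
  unfolding unit_interval_measurable_iff
  by (rule measurable_completion) measurable

interpretation unit_interval: finite_measure unit_interval
  by (rule finite_measureI) (simp add: emeasure_restrict_space space_restrict_space)

lemma integral_unit_interval:
  fixes f :: "real \<Rightarrow> 'b::{banach, second_countable_topology}"
  assumes [measurable]: "f \<in> borel_measurable borel"
  shows "(LINT s|unit_interval. f s) = (LBINT s:{0..1}. f s)"
proof -
  have "(LINT s|unit_interval. f s) = (LINT s|lebesgue. indicator {0..1} s *\<^sub>R f s)"
    by (rule integral_restrict_space) simp
  also have "\<dots> = (LBINT s:{0..1}. f s)"
    unfolding set_lebesgue_integral_def by (rule integral_completion) measurable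
  finally show ?thesis .
qed

lemma integrable_unit_interval_bounded:
  fixes f :: "real \<Rightarrow> 'b::{banach, second_countable_topology}"
  assumes "f \<in> borel_measurable unit_interval" "AE s in unit_interval. norm (f s) \<le> K"
  shows "integrable unit_interval f"
  using assms by (intro unit_interval.integrable_const_bound) 

lemma integrable_continuous_scaleR:
  fixes f :: "real \<Rightarrow> 'b::{banach, second_countable_topology}"
  assumes \<psi>: "continuous_on {0..1} \<psi>" and f: "f \<in> borel_measurable unit_interval"
    and K: "AE s in unit_interval. norm (f s) \<le> K"
  shows "integrable unit_interval (\<lambda>s. \<psi> s *\<^sub>R f s)"
proof -
  obtain C where "\<forall>y\<in>\<psi> ` {0..1}. norm y \<le> C"
    using compact_imp_bounded[OF compact_continuous_image[OF \<psi> compact_Icc]]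
    unfolding bounded_iff by blast
  then have C: "norm (\<psi> x) \<le> C" if "x \<in> {0..1}" for x using that by blast
  show ?thesis
  proof (rule integrable_unit_interval_bounded[where K = "C * \<bar>K\<bar>"])
    show "(\<lambda>s. \<psi> s *\<^sub>R f s) \<in> borel_measurable unit_interval"
      by (intro borel_measurable_scaleR f continuous_imp_measurable_on_sets_lebesgue[OF \<psi>]) simp
    have "AE s in unit_interval. s \<in> {0..1}" by (rule AE_unit_intervalI) simp
    then show "AE s in unit_interval. norm (\<psi> s *\<^sub>R f s) \<le> C * \<bar>K\<bar>"
      using K
    proof eventually_elim
      case (elim s)
      have "norm (\<psi> s) * norm (f s) \<le> C * \<bar>K\<bar>"
        using C[OF elim(1)] elim(2) by (intro mult_mono) auto
      then show ?case by simp
    qed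
  qed
qed

lemma unit_interval_indicator_integral:
  fixes f :: "real \<Rightarrow> 'b::{banach, second_countable_topology}"
  assumes [measurable]: "f \<in> borel_measurable borel" and "b \<le> 1"
  shows "(LINT s|unit_interval. indicator {0..b} s *\<^sub>R f s) = (LBINT s:{0..b}. f s)"
proof -
  have "(LINT s|unit_interval. indicator {0..b} s *\<^sub>R f s) = (LBINT s:{0..1}. indicator {0..b} s *\<^sub>R f s)"
    by (rule integral_unit_interval) measurable
  also have "\<dots> = (LBINT s:{0..b}. f s)"
    unfolding set_lebesgue_integral_def
    by (rule Bochner_Integration.integral_cong) (use assms in \<open>auto simp: indicator_def\<close>)
  finally show ?thesis .
qed

text \<open>For uniformly bounded families, convergence to 0 of the integrals over all initial intervals
  passes to all measurable sets: the sets for which it holds form a Dynkin system.\<close>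

lemma tendsto_integral_sets:
  fixes q :: "'i \<Rightarrow> real \<Rightarrow> 'b::{banach, second_countable_topology}"
  assumes meas [measurable]: "\<And>i. q i \<in> borel_measurable unit_interval"
    and bound: "\<And>i. AE s in unit_interval. norm (q i s) \<le> K"
    and init: "\<And>b. 0 \<le> b \<Longrightarrow> b \<le> 1 \<Longrightarrow>
      ((\<lambda>i. LINT s|unit_interval. indicator {0..b} s *\<^sub>R q i s) \<longlongrightarrow> 0) Fl"
    and A: "A \<in> sets unit_interval"
  shows "((\<lambda>i. LINT s|unit_interval. indicator A s *\<^sub>R q i s) \<longlongrightarrow> 0) Fl"
proof -
  have borel_sets [measurable]: "{s \<in> space unit_interval. s \<in> B} \<in> sets unit_interval"
    if "B \<in> sets borel" for B
  proof -
    have "{s \<in> space unit_interval. s \<in> B} = {0..1} \<inter> B" by (auto simp: space_restrict_space)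
    moreover have "B \<in> sets lebesgue" using that by simp
    ultimately show ?thesis by (simp add: sets_restrict_space)
  qed
  have intble: "integrable unit_interval (\<lambda>s. indicator B s *\<^sub>R q i s)" if "B \<in> sets borel" for B i
  proof (rule integrable_unit_interval_bounded[where K = "\<bar>K\<bar>"])
    show "(\<lambda>s. indicator B s *\<^sub>R q i s) \<in> borel_measurable unit_interval"
      using borel_sets[OF that] by measurable
    show "AE s in unit_interval. norm (indicator B s *\<^sub>R q i s) \<le> \<bar>K\<bar>"
      using bound[of i] by eventually_elim (auto simp: indicator_def)
  qed
  have borel: "((\<lambda>i. LINT s|unit_interval. indicator B s *\<^sub>R q i s) \<longlongrightarrow> 0) Fl"
    if "B \<in> sets borel" for B
  proof -
    have "Int_stable (range (\<lambda>a. {..a::real}))"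
      by (rule Int_stableI_image) (metis Int_atMost UNIV_I)
    moreover have "range (\<lambda>a. {..a::real}) \<subseteq> Pow UNIV" by simp
    moreover have B': "B \<in> sigma_sets UNIV (range (\<lambda>a. {..a::real}))"
      using that unfolding borel_eq_atMost by (simp add: sets_measure_of)
    have sig: "sigma_sets UNIV (range (\<lambda>a. {..a::real})) = sets borel"
      unfolding borel_eq_atMost by (simp add: sets_measure_of)
    show ?thesis using calculation B'
    proof (induction rule: sigma_sets_induct_disjoint)
      case (basic B)
      then obtain b where b: "B = {..b}" by auto
      consider "b < 0" | "0 \<le> b" by linarith
      then show ?case
      proof cases
        case 1
        have "(LINT s|unit_interval. indicator B s *\<^sub>R q i s) = (LINT s|unit_interval. 0)" for i
          by (rule Bochner_Integration.integral_cong)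
            (use 1 in \<open>auto simp: b space_restrict_space\<close>)
        then show ?thesis by simp
      next
        case 2
        have "(LINT s|unit_interval. indicator B s *\<^sub>R q i s)
            = (LINT s|unit_interval. indicator {0..min b 1} s *\<^sub>R q i s)" for i
          by (rule Bochner_Integration.integral_cong)
            (auto simp: b space_restrict_space indicator_def)
        then show ?thesis using init[of "min b 1"] 2 by simp
      qed
    next
      case empty
      then show ?case by simp
    next
      case (compl B)
      have B: "B \<in> sets borel" using compl(1) sig by simp
      have "(LINT s|unit_interval. indicator (UNIV - B) s *\<^sub>R q i s)
          = (LINT s|unit_interval. indicator {0..1} s *\<^sub>R q i s)
            - (LINT s|unit_interval. indicator B s *\<^sub>R q i s)" for i
      proof -
        have "(LINT s|unit_interval. indicator (UNIV - B) s *\<^sub>R q i s)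
          = (LINT s|unit_interval. indicator {0..1} s *\<^sub>R q i s - indicator B s *\<^sub>R q i s)"
          by (rule Bochner_Integration.integral_cong) (auto simp: indicator_def space_restrict_space)
        also have "\<dots> = (LINT s|unit_interval. indicator {0..1} s *\<^sub>R q i s)
            - (LINT s|unit_interval. indicator B s *\<^sub>R q i s)"
          by (rule Bochner_Integration.integral_diff) (rule intble; simp add: B)+
        finally show ?thesis .
      qed
      then show ?case
        using tendsto_diff[OF init[of 1] compl(2)] by simp
    next
      case (union B)
      have B: "B n \<in> sets borel" for n using union(2) sig by auto
      have U: "(\<Union>n. B n) \<in> sets borel" using B by auto
      \<comment> \<open>The tails have small measure, hence contribute little, uniformly in \<open>i\<close>.\<close>
      define rest where "rest N = (\<Union>n. B n) - (\<Union>n<N. B n)" for N :: nat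
      have rest: "rest N \<in> sets borel" for N
        unfolding rest_def using B by auto
      have split: "(LINT s|unit_interval. indicator (\<Union>n. B n) s *\<^sub>R q i s)
          = (\<Sum>n<N. LINT s|unit_interval. indicator (B n) s *\<^sub>R q i s)
            + (LINT s|unit_interval. indicator (rest N) s *\<^sub>R q i s)" for i N
      proof -
        have "disjoint_family_on B {..<N}" using union(1) by (auto simp: disjoint_family_on_def)
        then have ind: "indicator (\<Union>n. B n) s
            = (\<Sum>n<N. indicator (B n) s) + (indicator (rest N) s :: real)" for s
          by (subst indicator_UN_disjoint[symmetric]) (auto simp: rest_def indicator_def)
        show ?thesis
          unfolding ind scaleR_add_left scaleR_sum_left
          by (simp only: Bochner_Integration.integral_add Bochner_Integration.integrable_sum
              Bochner_Integration.integral_sum intble B rest)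
      qed
      have rest_bound: "norm (LINT s|unit_interval. indicator (rest N) s *\<^sub>R q i s)
          \<le> \<bar>K\<bar> * (LINT s|unit_interval. indicator (rest N) s)" for i N
      proof -
        note [measurable] = rest
        have "integrable unit_interval (\<lambda>s. \<bar>K\<bar> * indicator (rest N) s)"
        proof (rule integrable_unit_interval_bounded[where K = "\<bar>K\<bar>"])
          show "(\<lambda>s. \<bar>K\<bar> * indicator (rest N) s) \<in> borel_measurable unit_interval"
            by (rule borel_measurable_unit_interval) measurable
        qed (auto simp: indicator_def)
        then have "norm (LINT s|unit_interval. indicator (rest N) s *\<^sub>R q i s)
            \<le> (LINT s|unit_interval. \<bar>K\<bar> * indicator (rest N) s)"
          using bound[of i] intble[OF rest, of N i]
          by (intro norm_integral_le_AE) (auto simp: indicator_def elim!: eventually_mono)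
        then show ?thesis by simp
      qed
      have "(\<lambda>N. LINT s|unit_interval. indicator (rest N) s) \<longlonglongrightarrow> (LINT s|unit_interval. (0::real))"
      proof (rule integral_dominated_convergence[where w = "\<lambda>_. 1"])
        show "(\<lambda>s. indicator (rest N) s :: real) \<in> borel_measurable unit_interval" for N
          by (rule borel_measurable_unit_interval) (use rest in measurable)
        show "AE s in unit_interval. (\<lambda>N. indicator (rest N) s :: real) \<longlonglongrightarrow> 0"
        proof (rule AE_I2)
          fix s
          have "eventually (\<lambda>N. indicator (rest N) s = (0::real)) sequentially"
          proof (cases "\<exists>n. s \<in> B n")
            case True
            then obtain n where "s \<in> B n" by blast
            then show ?thesis
              unfolding eventually_sequentially
              by (intro exI[of _ "Suc n"]) (auto simp: rest_def indicator_def)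
          qed (simp add: rest_def indicator_def)
          then show "(\<lambda>N. indicator (rest N) s :: real) \<longlonglongrightarrow> 0"
            by (rule tendsto_eventually)
        qed
      qed (auto simp: indicator_def)
      then have "(\<lambda>N. \<bar>K\<bar> * (LINT s|unit_interval. indicator (rest N) s)) \<longlonglongrightarrow> \<bar>K\<bar> * 0"
        by (intro tendsto_intros) simp
      then have small: "\<exists>N. \<bar>K\<bar> * (LINT s|unit_interval. indicator (rest N) s) < e" if "e > 0" for e
        using order_tendstoD(2)[of _ 0 sequentially e] that
        by (metis (no_types, lifting) eventually_happens' mult_zero_right sequentially_bot)
      show ?case
      proof (rule tendstoI)
        fix e :: real assume e: "e > 0"
        obtain N where N: "\<bar>K\<bar> * (LINT s|unit_interval. indicator (rest N) s) < e / 2"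
          using small[of "e / 2"] e by auto
        have "((\<lambda>i. \<Sum>n<N. LINT s|unit_interval. indicator (B n) s *\<^sub>R q i s) \<longlongrightarrow> (\<Sum>n<N. 0)) Fl"
          by (intro tendsto_sum union)
        then have "eventually (\<lambda>i. norm (\<Sum>n<N. LINT s|unit_interval. indicator (B n) s *\<^sub>R q i s) < e / 2) Fl"
          using tendstoD[where e = "e / 2"] e by (fastforce simp: dist_norm)
        then show "eventually (\<lambda>i. dist (LINT s|unit_interval. indicator (\<Union>n. B n) s *\<^sub>R q i s) 0 < e) Fl"
        proof eventually_elim
          case (elim i)
          show ?case
            unfolding split[of _ N] dist_norm diff_zero
            by (rule le_less_trans[OF norm_triangle_ineq]) (use elim N rest_bound[of N i] in linarith)
        qed
      qed
    qed
  qed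
  have "A \<in> sets lebesgue" "A \<subseteq> {0..1}"
    using A by (auto simp: sets_restrict_space)
  then obtain B where B: "B \<in> sets borel" "AE s in lborel. s \<in> A \<longleftrightarrow> s \<in> B"
  proof -
    have "main_part lborel A \<in> sets lborel" "A = main_part lborel A \<union> null_part lborel A"
      using main_part_null_part_Un[of A lborel] main_part_sets[of A lborel] \<open>A \<in> sets lebesgue\<close>
      by auto
    moreover obtain N where "N \<in> null_sets lborel" "null_part lborel A \<subseteq> N"
      using null_part[OF \<open>A \<in> sets lebesgue\<close>] by blast
    moreover from this(1) have "AE s in lborel. s \<notin> N" by (rule AE_not_in)
    ultimately show ?thesis
      by (intro that[of "main_part lborel A"]) (auto elim!: eventually_mono)
  qed
  have "(LINT s|unit_interval. indicator A s *\<^sub>R q i s) = (LINT s|unit_interval. indicator B s *\<^sub>R q i s)" for i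
  proof (rule integral_cong_AE)
    show "(\<lambda>s. indicator A s *\<^sub>R q i s) \<in> borel_measurable unit_interval" using A by measurable
    show "(\<lambda>s. indicator B s *\<^sub>R q i s) \<in> borel_measurable unit_interval"
      using intble[OF B(1)] by auto
    show "AE s in unit_interval. indicator A s *\<^sub>R q i s = indicator B s *\<^sub>R q i s"
      unfolding AE_unit_interval_iff using B(2) by eventually_elim (auto simp: indicator_def)
  qed
  then show ?thesis using borel[OF B(1)] by simp
qed

lemma AE_zero_if_initial_integrals_zero:
  fixes f :: "real \<Rightarrow> 'b::{banach, second_countable_topology}"
  assumes meas: "f \<in> borel_measurable unit_interval"
    and bound: "AE s in unit_interval. norm (f s) \<le> K"
    and init: "\<And>b. 0 \<le> b \<Longrightarrow> b \<le> 1 \<Longrightarrow> (LINT s|unit_interval. indicator {0..b} s *\<^sub>R f s) = 0"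
  shows "AE s in unit_interval. f s = 0"
proof (rule unit_interval.density_zero)
  show "integrable unit_interval f" by (rule integrable_unit_interval_bounded[OF meas bound])
  fix A assume "A \<in> sets unit_interval"
  then have "((\<lambda>i::nat. LINT s|unit_interval. indicator A s *\<^sub>R f s) \<longlongrightarrow> 0) sequentially"
    by (rule tendsto_integral_sets[OF meas bound, rotated]) (simp only: init tendsto_const)
  then show "set_lebesgue_integral unit_interval A f = 0"
    by (simp add: set_lebesgue_integral_def tendsto_const_iff)
qed

section \<open>Pairings and the weak-star topology\<close>

lemma bounded_linear_ell1_nth: "bounded_linear (\<lambda>x. ell1_nth x j)"
  by (rule bounded_linear_intro[where K = 1])
    (simp_all add: plus_ell1.rep_eq scaleR_ell1.rep_eq norm_ell1_nth_le)

lemma norm_ell1_mult_c0_nth_le: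
  fixes x :: "'a::real_normed_field ell1"
  shows "norm (ell1_nth x j * c0_nth y j) \<le> norm (ell1_nth x j) * norm y"
  by (simp add: norm_mult mult_left_mono norm_c0_nth_le)

lemma summable_norm_ell1_mult_c0:
  fixes x :: "'a::real_normed_field ell1"
  shows "summable (\<lambda>j. norm (ell1_nth x j * c0_nth y j))"
  by (rule summable_comparison_test'[OF summable_mult2[OF ell1_nth_summable[of x], of "norm y"], of 0])
    (simp del: norm_mult add: norm_ell1_mult_c0_nth_le)

lemma summable_ell1_mult_c0:
  fixes x :: "'a::{real_normed_field, banach} ell1"
  shows "summable (\<lambda>j. ell1_nth x j * c0_nth y j)"
  by (rule summable_norm_cancel[OF summable_norm_ell1_mult_c0])

lemma norm_ell1_c0_pairing_le:
  fixes x :: "'a::{real_normed_field, banach} ell1"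
  shows "norm (ell1_c0_pairing x y) \<le> norm x * norm y"
proof -
  have "norm (ell1_c0_pairing x y) \<le> (\<Sum>j. norm (ell1_nth x j * c0_nth y j))"
    unfolding ell1_c0_pairing_def by (rule summable_norm[OF summable_norm_ell1_mult_c0])
  also have "\<dots> \<le> (\<Sum>j. norm (ell1_nth x j) * norm y)"
    by (intro suminf_le norm_ell1_mult_c0_nth_le summable_norm_ell1_mult_c0
        summable_mult2 ell1_nth_summable)
  also have "\<dots> = norm x * norm y"
    by (simp add: norm_ell1.rep_eq suminf_mult2[OF ell1_nth_summable])
  finally show ?thesis .
qed

lemma bounded_bilinear_ell1_c0_pairing:
  "bounded_bilinear (ell1_c0_pairing :: 'a::{real_normed_field, banach} ell1 \<Rightarrow> 'a c0 \<Rightarrow> 'a)"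
proof
  fix x x' :: "'a ell1" and y y' :: "'a c0" and r :: real
  note summable = summable_ell1_mult_c0
  show "ell1_c0_pairing (x + x') y = ell1_c0_pairing x y + ell1_c0_pairing x' y"
    by (simp add: ell1_c0_pairing_def plus_ell1.rep_eq distrib_right suminf_add summable)
  show "ell1_c0_pairing x (y + y') = ell1_c0_pairing x y + ell1_c0_pairing x y'"
    by (simp add: ell1_c0_pairing_def plus_c0.rep_eq distrib_left suminf_add summable)
  show "ell1_c0_pairing (r *\<^sub>R x) y = r *\<^sub>R ell1_c0_pairing x y"
    by (simp add: ell1_c0_pairing_def scaleR_ell1.rep_eq suminf_scaleR_right summable)
  show "ell1_c0_pairing x (r *\<^sub>R y) = r *\<^sub>R ell1_c0_pairing x y"
    by (simp add: ell1_c0_pairing_def scaleR_c0.rep_eq suminf_scaleR_right summable)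
  show "\<exists>K. \<forall>(x::'a ell1) y. norm (ell1_c0_pairing x y) \<le> norm x * norm y * K"
    by (intro exI[of _ 1]) (simp add: norm_ell1_c0_pairing_le)
qed

interpretation ell1_c0: bounded_bilinear
  "ell1_c0_pairing :: 'a::{real_normed_field, banach} ell1 \<Rightarrow> 'a c0 \<Rightarrow> 'a"
  by (rule bounded_bilinear_ell1_c0_pairing)

lemma borel_measurable_ell1_c0_pairing [measurable (raw)]:
  fixes f :: "'m \<Rightarrow> 'a::{real_normed_field, euclidean_space} ell1"
  assumes "f \<in> borel_measurable M" "g \<in> borel_measurable M"
  shows "(\<lambda>x. ell1_c0_pairing (f x) (g x)) \<in> borel_measurable M"
  using assms by (rule borel_measurable_continuous_Pair)
    (intro ell1_c0.continuous_on continuous_on_fst continuous_on_snd continuous_on_id)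

lemma borel_measurable_ell1_nth [measurable (raw)]:
  fixes f :: "'m \<Rightarrow> 'a::{real_normed_field, euclidean_space} ell1"
  assumes "f \<in> borel_measurable M"
  shows "(\<lambda>x. ell1_nth (f x) j) \<in> borel_measurable M"
  using borel_measurable_continuous_on[OF linear_continuous_on[OF bounded_linear_ell1_nth] assms] .

text \<open>The \<open>j\<close>-th unit vector of \<open>c\<^sub>0\<close>.\<close>

lift_definition unit_c0 :: "nat \<Rightarrow> 'a::real_normed_field c0" is "\<lambda>j i. if i = j then 1 else 0"
  by (rule tendsto_eventually) (use eventually_gt_at_top in \<open>auto elim!: eventually_mono\<close>)

lemma ell1_c0_pairing_unit [simp]:
  fixes x :: "'a::{real_normed_field, banach} ell1"
  shows "ell1_c0_pairing x (unit_c0 j) = ell1_nth x j"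
proof -
  have "(\<lambda>i. ell1_nth x i * c0_nth (unit_c0 j) i) = (\<lambda>i. if i = j then ell1_nth x i else 0)"
    by (simp add: unit_c0.rep_eq fun_eq_iff)
  then show ?thesis unfolding ell1_c0_pairing_def
    by (simp add: sums_single[THEN sums_unique, symmetric])
qed

text \<open>Completeness of \<open>c\<^sub>0\<close> makes the induction principle for integrable functions available.\<close>

instance c0 :: (banach) banach
proof
  fix X :: "nat \<Rightarrow> 'a c0"
  assume X: "Cauchy X"
  have nth_le: "dist (c0_nth x i) (c0_nth y i) \<le> dist x y" for x y :: "'a c0" and i
    using norm_c0_nth_le[of "x - y" i] by (simp add: dist_norm minus_c0.rep_eq)
  have "Cauchy (\<lambda>n. c0_nth (X n) i)" for i
    using X nth_le unfolding Cauchy_def by (meson le_less_trans)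
  then have "\<exists>y. \<forall>i. (\<lambda>n. c0_nth (X n) i) \<longlonglongrightarrow> y i"
    by (intro choice allI) (simp add: Cauchy_convergent convergentD)
  then obtain y where y: "\<And>i. (\<lambda>n. c0_nth (X n) i) \<longlonglongrightarrow> y i" by blast
  have est: "\<exists>M. \<forall>m\<ge>M. \<forall>i. norm (c0_nth (X m) i - y i) \<le> e" if "e > 0" for e :: real
  proof -
    obtain M where M: "\<And>m n. m \<ge> M \<Longrightarrow> n \<ge> M \<Longrightarrow> dist (X m) (X n) < e"
      using metric_CauchyD[OF X \<open>e > 0\<close>] by blast
    have "norm (c0_nth (X m) i - y i) \<le> e" if "m \<ge> M" for m i
    proof (rule LIMSEQ_le_const2)
      show "(\<lambda>n. norm (c0_nth (X m) i - c0_nth (X n) i)) \<longlonglongrightarrow> norm (c0_nth (X m) i - y i)"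
        by (intro tendsto_intros y)
      show "\<exists>N. \<forall>n\<ge>N. norm (c0_nth (X m) i - c0_nth (X n) i) \<le> e"
        using M[OF that] nth_le by (metis dist_norm le_less_trans less_imp_le)
    qed
    then show ?thesis by blast
  qed
  have "y \<longlonglongrightarrow> 0"
  proof (rule LIMSEQ_I)
    fix e :: real assume "e > 0"
    then obtain M where M: "\<And>i. norm (c0_nth (X M) i - y i) \<le> e / 2"
      using est[of "e / 2"] by auto
    obtain N where N: "\<And>i. i \<ge> N \<Longrightarrow> norm (c0_nth (X M) i) < e / 2"
      using LIMSEQ_D[OF c0_nth_tendsto[of "X M"], of "e / 2"] \<open>e > 0\<close> by auto
    have "norm (y i) < e" if "i \<ge> N" for i
      using M[of i] N[OF that] norm_triangle_ineq3[of "c0_nth (X M) i" "y i"] by linarith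
    then show "\<exists>N. \<forall>i\<ge>N. norm (y i - 0) < e" by auto
  qed
  then obtain z where z: "\<And>i. c0_nth z i = y i"
    using Abs_c0_inverse[of y] by (metis mem_Collect_eq)
  have "X \<longlonglongrightarrow> z"
  proof (rule metric_LIMSEQ_I)
    fix e :: real assume "e > 0"
    then obtain M where M: "\<And>m i. m \<ge> M \<Longrightarrow> norm (c0_nth (X m) i - y i) \<le> e / 2"
      using est[of "e / 2"] by auto
    have "dist (X m) z < e" if "m \<ge> M" for m
    proof -
      have "norm (X m - z) \<le> e / 2"
        unfolding norm_c0.rep_eq
        by (rule cSUP_least) (use M[OF that] in \<open>simp_all add: minus_c0.rep_eq z\<close>)
      then show ?thesis using \<open>e > 0\<close> by (simp add: dist_norm)
    qed
    then show "\<exists>M. \<forall>m\<ge>M. dist (X m) z < e" by blast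
  qed
  then show "convergent X" by (rule convergentI)
qed

lemma Linf_norm_le_iff:
  fixes f :: "real \<Rightarrow> 'a::{real_normed_field, euclidean_space} ell1"
  assumes "f \<in> borel_measurable unit_interval"
  shows "Linf_norm f \<le> ereal C \<longleftrightarrow> (AE s in unit_interval. norm (f s) \<le> C)"
proof
  assume *: "Linf_norm f \<le> ereal C"
  have "AE s in unit_interval. ereal (norm (f s)) \<le> Linf_norm f"
    unfolding Linf_norm_def by (rule esssup_AE)
  then show "AE s in unit_interval. norm (f s) \<le> C"
    by eventually_elim (use * order_trans ereal_less_eq(3) in blast)
next
  assume "AE s in unit_interval. norm (f s) \<le> C"
  then show "Linf_norm f \<le> ereal C"
    unfolding Linf_norm_def by (intro esssup_I) (use assms in auto)
qed

lemma Linf_iff: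
  fixes f :: "real \<Rightarrow> 'a::{real_normed_field, euclidean_space} ell1"
  shows "f \<in> Linf J \<longleftrightarrow> f \<in> borel_measurable unit_interval \<and>
    (AE s in unit_interval. f s \<in> ell1_on J) \<and> (\<exists>K. AE s in unit_interval. norm (f s) \<le> K)"
proof -
  have "Linf_norm f < \<infinity> \<longleftrightarrow> (\<exists>K. AE s in unit_interval. norm (f s) \<le> K)"
    if f: "f \<in> borel_measurable unit_interval"
  proof
    assume "Linf_norm f < \<infinity>"
    then obtain r where "Linf_norm f \<le> ereal r"
      using less_PInf_Ex_of_nat[of "Linf_norm f"] less_imp_le by auto
    then show "\<exists>K. AE s in unit_interval. norm (f s) \<le> K"
      unfolding Linf_norm_le_iff[OF f] ..
  next
    assume "\<exists>K. AE s in unit_interval. norm (f s) \<le> K"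
    then obtain K where "Linf_norm f \<le> ereal K" unfolding Linf_norm_le_iff[OF f, symmetric] ..
    also have "\<dots> < \<infinity>" by simp
    finally show "Linf_norm f < \<infinity>" .
  qed
  then show ?thesis unfolding Linf_def by auto
qed

lemma Linf_measurable: "f \<in> Linf J \<Longrightarrow> f \<in> borel_measurable unit_interval"
  by (simp add: Linf_def)

lemma ell1_on_diff: "x \<in> ell1_on J \<Longrightarrow> y \<in> ell1_on J \<Longrightarrow> x - y \<in> ell1_on J"
  by (simp add: ell1_on_def minus_ell1.rep_eq)

lemma ell1_on_scaleR: "x \<in> ell1_on J \<Longrightarrow> r *\<^sub>R x \<in> ell1_on J"
  by (simp add: ell1_on_def scaleR_ell1.rep_eq)

lemma Linf_diff: 
  assumes "f \<in> Linf J" "g \<in> Linf J" shows "(\<lambda>s. f s - g s) \<in> Linf J"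
proof -
  from assms obtain K L where K: "AE s in unit_interval. norm (f s) \<le> K"
    and L: "AE s in unit_interval. norm (g s) \<le> L" by (auto simp: Linf_iff)
  from K L have "AE s in unit_interval. norm (f s - g s) \<le> K + L"
    by eventually_elim (meson add_mono norm_triangle_ineq4 order_trans)
  moreover have "AE s in unit_interval. f s - g s \<in> ell1_on J"
    using assms unfolding Linf_iff by (auto elim: eventually_elim2 intro: ell1_on_diff)
  moreover have "(\<lambda>s. f s - g s) \<in> borel_measurable unit_interval"
    using assms by (auto simp: Linf_iff)
  ultimately show ?thesis unfolding Linf_iff by blast
qed

lemma Linf_scaleR: 
  assumes "f \<in> Linf J" shows "(\<lambda>s. r *\<^sub>R f s) \<in> Linf J"
proof -
  from assms obtain K where K: "AE s in unit_interval. norm (f s) \<le> K" by (auto simp: Linf_iff)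
  from K have "AE s in unit_interval. norm (r *\<^sub>R f s) \<le> \<bar>r\<bar> * K"
    by eventually_elim (simp add: mult_left_mono)
  moreover have "AE s in unit_interval. r *\<^sub>R f s \<in> ell1_on J"
    using assms unfolding Linf_iff by (auto elim!: eventually_mono intro: ell1_on_scaleR)
  moreover have "(\<lambda>s. r *\<^sub>R f s) \<in> borel_measurable unit_interval"
    by (intro borel_measurable_scaleR borel_measurable_const Linf_measurable[OF assms(1)])
  ultimately show ?thesis unfolding Linf_iff by blast
qed

lemma integrable_pairing:
  fixes f :: "real \<Rightarrow> 'a::{real_normed_field, euclidean_space} ell1"
  assumes "f \<in> Linf J" "integrable unit_interval g"
  shows "integrable unit_interval (\<lambda>s. ell1_c0_pairing (f s) (g s))"
proof -
  obtain K where K: "AE s in unit_interval. norm (f s) \<le> K" using assms by (auto simp: Linf_iff)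
  show ?thesis
  proof (rule Bochner_Integration.integrable_bound)
    show "integrable unit_interval (\<lambda>s. \<bar>K\<bar> * norm (g s))"
      using assms(2) by (intro integrable_mult_right integrable_norm)
    show "(\<lambda>s. ell1_c0_pairing (f s) (g s)) \<in> borel_measurable unit_interval"
      using assms(1) assms(2) by (intro borel_measurable_ell1_c0_pairing) (auto simp: Linf_iff)
    show "AE s in unit_interval. norm (ell1_c0_pairing (f s) (g s)) \<le> norm (\<bar>K\<bar> * norm (g s))"
      using K
    proof eventually_elim
      case (elim s)
      have "norm (ell1_c0_pairing (f s) (g s)) \<le> norm (f s) * norm (g s)"
        by (rule norm_ell1_c0_pairing_le)
      also have "\<dots> \<le> \<bar>K\<bar> * norm (g s)" using elim by (intro mult_right_mono) auto
      finally show ?case by simp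
    qed
  qed
qed

lemma norm_Linf_pairing_le:
  fixes f :: "real \<Rightarrow> 'a::{real_normed_field, euclidean_space} ell1"
  assumes f: "f \<in> Linf J" "AE s in unit_interval. norm (f s) \<le> K" and g: "integrable unit_interval g"
  shows "norm (Linf_pairing f g) \<le> K * (LINT s|unit_interval. norm (g s))"
proof -
  have "norm (Linf_pairing f g) \<le> (LINT s|unit_interval. K * norm (g s))"
    unfolding Linf_pairing_def
  proof (rule norm_integral_le_AE)
    show "AE s in unit_interval. norm (ell1_c0_pairing (f s) (g s)) \<le> K * norm (g s)"
      using f(2) by eventually_elim (meson mult_right_mono norm_ell1_c0_pairing_le norm_ge_zero order_trans)
  qed (use integrable_pairing[OF f(1) g] g in auto)
  then show ?thesis by simp
qed

lemma Linf_pairing_diff_left: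
  assumes "f \<in> Linf J" "f' \<in> Linf J" "integrable unit_interval g"
  shows "Linf_pairing (\<lambda>s. f s - f' s) g = Linf_pairing f g - Linf_pairing f' g"
  unfolding Linf_pairing_def ell1_c0.diff_left
  using integrable_pairing[OF assms(1,3)] integrable_pairing[OF assms(2,3)]
  by (rule Bochner_Integration.integral_diff)

lemma Linf_pairing_scaleR_left:
  "Linf_pairing (\<lambda>s. r *\<^sub>R f s) g = r *\<^sub>R Linf_pairing f g"
  unfolding Linf_pairing_def ell1_c0.scaleR_left by simp

lemma Linf_pairing_cong_AE:
  assumes "f \<in> Linf J" "f' \<in> Linf J" "integrable unit_interval g"
    and "AE s in unit_interval. f s = f' s"
  shows "Linf_pairing f g = Linf_pairing f' g"
  unfolding Linf_pairing_def
proof (rule integral_cong_AE)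
  show "AE s in unit_interval. ell1_c0_pairing (f s) (g s) = ell1_c0_pairing (f' s) (g s)"
    using assms(4) by eventually_elim simp
qed (use integrable_pairing[OF assms(1,3)] integrable_pairing[OF assms(2,3)] in auto)

text \<open>The integral of the \<open>j\<close>-th coordinate over \<open>[0,b]\<close>, which is the pairing with
  \<open>1\<^bsub>[0,b]\<^esub> e\<^sub>j\<close>.\<close>

definition coord_mean :: "(real \<Rightarrow> 'a::{real_normed_field, euclidean_space} ell1) \<Rightarrow> nat \<Rightarrow> real \<Rightarrow> 'a"
  where "coord_mean f j b = (LINT s|unit_interval. indicator {0..b} s *\<^sub>R ell1_nth (f s) j)"

lemma coord_mean_eq_pairing:
  "coord_mean f j b = Linf_pairing f (\<lambda>s. indicator {0..b} s *\<^sub>R unit_c0 j)"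
  unfolding coord_mean_def Linf_pairing_def by (simp add: ell1_c0.scaleR_right)

lemma integrable_indicator_unit_c0:
  "integrable unit_interval (\<lambda>s. indicator {0..b} s *\<^sub>R (unit_c0 j :: 'a::{real_normed_field, euclidean_space} c0))"
  by (rule integrable_unit_interval_bounded[where K = "norm (unit_c0 j :: 'a c0)"])
    (auto intro!: borel_measurable_unit_interval simp: indicator_def)

lemma indicator_unit_c0_in_L1_c0:
  "j \<in> J \<Longrightarrow> (\<lambda>s. indicator {0..b} s *\<^sub>R (unit_c0 j :: 'a::{real_normed_field, euclidean_space} c0)) \<in> L1_c0 J"
  unfolding L1_c0_def
  by (auto simp: integrable_indicator_unit_c0 c0_on_def scaleR_c0.rep_eq unit_c0.rep_eq)

text \<open>The functions \<open>1\<^bsub>[0,b]\<^esub> e\<^sub>j\<close> span a dense subspace of \<open>L\<^sup>1([0,1], c\<^sub>0)\<close>; hence, on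
  norm-bounded families, they detect weak-star convergence.\<close>

lemma tendsto_Linf_pairing_zero:
  fixes q :: "'i \<Rightarrow> real \<Rightarrow> 'a::{real_normed_field, euclidean_space} ell1"
  assumes q: "\<And>i. q i \<in> Linf J"
    and bound: "\<And>i. AE s in unit_interval. norm (q i s) \<le> K"
    and init: "\<And>j b. j \<in> J \<Longrightarrow> 0 \<le> b \<Longrightarrow> b \<le> 1 \<Longrightarrow> ((\<lambda>i. coord_mean (q i) j b) \<longlongrightarrow> 0) Fl"
    and h: "integrable unit_interval h"
  shows "((\<lambda>i. Linf_pairing (q i) h) \<longlongrightarrow> 0) Fl"
  using h
proof (induction rule: integrable_induct)
  case (base A y)
  have qm: "(\<lambda>s. ell1_nth (q i s) j) \<in> borel_measurable unit_interval" for i j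
    using q[of i] by (auto simp: Linf_iff)
  have sets: "((\<lambda>i. LINT s|unit_interval. indicator A s *\<^sub>R ell1_nth (q i s) j) \<longlongrightarrow> 0) Fl" for j
  proof (cases "j \<in> J")
    case True
    show ?thesis
    proof (rule tendsto_integral_sets[where K = K, OF qm _ _ base(1)])
      show "AE s in unit_interval. norm (ell1_nth (q i s) j) \<le> K" for i
        using bound[of i] by eventually_elim (meson norm_ell1_nth_le order_trans)
    qed (use init[OF True] in \<open>simp add: coord_mean_def\<close>)
  next
    case False
    have "(LINT s|unit_interval. indicator A s *\<^sub>R ell1_nth (q i s) j) = (LINT s|unit_interval. 0)" for i
    proof (rule integral_cong_AE)
      have "AE s in unit_interval. q i s \<in> ell1_on J" using q[of i] by (simp add: Linf_iff)
      then show "AE s in unit_interval. indicator A s *\<^sub>R ell1_nth (q i s) j = 0"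
        by eventually_elim (use False in \<open>auto simp: ell1_on_def\<close>)
    qed (use base(1) qm in measurable)
    then show ?thesis by simp
  qed
  \<comment> \<open>The pairing with \<open>1\<^sub>A y\<close> is the pairing of \<open>y\<close> with the integral of \<open>q i\<close> over \<open>A\<close>; the tail of
    \<open>y \<in> c\<^sub>0\<close> is uniformly negligible, and finitely many coordinates remain.\<close>
  define I where "I i j = (LINT s|unit_interval. indicator A s *\<^sub>R ell1_nth (q i s) j)" for i j
  define V where "V i = (LINT s|unit_interval. indicator A s *\<^sub>R q i s)" for i
  have int: "integrable unit_interval (\<lambda>s. indicator A s *\<^sub>R q i s)" for i
  proof (rule integrable_unit_interval_bounded[where K = "\<bar>K\<bar>"])
    show "(\<lambda>s. indicator A s *\<^sub>R q i s) \<in> borel_measurable unit_interval"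
      using base(1) Linf_measurable[OF q[of i]] by measurable
    show "AE s in unit_interval. norm (indicator A s *\<^sub>R q i s) \<le> \<bar>K\<bar>"
      using bound[of i] by eventually_elim (auto simp: indicator_def)
  qed
  have V_nth: "ell1_nth (V i) j = I i j" for i j
    unfolding V_def I_def
    by (subst integral_bounded_linear[OF bounded_linear_ell1_nth int, symmetric])
      (simp add: scaleR_ell1.rep_eq)
  have V_norm: "norm (V i) \<le> \<bar>K\<bar>" for i
  proof -
    have "norm (V i) \<le> (LINT s|unit_interval. \<bar>K\<bar>)"
      unfolding V_def using bound[of i]
      by (intro norm_integral_le_AE int) (auto simp: indicator_def elim!: eventually_mono)
    also have "\<dots> = \<bar>K\<bar>"
      by (simp add: measure_restrict_space space_restrict_space)
    finally show ?thesis .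
  qed
  have pair: "Linf_pairing (q i) (\<lambda>s. indicator A s *\<^sub>R y) = ell1_c0_pairing (V i) y" for i
    unfolding V_def Linf_pairing_def
    by (subst integral_bounded_linear[OF ell1_c0.bounded_linear_left int, symmetric])
      (simp add: ell1_c0.scaleR_left ell1_c0.scaleR_right)
  have "((\<lambda>i. ell1_c0_pairing (V i) y) \<longlongrightarrow> 0) Fl"
  proof (rule tendstoI)
    fix e :: real assume e: "e > 0"
    define d where "d = e / (2 * (\<bar>K\<bar> + 1))"
    have d: "d > 0" using e by (simp add: d_def)
    obtain N where N: "\<And>j. j \<ge> N \<Longrightarrow> norm (c0_nth y j) < d"
      using LIMSEQ_D[OF c0_nth_tendsto[of y] d] by auto
    have le: "norm (ell1_c0_pairing x y)
        \<le> norm (\<Sum>j<N. ell1_nth x j * c0_nth y j) + norm x * d" for x :: "'a ell1"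
    proof -
      have sN: "summable (\<lambda>j. norm (ell1_nth x (j + N)))"
        using ell1_nth_summable[of x] by (subst summable_iff_shift)
      have sN': "summable (\<lambda>j. norm (ell1_nth x (j + N) * c0_nth y (j + N)))"
        using summable_norm_ell1_mult_c0[of x y] summable_iff_shift[of "\<lambda>j. norm (ell1_nth x j * c0_nth y j)" N]
        by simp
      have "ell1_c0_pairing x y = (\<Sum>j. ell1_nth x (j + N) * c0_nth y (j + N))
          + (\<Sum>j<N. ell1_nth x j * c0_nth y j)"
        unfolding ell1_c0_pairing_def by (rule suminf_split_initial_segment[OF summable_ell1_mult_c0])
      moreover have "norm (\<Sum>j. ell1_nth x (j + N) * c0_nth y (j + N)) \<le> norm x * d"
      proof -
        have "norm (\<Sum>j. ell1_nth x (j + N) * c0_nth y (j + N))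
            \<le> (\<Sum>j. norm (ell1_nth x (j + N) * c0_nth y (j + N)))"
          by (rule summable_norm[OF sN'])
        also have "\<dots> \<le> (\<Sum>j. norm (ell1_nth x (j + N)) * d)"
          by (intro suminf_le sN' summable_mult2 sN)
            (simp add: norm_mult mult_left_mono less_imp_le N)
        also have "\<dots> = (\<Sum>j. norm (ell1_nth x (j + N))) * d"
          by (rule suminf_mult2[OF sN, symmetric])
        also have "\<dots> \<le> norm x * d"
          using suminf_split_initial_segment[OF ell1_nth_summable[of x], of N] d
          by (intro mult_right_mono) (auto simp: norm_ell1.rep_eq sum_nonneg)
        finally show ?thesis .
      qed
      ultimately show ?thesis
        using norm_triangle_ineq[of "\<Sum>j. ell1_nth x (j + N) * c0_nth y (j + N)"] by (smt (verit))
    qed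
    have "((\<lambda>i. \<Sum>j<N. I i j * c0_nth y j) \<longlongrightarrow> (\<Sum>j<N. 0 * c0_nth y j)) Fl"
      unfolding I_def by (intro tendsto_sum tendsto_mult tendsto_const sets)
    then have "eventually (\<lambda>i. norm (\<Sum>j<N. I i j * c0_nth y j) < e / 2) Fl"
      using tendstoD[where e = "e / 2"] e by (fastforce simp: dist_norm)
    then show "eventually (\<lambda>i. dist (ell1_c0_pairing (V i) y) 0 < e) Fl"
    proof eventually_elim
      case (elim i)
      have "norm (V i) * d \<le> \<bar>K\<bar> * d" using V_norm d by (intro mult_right_mono) auto
      also have "\<dots> \<le> e / 2" using e by (simp add: d_def field_simps)
      finally show ?case using le[of "V i"] elim by (simp add: V_nth)
    qed
  qed
  then show ?case by (simp add: pair)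
next
  case (add f g)
  have "Linf_pairing (q i) (\<lambda>s. f s + g s) = Linf_pairing (q i) f + Linf_pairing (q i) g" for i
    unfolding Linf_pairing_def ell1_c0.add_right
    by (intro Bochner_Integration.integral_add integrable_pairing[OF q] add)
  then show ?case using tendsto_add[OF add(3,4)] by simp
next
  case (lim h s)
  have "(\<lambda>n. LINT x|unit_interval. norm (h x - s n x)) \<longlonglongrightarrow> (LINT x|unit_interval. (0::real))"
  proof (rule integral_dominated_convergence[where w = "\<lambda>x. 3 * norm (h x)"])
    show "(\<lambda>x. norm (h x - s n x)) \<in> borel_measurable unit_interval" for n
      using lim(1,4) by auto
    show "integrable unit_interval (\<lambda>x. 3 * norm (h x))" using lim(4) by auto
    show "AE x in unit_interval. (\<lambda>n. norm (h x - s n x)) \<longlonglongrightarrow> 0"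
    proof (rule AE_I2)
      fix x assume "x \<in> space unit_interval"
      from tendsto_norm[OF tendsto_diff[OF tendsto_const[of "h x"] lim(2)[OF this]]]
      show "(\<lambda>n. norm (h x - s n x)) \<longlonglongrightarrow> 0" by simp
    qed
    show "AE x in unit_interval. norm (norm (h x - s n x)) \<le> 3 * norm (h x)" for n
    proof (rule AE_I2)
      fix x assume "x \<in> space unit_interval"
      then show "norm (norm (h x - s n x)) \<le> 3 * norm (h x)"
        using lim(3)[of x n] norm_triangle_ineq4[of "h x" "s n x"] by simp
    qed
  qed simp
  then have L: "(\<lambda>n. \<bar>K\<bar> * (LINT x|unit_interval. norm (h x - s n x))) \<longlonglongrightarrow> \<bar>K\<bar> * 0"
    by (intro tendsto_intros) simp
  show ?case
  proof (rule tendstoI)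
    fix e :: real assume e: "e > 0"
    obtain n where n: "\<bar>K\<bar> * (LINT x|unit_interval. norm (h x - s n x)) < e / 2"
      using order_tendstoD(2)[OF L, of "e / 2"] e eventually_happens'[OF sequentially_bot]
      by (metis (no_types, lifting) half_gt_zero mult_zero_right)
    have hs: "integrable unit_interval (\<lambda>x. h x - s n x)" using lim(1,4) by auto
    have le: "norm (Linf_pairing (q i) h) \<le> norm (Linf_pairing (q i) (s n)) + e / 2" for i
    proof -
      have "Linf_pairing (q i) (\<lambda>x. h x - s n x) = Linf_pairing (q i) h - Linf_pairing (q i) (s n)"
        unfolding Linf_pairing_def ell1_c0.diff_right
        by (intro Bochner_Integration.integral_diff integrable_pairing[OF q] lim)
      moreover have "norm (Linf_pairing (q i) (\<lambda>x. h x - s n x))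
          \<le> \<bar>K\<bar> * (LINT x|unit_interval. norm (h x - s n x))"
        by (rule norm_Linf_pairing_le[OF q _ hs])
          (use bound[of i] in \<open>eventually_elim, simp\<close>)
      ultimately show ?thesis
        using n norm_triangle_ineq2[of "Linf_pairing (q i) h" "Linf_pairing (q i) (s n)"]
        by simp
    qed
    have "eventually (\<lambda>i. dist (Linf_pairing (q i) (s n)) 0 < e / 2) Fl"
      using tendstoD[OF lim(5)[of n], of "e / 2"] e by simp
    then show "eventually (\<lambda>i. dist (Linf_pairing (q i) h) 0 < e) Fl"
    proof eventually_elim
      case (elim i)
      then show ?case using le[of i] by simp
    qed
  qed
qed

lemma openin_weak_star_subbasis:
  assumes "g \<in> L1_c0 J" "open V"
  shows "openin (weak_star J) {f \<in> Linf J. Linf_pairing f g \<in> V}"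
  unfolding weak_star_def by (rule topology_generated_by_Basis) (use assms in blast)

lemma zero_in_L1_c0: "(\<lambda>s. 0) \<in> L1_c0 J"
  by (simp add: L1_c0_def c0_on_def zero_c0.rep_eq)

lemma openin_weak_star_Linf: "openin (weak_star J) (Linf J)"
  using openin_weak_star_subbasis[OF zero_in_L1_c0 open_UNIV] by simp

lemma topspace_weak_star: "topspace (weak_star J) = Linf J"
proof
  show "topspace (weak_star J) \<subseteq> Linf J"
    unfolding weak_star_def topology_generated_by_topspace by auto
qed (rule openin_subset[OF openin_weak_star_Linf])

lemma limitin_weak_star_iff:
  "limitin (weak_star J) f l Fl \<longleftrightarrow> l \<in> Linf J \<and> eventually (\<lambda>i. f i \<in> Linf J) Fl \<and>
    (\<forall>g\<in>L1_c0 J. ((\<lambda>i. Linf_pairing (f i) g) \<longlongrightarrow> Linf_pairing l g) Fl)" (is "?L \<longleftrightarrow> ?R")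
proof
  assume L: ?L
  then have l: "l \<in> Linf J" by (simp add: limitin_def topspace_weak_star)
  moreover have "eventually (\<lambda>i. f i \<in> Linf J) Fl"
    using L l openin_weak_star_Linf unfolding limitin_def by blast
  moreover have "((\<lambda>i. Linf_pairing (f i) g) \<longlongrightarrow> Linf_pairing l g) Fl" if g: "g \<in> L1_c0 J" for g
  proof (rule topological_tendstoI)
    fix V assume "open V" "Linf_pairing l g \<in> V"
    then have "eventually (\<lambda>i. f i \<in> {f \<in> Linf J. Linf_pairing f g \<in> V}) Fl"
      using L l openin_weak_star_subbasis[OF g] unfolding limitin_def by blast
    then show "eventually (\<lambda>i. Linf_pairing (f i) g \<in> V) Fl" by eventually_elim simp
  qed
  ultimately show ?R by blast
next
  assume R: ?R
  have "l \<in> U \<longrightarrow> eventually (\<lambda>i. f i \<in> U) Fl" if "openin (weak_star J) U" for U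
  proof -
    from that have "generate_topology_on
        {{f \<in> Linf J. Linf_pairing f g \<in> V} | g V. g \<in> L1_c0 J \<and> open V} U"
      unfolding weak_star_def by (rule openin_topology_generated_by)
    then show ?thesis
    proof induction
      case (UN K)
      then show ?case by (fastforce elim: eventually_mono)
    next
      case (Basis s)
      then obtain g V where s: "s = {f \<in> Linf J. Linf_pairing f g \<in> V}" and g: "g \<in> L1_c0 J" and V: "open V"
        by blast
      show ?case
      proof
        assume "l \<in> s"
        then have "eventually (\<lambda>i. Linf_pairing (f i) g \<in> V) Fl"
          using R g V s by (auto dest: topological_tendstoD)
        with R show "eventually (\<lambda>i. f i \<in> s) Fl"
          unfolding s by (auto elim: eventually_elim2)
      qed
    qed (auto elim: eventually_elim2)
  qed
  with R show ?L by (auto simp: limitin_def topspace_weak_star)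
qed

lemma continuous_map_weak_star_iff:
  fixes S :: "'t::topological_space set"
  shows "continuous_map (top_of_set S) (weak_star J) f \<longleftrightarrow> (\<forall>t\<in>S. f t \<in> Linf J) \<and>
    (\<forall>g\<in>L1_c0 J. continuous_on S (\<lambda>t. Linf_pairing (f t) g))"
proof -
  have "atin (top_of_set S) t = at t within S" if "t \<in> S" for t
    using that unfolding atin_subtopology_within[OF that] filter_eq_iff
    by (auto simp: eventually_atin_within eventually_at_topological)
  moreover have "eventually (\<lambda>r. f r \<in> Linf J) (at t within S)" if "\<forall>t\<in>S. f t \<in> Linf J" for t
    using that by (auto simp: eventually_at_filter)
  ultimately show ?thesis
    by (auto simp: continuous_map_atin limitin_weak_star_iff continuous_on_def)
qed

section \<open>Smooth bump functions\<close>

text \<open>The functions \<open>e\<^sup>-\<^sup>1\<^sup>/\<^sup>y y\<^sup>-\<^sup>k\<close>, extended by 0 to \<open>y \<le> 0\<close>. The derivative of one of them is a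
  combination of two others, which is how smoothness is obtained.\<close>

definition flat :: "nat \<Rightarrow> real \<Rightarrow> real"
  where "flat k y = (if y > 0 then exp (- inverse y) * inverse y ^ k else 0)"

lemma flat_tendsto_0: "(flat k \<longlongrightarrow> 0) (at 0)"
proof -
  have "((\<lambda>y. inverse y ^ k / exp (inverse y)) \<longlongrightarrow> 0) (at_right (0::real))"
    by (rule filterlim_compose[OF tendsto_power_div_exp_0 filterlim_inverse_at_top_right])
  then have "(flat k \<longlongrightarrow> 0) (at_right 0)"
    by (rule Lim_transform_eventually)
      (auto simp: flat_def exp_minus field_simps intro!: eventually_mono[OF eventually_at_right_less])
  moreover have "(flat k \<longlongrightarrow> 0) (at_left 0)"
    by (rule tendsto_eventually) (auto simp: flat_def eventually_at_filter)
  ultimately show ?thesis by (simp add: filterlim_at_split)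
qed

lemma DERIV_flat:
  "(flat k has_field_derivative flat (Suc (Suc k)) y - real k * flat (Suc k) y) (at y)"
proof -
  consider "y > 0" | "y < 0" | "y = 0" by linarith
  then show ?thesis
  proof cases
    case 1
    have pow: "real k * inverse y ^ (k - Suc 0) * inverse y = real k * inverse y ^ k"
      by (cases k) simp_all
    have "((\<lambda>y. exp (- inverse y) * inverse y ^ k) has_field_derivative
        exp (- inverse y) * inverse y * inverse y * inverse y ^ k
        - (real k * inverse y ^ (k - Suc 0) * inverse y) * inverse y * exp (- inverse y)) (at y)"
      using 1 by (auto intro!: derivative_eq_intros simp: algebra_simps)
    then have "((\<lambda>y. exp (- inverse y) * inverse y ^ k) has_field_derivative
        flat (Suc (Suc k)) y - real k * flat (Suc k) y) (at y)"
      using 1 unfolding pow by (simp add: flat_def algebra_simps)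
    then show ?thesis
      by (rule has_field_derivative_transform_within_open[where S = "{0<..}"])
        (use 1 in \<open>auto simp: flat_def\<close>)
  next
    case 2
    have "((\<lambda>y. 0) has_field_derivative flat (Suc (Suc k)) y - real k * flat (Suc k) y) (at y)"
      using 2 by (simp add: flat_def)
    then show ?thesis
      by (rule has_field_derivative_transform_within_open[where S = "{..<0}"])
        (use 2 in \<open>auto simp: flat_def\<close>)
  next
    case 3
    have "(\<lambda>h. (flat k (0 + h) - flat k 0) / h) = flat (Suc k)"
      by (auto simp: fun_eq_iff flat_def field_simps)
    then have "(flat k has_field_derivative 0) (at 0)"
      using flat_tendsto_0[of "Suc k"] by (simp add: DERIV_def)
    with 3 show ?thesis by (simp add: flat_def)
  qed
qed

text \<open>The linear span of the functions \<open>p(x) flat\<^sub>k(q(x))\<close> with polynomials \<open>p\<close> and \<open>q\<close>. It contains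
  bump functions and is closed under differentiation, so all its elements are smooth.\<close>

inductive_set flat_span :: "(real \<Rightarrow> real) set" where
  base: "(\<lambda>x. poly p x * flat k (poly q x)) \<in> flat_span"
| add: "f \<in> flat_span \<Longrightarrow> g \<in> flat_span \<Longrightarrow> (\<lambda>x. f x + g x) \<in> flat_span"

lemma flat_span_scale: "f \<in> flat_span \<Longrightarrow> (\<lambda>x. c * f x) \<in> flat_span"
proof (induction rule: flat_span.induct)
  case (base p k q)
  have "(\<lambda>x. c * (poly p x * flat k (poly q x))) = (\<lambda>x. poly (smult c p) x * flat k (poly q x))"
    by (simp add: mult.assoc)
  then show ?case using flat_span.base[of "smult c p" k q] by metis
next
  case (add f g)
  then show ?case using flat_span.add by (simp add: distrib_left)
qed

lemma flat_span_has_deriv: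
  "f \<in> flat_span \<Longrightarrow> \<exists>f'\<in>flat_span. \<forall>x. (f has_field_derivative f' x) (at x)"
proof (induction rule: flat_span.induct)
  case (base p k q)
  let ?f' = "\<lambda>x. poly (pderiv p) x * flat k (poly q x)
    + (poly (p * pderiv q) x * flat (Suc (Suc k)) (poly q x)
    + poly (smult (- real k) (p * pderiv q)) x * flat (Suc k) (poly q x))"
  have "?f' \<in> flat_span" by (intro flat_span.intros)
  moreover have "((\<lambda>x. poly p x * flat k (poly q x)) has_field_derivative ?f' x) (at x)" for x
    by (rule derivative_eq_intros poly_DERIV DERIV_chain2[OF DERIV_flat] refl)+
      (simp add: algebra_simps)
  ultimately show ?case by (intro bexI[of _ ?f']) auto
next
  case (add f g)
  then obtain f' g' where "f' \<in> flat_span" "g' \<in> flat_span"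
      "\<And>x. (f has_field_derivative f' x) (at x)" "\<And>x. (g has_field_derivative g' x) (at x)"
    by blast
  then show ?case
    by (intro bexI[of _ "\<lambda>x. f' x + g' x"]) (auto intro: flat_span.add derivative_intros)
qed

lemma flat_span_deriv:
  assumes "f \<in> flat_span"
  shows "deriv f \<in> flat_span" "f field_differentiable at x" "isCont f x"
proof -
  obtain f' where f': "f' \<in> flat_span" "\<And>x. (f has_field_derivative f' x) (at x)"
    using flat_span_has_deriv[OF assms] by blast
  have "deriv f = f'" using f'(2) by (auto intro: DERIV_imp_deriv)
  then show "deriv f \<in> flat_span" using f'(1) by simp
  show "f field_differentiable at x" using f'(2) field_differentiable_def by blast
  show "isCont f x" using f'(2) DERIV_isCont by blast
qed

lemma flat_span_iterated_deriv: "f \<in> flat_span \<Longrightarrow> (deriv ^^ n) f \<in> flat_span"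
  by (induction n) (auto intro: flat_span_deriv)

lemma closed_support_subset:
  assumes "\<And>x::real. \<phi> x \<noteq> 0 \<Longrightarrow> x \<in> {lo..hi}" "0 < lo" "hi < 1"
  shows "closure {x. \<phi> x \<noteq> (0::real)} \<subseteq> {0<..<1}"
proof -
  have "closure {x. \<phi> x \<noteq> 0} \<subseteq> {lo..hi}"
    by (rule closure_minimal) (use assms(1) in auto)
  then show ?thesis using assms(2,3) by auto
qed

lemma test_function_flat_span:
  assumes "f \<in> flat_span" "\<And>x. f x \<noteq> 0 \<Longrightarrow> x \<in> {lo..hi}" "0 < lo" "hi < 1"
  shows "test_function f"
  unfolding test_function_def
  using closed_support_subset[of f, OF assms(2-4)] flat_span_deriv(2)[OF flat_span_iterated_deriv[OF assms(1)]]
  by blast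

text \<open>An element of this space with integral 0 whose support is compact in \<open>(0,1)\<close> is the derivative
  of a test function.\<close>

lemma test_function_primitive:
  assumes f: "f \<in> flat_span" and supp: "\<And>x. f x \<noteq> 0 \<Longrightarrow> x \<in> {lo..hi}" "0 < lo" "lo \<le> hi" "hi < 1"
    and int0: "(LBINT x:{0..1}. f x) = 0"
  obtains \<phi> where "test_function \<phi>" "deriv \<phi> = f"
proof -
  have cont: "isCont f x" for x by (rule flat_span_deriv(3)[OF f])
  obtain F where F: "\<And>x. (F has_field_derivative f x) (at x)"
  proof -
    have "\<exists>F. \<forall>x. -\<infinity> < ereal x \<longrightarrow> ereal x < \<infinity> \<longrightarrow> (F has_vector_derivative f x) (at x)"
      by (rule einterval_antiderivative) (use cont in auto)
    then show ?thesis using that by (auto simp: has_real_derivative_iff_has_vector_derivative)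
  qed
  define \<phi> where "\<phi> x = F x - F 0" for x
  have D: "(\<phi> has_field_derivative f x) (at x)" for x
    unfolding \<phi>_def by (rule derivative_eq_intros F refl)+ simp
  have deriv: "deriv \<phi> = f" using D by (auto intro: DERIV_imp_deriv)
  have zero_outside: "f x = 0" if "x \<notin> {lo..hi}" for x using supp(1) that by blast
  have "F 1 - F 0 = (LBINT x. f x * indicator {0..1} x)"
    by (rule integral_FTC_Icc_real[symmetric]) (use F cont in auto)
  also have "\<dots> = 0" using int0 by (simp add: set_lebesgue_integral_def mult.commute)
  finally have one: "\<phi> 1 = 0" by (simp add: \<phi>_def)
  have const: "\<phi> x = \<phi> y" if "convex S" "x \<in> S" "y \<in> S" "\<And>z. z \<in> S \<Longrightarrow> f z = 0" for x y S
  proof -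
    have "\<exists>c. \<forall>z\<in>S. \<phi> z = c"
    proof (rule has_field_derivative_zero_constant[OF that(1)])
      fix z assume "z \<in> S"
      then show "(\<phi> has_field_derivative 0) (at z within S)"
        using has_field_derivative_at_within[OF D[of z]] that(4)[of z] by simp
    qed
    then show ?thesis using that(2,3) by auto
  qed
  have "\<phi> x = 0" if "x \<notin> {lo..hi}" for x
  proof (cases "x < lo")
    case True
    then have "\<phi> x = \<phi> 0"
      by (intro const[of "{..<lo}"]) (use supp(2) in \<open>simp_all add: zero_outside\<close>)
    then show ?thesis by (simp add: \<phi>_def)
  next
    case False
    then have "\<phi> x = \<phi> 1"
      by (intro const[of "{hi<..}"]) (use supp(4) that in \<open>simp_all add: zero_outside\<close>)
    then show ?thesis by (simp add: one)
  qed
  then have supp\<phi>: "\<phi> x \<noteq> 0 \<Longrightarrow> x \<in> {lo..hi}" for x by blast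
  have "(deriv ^^ n) \<phi> field_differentiable at x" for n x
  proof (cases n)
    case 0
    then show ?thesis using D field_differentiable_def by auto
  next
    case (Suc m)
    have "(deriv ^^ n) \<phi> = (deriv ^^ m) f" by (simp add: Suc funpow_swap1 deriv)
    then show ?thesis using flat_span_deriv(2)[OF flat_span_iterated_deriv[OF f]] by simp
  qed
  then have "test_function \<phi>"
    using closed_support_subset[of \<phi>, OF supp\<phi> supp(2,4)] by (simp add: test_function_def)
  then show ?thesis using that deriv by blast
qed

text \<open>A bump on \<open>[a,b]\<close>; as \<open>m\<close> grows it increases to the indicator function of \<open>(a,b)\<close>.\<close>

definition bump :: "real \<Rightarrow> real \<Rightarrow> real \<Rightarrow> real \<Rightarrow> real"
  where "bump m a b x = flat 0 (m * (x - a) * (b - x))"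

lemma bump_in_flat_span: "bump m a b \<in> flat_span"
proof -
  have "bump m a b = (\<lambda>x. poly 1 x * flat 0 (poly ([:m:] * [:-a, 1:] * [:b, -1:]) x))"
    by (simp add: bump_def fun_eq_iff algebra_simps)
  then show ?thesis using flat_span.base by metis
qed

lemma bump_support: "m > 0 \<Longrightarrow> a \<le> b \<Longrightarrow> bump m a b x \<noteq> 0 \<Longrightarrow> x \<in> {a..b}"
  by (auto simp: bump_def flat_def zero_less_mult_iff mult_less_0_iff split: if_splits)

lemma bump_pos: "m > 0 \<Longrightarrow> a < x \<Longrightarrow> x < b \<Longrightarrow> bump m a b x > 0"
  by (simp add: bump_def flat_def)

lemma bump_bounds: "0 \<le> bump m a b x" "bump m a b x \<le> 1"
proof -
  have "0 \<le> flat 0 y" "flat 0 y \<le> 1" for y by (simp_all add: flat_def)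
  then show "0 \<le> bump m a b x" "bump m a b x \<le> 1" by (simp_all add: bump_def)
qed

lemma bump_measurable [measurable]: "bump m a b \<in> borel_measurable borel"
  using flat_span_deriv(3)[OF bump_in_flat_span]
  by (intro borel_measurable_continuous_onI continuous_at_imp_continuous_on) blast

lemma bump_tendsto_indicator:
  assumes "0 < b" "x \<noteq> 0" "x \<noteq> b"
  shows "(\<lambda>n. bump (real n) (1 / real n) (b - 1 / real n) x) \<longlonglongrightarrow> indicator {0..b} x"
proof (cases "0 < x \<and> x < b")
  case True
  have lim: "filterlim (\<lambda>n. real n * (x - 1 / real n) * (b - 1 / real n - x)) at_top sequentially"
    using True by real_asymp
  have "((\<lambda>y::real. exp (- inverse y)) \<longlongrightarrow> exp (- 0)) at_top"
    by (intro tendsto_intros tendsto_inverse_0_at_top filterlim_ident)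
  from filterlim_compose[OF this lim]
  have *: "(\<lambda>n. exp (- inverse (real n * (x - 1 / real n) * (b - 1 / real n - x)))) \<longlonglongrightarrow> 1"
    by simp
  have "eventually (\<lambda>n. real n * (x - 1 / real n) * (b - 1 / real n - x) > 0) sequentially"
    using lim by (simp add: filterlim_at_top_dense)
  then have "eventually (\<lambda>n. exp (- inverse (real n * (x - 1 / real n) * (b - 1 / real n - x)))
      = bump (real n) (1 / real n) (b - 1 / real n) x) sequentially"
    by eventually_elim (simp add: bump_def flat_def)
  from Lim_transform_eventually[OF * this] True show ?thesis by simp
next
  case False
  have "filterlim (\<lambda>n. b - 2 / real n) (nhds b) sequentially" by real_asymp
  then have "eventually (\<lambda>n. b - 2 / real n > 0) sequentially"
    using order_tendstoD(1) assms(1) by blast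
  then have "eventually (\<lambda>n. bump (real n) (1 / real n) (b - 1 / real n) x = indicator {0..b} x) sequentially"
    using eventually_gt_at_top[of 0]
  proof eventually_elim
    case (elim n)
    have "x \<notin> {1 / real n..b - 1 / real n}"
    proof
      assume x: "x \<in> {1 / real n..b - 1 / real n}"
      then have "1 / real n \<le> x" "x \<le> b - 1 / real n" by auto
      moreover have "1 / real n > 0" using elim by simp
      ultimately have "0 < x \<and> x < b" by linarith
      then show False using False by blast
    qed
    then have "bump (real n) (1 / real n) (b - 1 / real n) x = 0"
      using bump_support[of "real n" "1 / real n" "b - 1 / real n" x] elim by auto
    moreover have "x \<notin> {0..b}" using False assms by auto
    ultimately show ?case by simp
  qed
  then show ?thesis by (rule tendsto_eventually)
qed

text \<open>The fundamental lemma of the calculus of variations: bumps approximate the indicator functions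
  of initial intervals boundedly and almost everywhere.\<close>

lemma AE_zero_if_test_integrals_zero:
  fixes f :: "real \<Rightarrow> 'b::{banach, second_countable_topology}"
  assumes meas [measurable]: "f \<in> borel_measurable unit_interval"
    and bound: "AE s in unit_interval. norm (f s) \<le> K"
    and zero: "\<And>\<phi> lo hi. \<phi> \<in> flat_span \<Longrightarrow> (\<And>x. \<phi> x \<noteq> 0 \<Longrightarrow> x \<in> {lo..hi}) \<Longrightarrow> 0 < lo \<Longrightarrow> lo \<le> hi \<Longrightarrow> hi < 1
      \<Longrightarrow> (LINT s|unit_interval. \<phi> s *\<^sub>R f s) = 0"
  shows "AE s in unit_interval. f s = 0"
proof (rule AE_zero_if_initial_integrals_zero[OF meas bound])
  fix b :: real assume b: "0 \<le> b" "b \<le> 1"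
  show "(LINT s|unit_interval. indicator {0..b} s *\<^sub>R f s) = 0"
  proof (cases "b = 0")
    case True
    have "AE s in unit_interval. indicator {0..b} s *\<^sub>R f s = 0"
      unfolding AE_unit_interval_iff using AE_lborel_singleton[of 0]
      by eventually_elim (auto simp: True indicator_def)
    then show ?thesis by (rule integral_eq_zero_AE)
  next
    case False
    define \<phi> where "\<phi> n = bump (real n) (1 / real n) (b - 1 / real n)" for n
    have [measurable]: "\<phi> n \<in> borel_measurable unit_interval" for n
      unfolding \<phi>_def by (rule borel_measurable_unit_interval) measurable
    have [measurable]: "(indicator {0..b} :: real \<Rightarrow> real) \<in> borel_measurable unit_interval"
      by (rule borel_measurable_unit_interval) measurable
    have "(\<lambda>n. LINT s|unit_interval. \<phi> n s *\<^sub>R f s) \<longlonglongrightarrow> (LINT s|unit_interval. indicator {0..b} s *\<^sub>R f s)"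
    proof (rule integral_dominated_convergence[where w = "\<lambda>_. \<bar>K\<bar>"])
      show "AE s in unit_interval. norm (\<phi> n s *\<^sub>R f s) \<le> \<bar>K\<bar>" for n
        using bound
      proof eventually_elim
        case (elim s)
        have "\<bar>\<phi> n s\<bar> * norm (f s) \<le> 1 * \<bar>K\<bar>"
          by (rule mult_mono) (use elim bump_bounds in \<open>auto simp: \<phi>_def\<close>)
        then show ?case by simp
      qed
      have "AE s in unit_interval. s \<noteq> c" for c
        unfolding AE_unit_interval_iff using AE_lborel_singleton[of c] by eventually_elim simp
      from this[of 0] this[of b] show "AE s in unit_interval. (\<lambda>n. \<phi> n s *\<^sub>R f s) \<longlonglongrightarrow> indicator {0..b} s *\<^sub>R f s"
        by eventually_elim
          (use b False bump_tendsto_indicator in \<open>auto simp: \<phi>_def intro!: tendsto_scaleR\<close>)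
    qed auto
    moreover have "eventually (\<lambda>n. (LINT s|unit_interval. \<phi> n s *\<^sub>R f s) = 0) sequentially"
    proof -
      have "filterlim (\<lambda>n. b - 2 / real n) (nhds b) sequentially" by real_asymp
      then have "eventually (\<lambda>n. b - 2 / real n > 0) sequentially"
        using order_tendstoD(1) b False by (metis order_le_less)
      then show ?thesis
        using eventually_gt_at_top[of 0]
      proof eventually_elim
        case (elim n)
        have n: "1 / real n > 0" "1 / real n \<le> b - 1 / real n"
          using elim by (simp_all add: field_simps)
        then have "b - 1 / real n < 1" using b by linarith
        then show ?case
          unfolding \<phi>_def using bump_support[of "real n" "1 / real n" "b - 1 / real n"] n elim
          by (intro zero[OF bump_in_flat_span]) auto
      qed
    qed
    ultimately show ?thesis
      by (blast intro: LIMSEQ_unique[OF _ tendsto_eventually])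
  qed
qed

text \<open>Du Bois-Reymond's lemma. A multiple of a fixed bump \<open>\<psi>\<close> is subtracted from a given function
  \<open>\<phi>\<close> so that the difference has vanishing integral and is therefore a derivative.\<close>

lemma AE_constant_if_weak_deriv_zero:
  fixes f :: "real \<Rightarrow> 'b::{banach, second_countable_topology}"
  assumes meas [measurable]: "f \<in> borel_measurable unit_interval"
    and bound: "AE s in unit_interval. norm (f s) \<le> K"
    and zero: "\<And>\<phi>. test_function \<phi> \<Longrightarrow> (LINT s|unit_interval. deriv \<phi> s *\<^sub>R f s) = 0"
  obtains a where "AE s in unit_interval. f s = a"
proof -
  define \<psi> where "\<psi> = bump 1 (1/4) (3/4)"
  have [measurable]: "\<psi> \<in> borel_measurable borel" by (simp add: \<psi>_def)
  have \<psi>_supp: "x \<in> {1/4..3/4}" if "\<psi> x \<noteq> 0" for x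
    using bump_support[of 1 "1/4" "3/4" x] that by (simp add: \<psi>_def)
  define p where "p = (LBINT x:{0..1}. \<psi> x)"
  have int\<psi>: "set_integrable lborel {0..1} \<psi>"
    by (rule borel_integrable_atLeastAtMost')
      (auto intro!: continuous_at_imp_continuous_on flat_span_deriv(3) bump_in_flat_span simp: \<psi>_def)
  have p: "p > 0"
  proof -
    have "p \<ge> 0" unfolding p_def set_lebesgue_integral_def
      by (intro Bochner_Integration.integral_nonneg) (auto simp: \<psi>_def bump_bounds)
    moreover have "p \<noteq> 0"
    proof
      assume "p = 0"
      then have "AE x in lborel. indicator {0..1} x *\<^sub>R \<psi> x = 0"
        unfolding p_def set_lebesgue_integral_def
        using int\<psi>[unfolded set_integrable_def]
        by (subst (asm) integral_nonneg_eq_0_iff_AE) (auto simp: \<psi>_def bump_bounds)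
      then have "AE x in lebesgue. x \<in> {1/4<..<3/4::real} \<longrightarrow> x \<in> {}"
        unfolding AE_completion_iff
        by eventually_elim (use bump_pos[of 1 "1/4" _ "3/4"] in \<open>force simp: \<psi>_def indicator_def\<close>)
      from mem_closed_if_AE_lebesgue_open[OF _ _ this, of "1/2"] show False by auto
    qed
    ultimately show ?thesis by simp
  qed
  define a where "a = (1 / p) *\<^sub>R (LINT s|unit_interval. \<psi> s *\<^sub>R f s)"
  have int: "integrable unit_interval (\<lambda>s. \<phi> s *\<^sub>R f s)" if "\<phi> \<in> flat_span" for \<phi>
    using flat_span_deriv(3)[OF that]
    by (intro integrable_continuous_scaleR[OF _ meas bound] continuous_at_imp_continuous_on) blast
  have "AE s in unit_interval. f s - a = 0"
  proof (rule AE_zero_if_test_integrals_zero[where K = "K + norm a"])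
    show "(\<lambda>s. f s - a) \<in> borel_measurable unit_interval" by measurable
    show "AE s in unit_interval. norm (f s - a) \<le> K + norm a"
      using bound by eventually_elim (meson add_right_mono norm_triangle_ineq4 order_trans)
    fix \<phi> lo hi
    assume \<phi>: "\<phi> \<in> flat_span" "\<And>x. \<phi> x \<noteq> 0 \<Longrightarrow> x \<in> {lo..hi}" "0 < lo" "lo \<le> (hi::real)" "hi < 1"
    have cont: "continuous_on {0..1} \<phi>" "continuous_on UNIV \<phi>"
      using flat_span_deriv(3)[OF \<phi>(1)] by (simp_all add: continuous_at_imp_continuous_on)
    have [measurable]: "\<phi> \<in> borel_measurable borel"
      by (rule borel_measurable_continuous_onI[OF cont(2)])
    have int\<phi>: "set_integrable lborel {0..1} \<phi>"
      by (rule borel_integrable_atLeastAtMost'[OF cont(1)])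
    define c where "c = (LBINT x:{0..1}. \<phi> x) / p"
    define \<eta> where "\<eta> x = \<phi> x + (- c) * \<psi> x" for x
    have \<eta>: "\<eta> \<in> flat_span"
      unfolding \<eta>_def[abs_def] \<psi>_def by (intro flat_span.add \<phi>(1) flat_span_scale bump_in_flat_span)
    have "(LBINT x:{0..1}. \<eta> x) = (LBINT x:{0..1}. \<phi> x) + (- c) * p"
      unfolding \<eta>_def p_def set_integral_mult_right[symmetric]
      by (intro set_integral_add(2) set_integrable_mult_right int\<phi> int\<psi>)
    then have "(LBINT x:{0..1}. \<eta> x) = 0" using p by (simp add: c_def)
    moreover have "x \<in> {min lo (1/4)..max hi (3/4)}" if "\<eta> x \<noteq> 0" for x
    proof -
      from that have "\<phi> x \<noteq> 0 \<or> \<psi> x \<noteq> 0" by (auto simp: \<eta>_def)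
      then show ?thesis using \<phi>(2)[of x] \<psi>_supp[of x] by (auto simp: min_le_iff_disj le_max_iff_disj)
    qed
    ultimately obtain \<Phi> where \<Phi>: "test_function \<Phi>" "deriv \<Phi> = \<eta>"
      using test_function_primitive[OF \<eta>, of "min lo (1/4)" "max hi (3/4)"] \<phi>(3-5)
      by (auto simp: min_le_iff_disj le_max_iff_disj)
    have "0 = (LINT s|unit_interval. \<phi> s *\<^sub>R f s - c *\<^sub>R (\<psi> s *\<^sub>R f s))"
      using zero[OF \<Phi>(1)] unfolding \<Phi>(2) \<eta>_def by (simp add: algebra_simps)
    also have "\<dots> = (LINT s|unit_interval. \<phi> s *\<^sub>R f s) - c *\<^sub>R (LINT s|unit_interval. \<psi> s *\<^sub>R f s)"
      unfolding integral_scaleR_right[symmetric] \<psi>_def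
      by (intro Bochner_Integration.integral_diff integrable_scaleR_right int \<phi>(1) bump_in_flat_span)
    finally have eq: "(LINT s|unit_interval. \<phi> s *\<^sub>R f s) = c *\<^sub>R (p *\<^sub>R a)"
      using p by (simp add: a_def)
    have "integrable unit_interval \<phi>"
      using int\<phi> unfolding set_integrable_def
      by (subst integrable_restrict_space) (auto simp: integrable_completion)
    moreover have "(LINT s|unit_interval. \<phi> s) = (LBINT x:{0..1}. \<phi> x)"
      by (rule integral_unit_interval) measurable
    ultimately have "(LINT s|unit_interval. \<phi> s *\<^sub>R a) = (LBINT x:{0..1}. \<phi> x) *\<^sub>R a" "integrable unit_interval (\<lambda>s. \<phi> s *\<^sub>R a)"
      by auto
    then show "(LINT s|unit_interval. \<phi> s *\<^sub>R (f s - a)) = 0"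
      unfolding scaleR_diff_right using int[OF \<phi>(1)] eq p
      by (subst Bochner_Integration.integral_diff) (auto simp: c_def)
  qed
  then show ?thesis using that by simp
qed

section \<open>Primitives and weak derivatives\<close>

text \<open>The primitive of \<open>g\<close> with value \<open>a\<close> at 0, as a Bochner integral; it is constant on the negative
  half line, where \<open>{0..x}\<close> is empty.\<close>

definition antideriv :: "'b::{banach, second_countable_topology} \<Rightarrow> (real \<Rightarrow> 'b) \<Rightarrow> real \<Rightarrow> 'b"
  where "antideriv a g x = a + (LBINT r:{0..x}. g r)"

lemma set_integrable_bounded:
  fixes g :: "real \<Rightarrow> 'b::{banach, second_countable_topology}"
  assumes [measurable]: "g \<in> borel_measurable borel" and "\<And>s. norm (g s) \<le> K"
  shows "set_integrable lborel {x..y} g"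
proof (rule set_integrable_bound)
  show "set_integrable lborel {x..y} (\<lambda>_. K)"
    by (rule borel_integrable_atLeastAtMost') simp
  show "set_borel_measurable lborel {x..y} g"
    unfolding set_borel_measurable_def by measurable
  show "AE s in lborel. s \<in> {x..y} \<longrightarrow> norm (g s) \<le> norm K"
    by (intro AE_I2) (auto intro: order_trans[OF assms(2) abs_ge_self])
qed

lemma set_integral_norm_le:
  fixes g :: "real \<Rightarrow> 'b::{banach, second_countable_topology}"
  assumes [measurable]: "g \<in> borel_measurable borel" and bound: "\<And>s. norm (g s) \<le> K" and "x \<le> y"
  shows "norm (LBINT s:{x..y}. g s) \<le> K * (y - x)"
proof -
  have "norm (LBINT s:{x..y}. g s) \<le> (LBINT s:{x..y}. K)"
    unfolding set_lebesgue_integral_def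
    by (rule norm_integral_le_AE)
      (use set_integrable_bounded[OF assms(1,2)] borel_integrable_atLeastAtMost'[of x y "\<lambda>_. K"] bound
       in \<open>auto simp: set_integrable_def indicator_def\<close>)
  also have "\<dots> = K * (y - x)"
    using \<open>x \<le> y\<close> by (simp add: set_lebesgue_integral_def)
  finally show ?thesis .
qed

lemma set_integral_Icc_combine:
  fixes g :: "real \<Rightarrow> 'b::{banach, second_countable_topology}"
  assumes [measurable]: "g \<in> borel_measurable borel" and "\<And>s. norm (g s) \<le> K" "x \<le> y" "y \<le> z"
  shows "(LBINT s:{x..z}. g s) = (LBINT s:{x..y}. g s) + (LBINT s:{y..z}. g s)"
proof -
  have "(LBINT s:{x..y}. g s) + (LBINT s:{y..z}. g s)
      = (LBINT s. indicator {x..y} s *\<^sub>R g s + indicator {y..z} s *\<^sub>R g s)"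
    unfolding set_lebesgue_integral_def
    using set_integrable_bounded[OF assms(1,2)]
    by (intro Bochner_Integration.integral_add[symmetric]) (auto simp: set_integrable_def)
  also have "\<dots> = (LBINT s:{x..z}. g s)"
    unfolding set_lebesgue_integral_def
  proof (rule integral_cong_AE)
    show "AE s in lborel. indicator {x..y} s *\<^sub>R g s + indicator {y..z} s *\<^sub>R g s = indicator {x..z} s *\<^sub>R g s"
      using AE_lborel_singleton[of y]
      by eventually_elim (use assms(3,4) in \<open>auto simp: indicator_def\<close>)
  qed measurable
  finally show ?thesis ..
qed

lemma antideriv_diff:
  assumes "g \<in> borel_measurable borel" "\<And>s. norm (g s) \<le> K" "0 \<le> x" "x \<le> y"
  shows "antideriv a g y - antideriv a g x = (LBINT s:{x..y}. g s)"
  using set_integral_Icc_combine[OF assms] by (simp add: antideriv_def)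

lemma antideriv_0: "antideriv a g 0 = a"
proof -
  have "(LBINT r:{0..0}. g r) = 0"
    unfolding set_lebesgue_integral_def
    by (rule integral_eq_zero_AE)
      (use AE_lborel_singleton[of 0] in \<open>eventually_elim, auto simp: indicator_def\<close>)
  then show ?thesis by (simp add: antideriv_def)
qed

lemma antideriv_Lipschitz:
  assumes g: "g \<in> borel_measurable borel" "\<And>s. norm (g s) \<le> K"
  shows "norm (antideriv a g y - antideriv a g x) \<le> K * \<bar>y - x\<bar>"
proof -
  have neg: "antideriv a g (max 0 x) = antideriv a g x" for x
  proof (cases "x < 0")
    case True
    then show ?thesis using antideriv_0[of a g] by (simp add: antideriv_def set_lebesgue_integral_def)
  qed (simp add: max_def)
  have *: "norm (antideriv a g y - antideriv a g x) \<le> K * (y - x)" if "x \<le> y" for x y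
  proof -
    have "norm (antideriv a g (max 0 y) - antideriv a g (max 0 x)) \<le> K * (max 0 y - max 0 x)"
      using that by (subst antideriv_diff[OF g]) (auto intro!: set_integral_norm_le[OF g])
    also have "\<dots> \<le> K * (y - x)"
      using that order_trans[OF norm_ge_zero g(2)] by (intro mult_left_mono) auto
    finally show ?thesis by (simp only: neg)
  qed
  show ?thesis using *[of x y] *[of y x] by (cases "x \<le> y") (auto simp: norm_minus_commute)
qed

lemma continuous_on_antideriv:
  assumes g: "g \<in> borel_measurable borel" "\<And>s. norm (g s) \<le> K"
  shows "continuous_on S (antideriv a g)"
proof (rule continuous_on_subset[OF lipschitz_on_continuous_on])
  show "lipschitz_on K UNIV (antideriv a g)"
    by (rule lipschitz_onI)
      (use antideriv_Lipschitz[OF g] order_trans[OF norm_ge_zero g(2)] in \<open>auto simp: dist_norm\<close>)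
qed simp

lemma borel_measurable_antideriv:
  assumes "g \<in> borel_measurable borel" "\<And>s. norm (g s) \<le> K"
  shows "antideriv a g \<in> borel_measurable borel"
  by (rule borel_measurable_continuous_onI[OF continuous_on_antideriv[OF assms]])

lemma ell1_nth_set_integral:
  fixes g :: "real \<Rightarrow> 'a::{real_normed_field, euclidean_space} ell1"
  assumes "g \<in> borel_measurable borel" "\<And>s. norm (g s) \<le> K"
  shows "ell1_nth (LBINT s:{x..y}. g s) j = (LBINT s:{x..y}. ell1_nth (g s) j)"
  using integral_bounded_linear[OF bounded_linear_ell1_nth
      set_integrable_bounded[OF assms, of x y, unfolded set_integrable_def], of j]
  by (simp add: set_lebesgue_integral_def scaleR_ell1.rep_eq)

lemma antideriv_ell1_on:
  fixes g :: "real \<Rightarrow> 'a::{real_normed_field, euclidean_space} ell1"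
  assumes g: "g \<in> borel_measurable borel" "\<And>s. norm (g s) \<le> K"
    and J: "\<And>s. g s \<in> ell1_on J" "a \<in> ell1_on J"
  shows "antideriv a g x \<in> ell1_on J"
proof -
  have "ell1_nth (LBINT s:{0..x}. g s) j = 0" if "j \<notin> J" for j
    unfolding ell1_nth_set_integral[OF g] using J(1) that by (simp add: ell1_on_def)
  then show ?thesis using J(2) by (simp add: antideriv_def ell1_on_def plus_ell1.rep_eq)
qed

text \<open>Integration by parts for a Bochner primitive, by Fubini's theorem.\<close>

lemma integral_by_parts_antideriv:
  fixes g :: "real \<Rightarrow> 'b::{banach, second_countable_topology}"
  assumes g [measurable]: "g \<in> borel_measurable borel" and bound: "\<And>s. norm (g s) \<le> K"
    and \<phi>: "\<And>x. (\<phi> has_field_derivative \<phi>' x) (at x)" "\<And>x. isCont \<phi>' x" "\<phi> 0 = 0" "\<phi> 1 = 0"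
  shows "(LBINT s:{0..1}. \<phi>' s *\<^sub>R antideriv a g s) = - (LBINT s:{0..1}. \<phi> s *\<^sub>R g s)"
proof -
  have cont: "continuous_on S \<phi>'" for S using \<phi>(2) by (simp add: continuous_at_imp_continuous_on)
  have [measurable]: "\<phi>' \<in> borel_measurable borel" by (rule borel_measurable_continuous_onI[OF cont])
  obtain C where "\<forall>y\<in>\<phi>' ` {0..1}. norm y \<le> C"
    using compact_imp_bounded[OF compact_continuous_image[OF cont compact_Icc]]
    unfolding bounded_iff by blast
  then have C: "\<bar>\<phi>' x\<bar> \<le> C" if "0 \<le> x" "x \<le> 1" for x using that by auto
  have K: "K \<ge> 0" using order_trans[OF norm_ge_zero bound] .
  have FTC: "(LBINT s:{r..1}. \<phi>' s) = - \<phi> r" if "r \<le> 1" for r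
    using integral_FTC_Icc_real[of r 1 \<phi> \<phi>'] that \<phi>
    by (simp add: set_lebesgue_integral_def mult.commute)
  define k where "k s r = (if 0 \<le> r \<and> r \<le> s \<and> s \<le> 1 then \<phi>' s else 0) *\<^sub>R g r" for s r
  have "integrable (lborel \<Otimes>\<^sub>M lborel) (case_prod k)"
  proof (rule Bochner_Integration.integrable_bound)
    have "emeasure (lborel \<Otimes>\<^sub>M lborel) ({0..1::real} \<times> {0..1::real}) < \<infinity>"
      by (subst lborel.emeasure_pair_measure_Times) auto
    then show "integrable (lborel \<Otimes>\<^sub>M lborel) (\<lambda>p. (C * K) * indicator ({0..1::real} \<times> {0..1::real}) p)"
      by (intro integrable_mult_right integrable_real_indicator) auto
    show "case_prod k \<in> borel_measurable (lborel \<Otimes>\<^sub>M lborel)"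
      unfolding k_def by measurable
    show "AE p in lborel \<Otimes>\<^sub>M lborel. norm (case_prod k p)
        \<le> norm ((C * K) * indicator ({0..1::real} \<times> {0..1::real}) p)"
    proof (rule AE_I2)
      fix p :: "real \<times> real"
      obtain s r where p: "p = (s, r)" by (cases p)
      show "norm (case_prod k p) \<le> norm ((C * K) * indicator ({0..1::real} \<times> {0..1::real}) p)"
      proof (cases "0 \<le> r \<and> r \<le> s \<and> s \<le> 1")
        case True
        then have "\<bar>\<phi>' s\<bar> * norm (g r) \<le> C * K" using K C[of s] bound[of r] by (intro mult_mono) auto
        also have "\<dots> \<le> \<bar>C * K\<bar>" by simp
        finally show ?thesis using True by (simp add: p k_def)
      qed (auto simp: p k_def)
    qed
  qed
  then have fub: "(LBINT r. LBINT s. k s r) = (LBINT s. LBINT r. k s r)"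
    by (rule lborel_pair.Fubini_integral)
  have inner_r: "(LBINT r. k s r) = indicator {0..1} s *\<^sub>R (\<phi>' s *\<^sub>R (LBINT r:{0..s}. g r))" for s
  proof (cases "s \<in> {0..1}")
    case True
    then have "k s r = \<phi>' s *\<^sub>R (indicator {0..s} r *\<^sub>R g r)" for r by (auto simp: k_def indicator_def)
    then have "(LBINT r. k s r) = \<phi>' s *\<^sub>R (LBINT r:{0..s}. g r)"
      unfolding set_lebesgue_integral_def by (simp only: integral_scaleR_right)
    then show ?thesis using True by simp
  next
    case False
    then have "k s r = 0" for r by (auto simp: k_def)
    then show ?thesis using False by simp
  qed
  have inner_s: "(LBINT s. k s r) = - (indicator {0..1} r *\<^sub>R (\<phi> r *\<^sub>R g r))" for r
  proof (cases "r \<in> {0..1}")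
    case True
    have "(LBINT s. k s r) = (LBINT s. (indicator {r..1} s *\<^sub>R \<phi>' s) *\<^sub>R g r)"
      by (rule Bochner_Integration.integral_cong) (use True in \<open>auto simp: k_def indicator_def\<close>)
    also have "\<dots> = (LBINT s:{r..1}. \<phi>' s) *\<^sub>R g r"
      unfolding set_lebesgue_integral_def
      using borel_integrable_atLeastAtMost'[OF cont, of r 1]
      by (intro integral_scaleR_left) (simp add: set_integrable_def)
    finally show ?thesis using True FTC by simp
  next
    case False
    then have "k s r = 0" for s by (auto simp: k_def)
    then show ?thesis using False by simp
  qed
  have parts: "(LBINT s:{0..1}. \<phi>' s *\<^sub>R (LBINT r:{0..s}. g r)) = - (LBINT s:{0..1}. \<phi> s *\<^sub>R g s)"
    using fub unfolding inner_r inner_s by (simp add: set_lebesgue_integral_def)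
  have int1: "set_integrable lborel {0..1} (\<lambda>s. \<phi>' s *\<^sub>R a)"
    by (rule borel_integrable_atLeastAtMost') (intro continuous_intros cont)
  have int2: "set_integrable lborel {0..1} (\<lambda>s. \<phi>' s *\<^sub>R (LBINT r:{0..s}. g r))"
  proof -
    have "continuous_on {0..1} (\<lambda>s. LBINT r:{0..s}. g r)"
      using continuous_on_antideriv[OF g bound, of _ 0] by (simp add: antideriv_def[abs_def])
    then show ?thesis
      by (intro borel_integrable_atLeastAtMost' continuous_on_scaleR cont)
  qed
  have "(LBINT s:{0..1}. \<phi>' s *\<^sub>R a) = (LBINT s:{0..1}. \<phi>' s) *\<^sub>R a"
    using integral_scaleR_left[of a lborel "\<lambda>s. indicator {0..1} s *\<^sub>R \<phi>' s"]
      borel_integrable_atLeastAtMost'[OF cont, of 0 1]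
    by (simp add: set_lebesgue_integral_def set_integrable_def)
  then have "(LBINT s:{0..1}. \<phi>' s *\<^sub>R a) = 0" using FTC[of 0] \<phi>(3) by simp
  then show ?thesis
    unfolding antideriv_def scaleR_add_right using set_integral_add(2)[OF int1 int2] parts by simp
qed

lemma test_function_props:
  assumes "test_function \<phi>"
  shows "(\<phi> has_field_derivative deriv \<phi> x) (at x)" "isCont (deriv \<phi>) x" "isCont \<phi> x" "\<phi> 0 = 0" "\<phi> 1 = 0"
proof -
  have d: "(deriv ^^ n) \<phi> field_differentiable at x" for n x
    using assms by (simp add: test_function_def)
  show "(\<phi> has_field_derivative deriv \<phi> x) (at x)"
    using d[of 0 x] by (simp add: DERIV_deriv_iff_field_differentiable)
  then show "isCont \<phi> x" by (rule DERIV_isCont)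
  have "deriv \<phi> field_differentiable at x" using d[of 1 x] by simp
  then show "isCont (deriv \<phi>) x" by (rule field_differentiable_imp_continuous_at)
  have "x \<in> {0<..<1}" if "\<phi> x \<noteq> 0" for x
    using assms closure_subset[of "{x. \<phi> x \<noteq> 0}"] that unfolding test_function_def by blast
  from this[of 0] this[of 1] show "\<phi> 0 = 0" "\<phi> 1 = 0" by auto
qed

text \<open>A Borel function on the whole line that is bounded by \<open>K\<close> and \<open>\<ell>\<^sup>1(J)\<close>-valued everywhere, not only
  almost everywhere. Every element of \<open>L\<^sup>\<infinity>\<close> has such a representative.\<close>

definition nice :: "nat set \<Rightarrow> real \<Rightarrow> (real \<Rightarrow> 'a::{real_normed_field, euclidean_space} ell1) \<Rightarrow> bool"
  where "nice J K g \<longleftrightarrow> g \<in> borel_measurable borel \<and> (\<forall>s. norm (g s) \<le> K) \<and> (\<forall>s. g s \<in> ell1_on J)"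

lemma niceD:
  assumes "nice J K g"
  shows "g \<in> borel_measurable borel" "norm (g s) \<le> K" "g s \<in> ell1_on J"
  using assms by (auto simp: nice_def)

lemma closed_ell1_on: "closed (ell1_on J :: 'a::{real_normed_field, euclidean_space} ell1 set)"
proof -
  have "ell1_on J = (\<Inter>j\<in>-J. {x. ell1_nth x j = (0::'a)})" by (auto simp: ell1_on_def)
  moreover have "closed {x. ell1_nth x j = (0::'a)}" for j
    by (intro closed_Collect_eq linear_continuous_on bounded_linear_ell1_nth continuous_on_const)
  ultimately show ?thesis by auto
qed

lemma zero_in_ell1_on: "0 \<in> ell1_on J"
  by (simp add: ell1_on_def zero_ell1.rep_eq)

lemma Linf_nice_representative:
  fixes g :: "real \<Rightarrow> 'a::{real_normed_field, euclidean_space} ell1"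
  assumes "g \<in> Linf J" "AE s in unit_interval. norm (g s) \<le> K" "0 \<le> K"
  obtains g' where "nice J K g'" "AE s in unit_interval. g s = g' s"
proof -
  obtain h where h [measurable]: "h \<in> borel_measurable borel" "AE s in unit_interval. g s = h s"
    using unit_interval_borel_representative[OF Linf_measurable[OF assms(1)]] by blast
  have [measurable]: "ell1_on J \<in> sets (borel :: 'a ell1 measure)" by (intro borel_closed closed_ell1_on)
  define g' where "g' s = (if norm (h s) \<le> K \<and> h s \<in> ell1_on J then h s else 0)" for s
  have "nice J K g'"
    unfolding nice_def
  proof (intro conjI allI)
    show "g' \<in> borel_measurable borel" unfolding g'_def[abs_def] by measurable
  qed (use assms(3) in \<open>auto simp: g'_def zero_in_ell1_on\<close>)
  moreover have "AE s in unit_interval. g s \<in> ell1_on J" using assms by (simp add: Linf_iff)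
  then have "AE s in unit_interval. g s = g' s"
    using h(2) assms(2) by eventually_elim (auto simp: g'_def)
  ultimately show ?thesis using that by blast
qed

lemma nice_Linf:
  assumes "nice J K g" shows "g \<in> Linf J"
  using niceD[OF assms] by (auto simp: Linf_iff intro!: borel_measurable_unit_interval exI[of _ K])

lemma is_weak_deriv_cong_AE:
  assumes "is_weak_deriv J f g" "AE s in unit_interval. f s = f' s" "AE s in unit_interval. g s = g' s"
    and "f \<in> Linf J" "f' \<in> Linf J" "g' \<in> Linf J"
  shows "is_weak_deriv J f' g'"
  unfolding is_weak_deriv_def
proof (intro conjI allI impI)
  fix \<phi> assume \<phi>: "test_function \<phi>"
  have m: "\<phi> \<in> borel_measurable unit_interval" "deriv \<phi> \<in> borel_measurable unit_interval"
    using test_function_props[OF \<phi>]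
    by (auto intro!: borel_measurable_unit_interval borel_measurable_continuous_onI continuous_at_imp_continuous_on)
  have g: "g \<in> Linf J" using assms(1) by (simp add: is_weak_deriv_def)
  have "(LINT s|unit_interval. deriv \<phi> s *\<^sub>R f s) = (LINT s|unit_interval. deriv \<phi> s *\<^sub>R f' s)"
  proof (rule integral_cong_AE)
    show "AE s in unit_interval. deriv \<phi> s *\<^sub>R f s = deriv \<phi> s *\<^sub>R f' s"
      using assms(2) by eventually_elim simp
  qed (intro borel_measurable_scaleR m Linf_measurable[OF assms(4)] Linf_measurable[OF assms(5)])+
  moreover have "(LINT s|unit_interval. \<phi> s *\<^sub>R g s) = (LINT s|unit_interval. \<phi> s *\<^sub>R g' s)"
  proof (rule integral_cong_AE)
    show "AE s in unit_interval. \<phi> s *\<^sub>R g s = \<phi> s *\<^sub>R g' s"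
      using assms(3) by eventually_elim simp
  qed (intro borel_measurable_scaleR m Linf_measurable[OF g] Linf_measurable[OF assms(6)])+
  ultimately show "(LINT s|unit_interval. deriv \<phi> s *\<^sub>R f' s) = - (LINT s|unit_interval. \<phi> s *\<^sub>R g' s)"
    using assms(1) \<phi> by (simp add: is_weak_deriv_def)
qed (rule assms(6))

lemma is_weak_deriv_antideriv:
  assumes "nice J K g" "a \<in> ell1_on J"
  shows "antideriv a g \<in> Linf J" "is_weak_deriv J (antideriv a g) g"
proof -
  note g = niceD(1,2)[OF assms(1)]
  note gJ = niceD(3)[OF assms(1)]
  note [measurable] = g(1) borel_measurable_antideriv[OF g]
  have "norm (antideriv a g s) \<le> norm a + K" if "0 \<le> s" "s \<le> 1" for s
  proof -
    have "norm (antideriv a g s - antideriv a g 0) \<le> K * \<bar>s - 0\<bar>" by (rule antideriv_Lipschitz[OF g])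
    also have "\<dots> \<le> K" using that order_trans[OF norm_ge_zero g(2)] by (simp add: mult_left_le)
    finally show ?thesis
      unfolding antideriv_0 using norm_triangle_ineq2[of "antideriv a g s" a] by linarith
  qed
  then have "AE s in unit_interval. norm (antideriv a g s) \<le> norm a + K"
    by (intro AE_unit_intervalI)
  moreover have "antideriv a g \<in> borel_measurable unit_interval"
    by (rule borel_measurable_unit_interval) measurable
  ultimately show "antideriv a g \<in> Linf J"
    unfolding Linf_iff using antideriv_ell1_on[OF g gJ assms(2)] by auto
  show "is_weak_deriv J (antideriv a g) g"
    unfolding is_weak_deriv_def
  proof (intro conjI allI impI)
    fix \<phi> assume "test_function \<phi>"
    note \<phi> = test_function_props[OF this]
    have [measurable]: "\<phi> \<in> borel_measurable borel" "deriv \<phi> \<in> borel_measurable borel"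
      using \<phi> by (auto intro!: borel_measurable_continuous_onI continuous_at_imp_continuous_on)
    have "(LINT s|unit_interval. deriv \<phi> s *\<^sub>R antideriv a g s) = (LBINT s:{0..1}. deriv \<phi> s *\<^sub>R antideriv a g s)"
      by (rule integral_unit_interval) measurable
    also have "\<dots> = - (LBINT s:{0..1}. \<phi> s *\<^sub>R g s)"
      by (rule integral_by_parts_antideriv[OF g \<phi>(1,2,4,5)])
    also have "(LBINT s:{0..1}. \<phi> s *\<^sub>R g s) = (LINT s|unit_interval. \<phi> s *\<^sub>R g s)"
      by (rule integral_unit_interval[symmetric]) measurable
    finally show "(LINT s|unit_interval. deriv \<phi> s *\<^sub>R antideriv a g s) = - (LINT s|unit_interval. \<phi> s *\<^sub>R g s)" .
  qed (rule nice_Linf[OF assms(1)])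
qed

lemma integrable_test_function_Linf:
  assumes "test_function \<phi>" "f \<in> Linf J"
  shows "integrable unit_interval (\<lambda>s. \<phi> s *\<^sub>R f s)" "integrable unit_interval (\<lambda>s. deriv \<phi> s *\<^sub>R f s)"
proof -
  obtain K where K: "AE s in unit_interval. norm (f s) \<le> K" using assms(2) by (auto simp: Linf_iff)
  note int = integrable_continuous_scaleR[OF _ Linf_measurable[OF assms(2)] K]
  show "integrable unit_interval (\<lambda>s. \<phi> s *\<^sub>R f s)" "integrable unit_interval (\<lambda>s. deriv \<phi> s *\<^sub>R f s)"
    using test_function_props(2,3)[OF assms(1)] by (auto intro!: int continuous_at_imp_continuous_on)
qed

text \<open>An element of \<open>L\<^sup>\<infinity>\<close> with a weak derivative is a primitive of it.\<close>

lemma weak_deriv_imp_antideriv: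
  assumes f: "f \<in> Linf J" and g: "is_weak_deriv J f g" and g': "nice J K g'" "AE s in unit_interval. g s = g' s"
  obtains a where "a \<in> ell1_on J" "AE s in unit_interval. f s = antideriv a g' s"
proof -
  define k where "k s = f s - antideriv 0 g' s" for s
  note P = is_weak_deriv_antideriv[OF g'(1) zero_in_ell1_on]
  have k: "k \<in> Linf J" unfolding k_def by (rule Linf_diff[OF f P(1)])
  then obtain L where L: "AE s in unit_interval. norm (k s) \<le> L" by (auto simp: Linf_iff)
  have g'': "is_weak_deriv J f g'"
    by (rule is_weak_deriv_cong_AE[OF g _ g'(2) f f nice_Linf[OF g'(1)]]) simp
  have "(LINT s|unit_interval. deriv \<phi> s *\<^sub>R k s) = 0" if \<phi>: "test_function \<phi>" for \<phi>
  proof -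
    have "(LINT s|unit_interval. deriv \<phi> s *\<^sub>R k s)
        = (LINT s|unit_interval. deriv \<phi> s *\<^sub>R f s) - (LINT s|unit_interval. deriv \<phi> s *\<^sub>R antideriv 0 g' s)"
      unfolding k_def scaleR_diff_right
      by (rule Bochner_Integration.integral_diff)
        (intro integrable_test_function_Linf(2)[OF \<phi> f] integrable_test_function_Linf(2)[OF \<phi> P(1)])+
    then show ?thesis using g'' P(2) \<phi> by (simp add: is_weak_deriv_def)
  qed
  then obtain a where a: "AE s in unit_interval. k s = a"
    using AE_constant_if_weak_deriv_zero[OF Linf_measurable[OF k] L] by blast
  have "AE s in unit_interval. k s \<in> ell1_on J" using k by (simp add: Linf_iff)
  with a have "AE s in unit_interval. a \<in> ell1_on J" by eventually_elim simp
  then have "a \<in> ell1_on J"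
    using eventually_happens'[of "ae_filter unit_interval"]
    by (auto simp: ae_filter_eq_bot_iff emeasure_restrict_space space_restrict_space)
  moreover have "AE s in unit_interval. f s = antideriv a g' s"
    using a by eventually_elim (auto simp: k_def antideriv_def)
  ultimately show ?thesis using that by blast
qed

lemma weak_deriv_unique:
  assumes "is_weak_deriv J f g1" "is_weak_deriv J f g2"
  shows "AE s in unit_interval. g1 s = g2 s"
proof -
  have g: "g1 \<in> Linf J" "g2 \<in> Linf J" using assms by (auto simp: is_weak_deriv_def)
  define k where "k s = g1 s - g2 s" for s
  have k: "k \<in> Linf J" unfolding k_def by (rule Linf_diff[OF g])
  then obtain L where L: "AE s in unit_interval. norm (k s) \<le> L" by (auto simp: Linf_iff)
  have "AE s in unit_interval. k s = 0"
  proof (rule AE_zero_if_test_integrals_zero[OF Linf_measurable[OF k] L])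
    fix \<phi> lo hi
    assume "\<phi> \<in> flat_span" "\<And>x. \<phi> x \<noteq> 0 \<Longrightarrow> x \<in> {lo..hi}" "0 < lo" "lo \<le> (hi::real)" "hi < 1"
    then have \<phi>: "test_function \<phi>" using test_function_flat_span by blast
    have "(LINT s|unit_interval. \<phi> s *\<^sub>R k s)
        = (LINT s|unit_interval. \<phi> s *\<^sub>R g1 s) - (LINT s|unit_interval. \<phi> s *\<^sub>R g2 s)"
      unfolding k_def scaleR_diff_right
      by (rule Bochner_Integration.integral_diff)
        (intro integrable_test_function_Linf(1)[OF \<phi> g(1)] integrable_test_function_Linf(1)[OF \<phi> g(2)])+
    moreover have "- (LINT s|unit_interval. \<phi> s *\<^sub>R g1 s) = - (LINT s|unit_interval. \<phi> s *\<^sub>R g2 s)"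
      using assms \<phi> unfolding is_weak_deriv_def by metis
    ultimately show "(LINT s|unit_interval. \<phi> s *\<^sub>R k s) = 0" by simp
  qed
  then show ?thesis by (simp add: k_def)
qed

lemma continuous_AE_eq_imp_eq:
  fixes c d :: "real \<Rightarrow> 'b::real_normed_vector"
  assumes c: "continuous_on {0..1} c" and d: "continuous_on {0..1} d"
    and eq: "AE s in unit_interval. c s = d s" and s: "0 \<le> s" "s \<le> 1"
  shows "c s = d s"
proof -
  define C where "C = {s \<in> {0..1}. c s - d s = 0}"
  have C: "closed C"
    unfolding C_def by (rule continuous_closed_preimage_constant) (intro continuous_intros c d, simp)
  have "AE x in lebesgue. x \<in> {0<..<1} \<longrightarrow> x \<in> C"
    using eq unfolding AE_unit_interval_iff AE_completion_iff by eventually_elim (auto simp: C_def)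
  then have "{0<..<1} \<subseteq> C"
    by (intro subsetI mem_closed_if_AE_lebesgue_open[OF open_greaterThanLessThan C])
  then have "closure {0<..<1} \<subseteq> C" using C by (rule closure_minimal)
  then show ?thesis using s by (auto simp: C_def)
qed

section \<open>The stochastic matrix as an operator on the sequence space\<close>

text \<open>A nonnegative matrix over \<open>J\<close> with column sums at most 1 and finitely supported rows. The entries
  outside \<open>J \<times> J\<close> are irrelevant.\<close>

locale substochastic =
  fixes J :: "nat set" and B :: "nat \<Rightarrow> nat \<Rightarrow> real"
  assumes nonneg: "i \<in> J \<Longrightarrow> k \<in> J \<Longrightarrow> 0 \<le> B i k"
    and row_finite: "i \<in> J \<Longrightarrow> finite {k \<in> J. B i k \<noteq> 0}"
    and col_sum: "k \<in> J \<Longrightarrow> finite A \<Longrightarrow> A \<subseteq> J \<Longrightarrow> (\<Sum>i\<in>A. B i k) \<le> 1"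
begin

text \<open>The support of row \<open>i\<close>, and the coordinates of the image of \<open>x\<close> as finite sums.\<close>

definition row :: "nat \<Rightarrow> nat set" where "row i = {k \<in> J. B i k \<noteq> 0}"

definition mat_seq :: "'a::real_normed_vector ell1 \<Rightarrow> nat \<Rightarrow> 'a"
  where "mat_seq x i = (if i \<in> J then \<Sum>k\<in>row i. B i k *\<^sub>R ell1_nth x k else 0)"

lemma row: "i \<in> J \<Longrightarrow> finite (row i)" "row i \<subseteq> J"
  using row_finite by (auto simp: row_def)

text \<open>Only finitely many columns meet the first \<open>N\<close> rows, so the two sums can be exchanged.\<close>

lemma sum_norm_mat_seq_le: "(\<Sum>i<N. norm (mat_seq x i)) \<le> norm x"
proof -
  define A where "A = {..<N} \<inter> J"
  have A: "finite A" "A \<subseteq> J" by (auto simp: A_def)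
  define K where "K = (\<Union>i\<in>A. row i)"
  have K: "finite K" "K \<subseteq> J" using A row by (auto simp: K_def)
  have "(\<Sum>i<N. norm (mat_seq x i)) = (\<Sum>i\<in>A. norm (mat_seq x i))"
    by (rule sum.mono_neutral_right) (auto simp: A_def mat_seq_def)
  also have "\<dots> \<le> (\<Sum>i\<in>A. \<Sum>k\<in>K. B i k * norm (ell1_nth x k))"
  proof (rule sum_mono)
    fix i assume i: "i \<in> A"
    then have iJ: "i \<in> J" using A by auto
    have "norm (mat_seq x i) \<le> (\<Sum>k\<in>row i. norm (B i k *\<^sub>R ell1_nth x k))"
      using iJ by (simp add: mat_seq_def norm_sum del: norm_scaleR)
    also have "\<dots> = (\<Sum>k\<in>row i. B i k * norm (ell1_nth x k))"
      by (intro sum.cong refl) (use nonneg[OF iJ] row(2) in \<open>auto simp: subset_eq\<close>)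
    also have "\<dots> \<le> (\<Sum>k\<in>K. B i k * norm (ell1_nth x k))"
      by (rule sum_mono2) (use K i nonneg[OF iJ] in \<open>auto simp: K_def\<close>)
    finally show "norm (mat_seq x i) \<le> (\<Sum>k\<in>K. B i k * norm (ell1_nth x k))" .
  qed
  also have "\<dots> = (\<Sum>k\<in>K. (\<Sum>i\<in>A. B i k) * norm (ell1_nth x k))"
    by (subst sum.swap) (simp add: sum_distrib_right)
  also have "\<dots> \<le> (\<Sum>k\<in>K. norm (ell1_nth x k))"
    by (intro sum_mono mult_left_le_one_le norm_ge_zero col_sum sum_nonneg nonneg) (use A K in auto)
  also have "\<dots> \<le> norm x"
    unfolding norm_ell1.rep_eq by (intro sum_le_suminf ell1_nth_summable K) auto
  finally show ?thesis .
qed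

lemma summable_mat_seq: "summable (\<lambda>i. norm (mat_seq x i))"
  by (rule bounded_imp_summable[of _ "norm x"])
    (use sum_norm_mat_seq_le[of x "Suc _"] in \<open>simp_all add: lessThan_Suc_atMost\<close>)

text \<open>The operator on \<open>\<ell>\<^sup>1\<close> that the matrix defines. Its values vanish off \<open>J\<close>.\<close>

definition mat :: "'a::real_normed_vector ell1 \<Rightarrow> 'a ell1"
  where "mat x = Abs_ell1 (mat_seq x)"

lemma mat_nth: "ell1_nth (mat x) i = mat_seq x i"
  unfolding mat_def using summable_mat_seq[of x] by (simp add: Abs_ell1_inverse)

lemma norm_mat_le: "norm (mat x) \<le> norm x"
  unfolding norm_ell1.rep_eq[of "mat x"] mat_nth
  by (rule suminf_le_const[OF summable_mat_seq sum_norm_mat_seq_le])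

lemma mat_in_ell1_on: "mat x \<in> ell1_on J"
  by (simp add: ell1_on_def mat_nth mat_seq_def)

lemma bounded_linear_mat: "bounded_linear mat"
proof (rule bounded_linear_intro[where K = 1])
  show "mat (x + y) = mat x + mat y" for x y :: "'a ell1"
    by (rule ell1_eqI)
      (simp add: mat_nth mat_seq_def plus_ell1.rep_eq scaleR_add_right sum.distrib)
  show "mat (r *\<^sub>R x) = r *\<^sub>R mat x" for r and x :: "'a ell1"
    by (rule ell1_eqI)
      (simp add: mat_nth mat_seq_def scaleR_ell1.rep_eq scaleR_sum_right mult.commute)
qed (simp add: norm_mat_le)

lemma infsum_row:
  assumes "i \<in> J"
  shows "(\<Sum>\<^sub>\<infinity>k\<in>J. B i k *\<^sub>R ell1_nth x k) = ell1_nth (mat x) i"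
proof -
  have "(\<Sum>\<^sub>\<infinity>k\<in>J. B i k *\<^sub>R ell1_nth x k) = (\<Sum>\<^sub>\<infinity>k\<in>row i. B i k *\<^sub>R ell1_nth x k)"
    by (rule infsum_cong_neutral) (auto simp: row_def)
  then show ?thesis using assms row by (simp add: mat_nth mat_seq_def)
qed

lemma ell1_eq_mat_iff:
  assumes "y \<in> ell1_on J"
  shows "(\<forall>j\<in>J. ell1_nth y j = (\<Sum>\<^sub>\<infinity>k\<in>J. B j k *\<^sub>R ell1_nth x k)) \<longleftrightarrow> y = mat x"
proof
  assume *: "\<forall>j\<in>J. ell1_nth y j = (\<Sum>\<^sub>\<infinity>k\<in>J. B j k *\<^sub>R ell1_nth x k)"
  show "y = mat x"
  proof (rule ell1_eqI)
    fix j show "ell1_nth y j = ell1_nth (mat x) j"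
      using * infsum_row[of j x] assms mat_in_ell1_on[of x] by (cases "j \<in> J") (auto simp: ell1_on_def)
  qed
qed (simp add: infsum_row)

text \<open>The extension of a function on \<open>[0,1)\<close> to the half line by the rule \<open>G(x + 1) = B G(x)\<close>, and
  by 0 to negative arguments.\<close>

definition extend :: "(real \<Rightarrow> 'a::{real_normed_field, euclidean_space} ell1) \<Rightarrow> real \<Rightarrow> 'a ell1"
  where "extend g x = (if x < 0 then 0 else (mat ^^ nat \<lfloor>x\<rfloor>) (g (x - real (nat \<lfloor>x\<rfloor>))))"

lemma extend_unit: "0 \<le> x \<Longrightarrow> x < 1 \<Longrightarrow> extend g x = g x"
proof -
  assume "0 \<le> x" "x < 1"
  moreover from this have "\<lfloor>x\<rfloor> = 0" by linarith
  ultimately show ?thesis by (simp add: extend_def)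
qed

lemma extend_shift:
  assumes "0 \<le> x" shows "extend g (x + 1) = mat (extend g x)"
proof -
  have "nat \<lfloor>x + 1\<rfloor> = Suc (nat \<lfloor>x\<rfloor>)" using assms by (simp add: nat_add_distrib)
  then show ?thesis using assms by (simp add: extend_def)
qed

lemma funpow_mat: "norm ((mat ^^ n) x) \<le> norm x" "x \<in> ell1_on J \<Longrightarrow> (mat ^^ n) x \<in> ell1_on J"
  by (induction n) (auto intro: order_trans[OF norm_mat_le] mat_in_ell1_on)

lemma nice_extend:
  assumes "nice J K g" shows "nice J K (extend g)"
  unfolding nice_def
proof (intro conjI allI)
  note g = niceD[OF assms]
  note [measurable] = g(1)
  have [measurable]: "(mat ^^ n) \<in> borel_measurable (borel :: 'a ell1 measure)" for n
  proof (rule borel_measurable_continuous_onI)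
    show "continuous_on UNIV (mat ^^ n :: 'a ell1 \<Rightarrow> _)"
    proof (induction n)
      case (Suc n)
      then show ?case
        using continuous_on_compose[OF Suc linear_continuous_on[OF bounded_linear_mat]] by simp
    qed (simp add: id_def)
  qed
  have "(\<lambda>x. (\<lambda>n x. (mat ^^ n) (g (x - real n))) (nat \<lfloor>x\<rfloor>) x) \<in> borel_measurable borel"
    by (rule measurable_compose_countable) measurable
  then show "extend g \<in> borel_measurable borel"
    unfolding extend_def[abs_def] by measurable
  show "norm (extend g s) \<le> K" for s
    using funpow_mat(1) g(2) order_trans[OF norm_ge_zero g(2)]
    by (auto simp: extend_def intro: order_trans)
  show "extend g s \<in> ell1_on J" for s
    using funpow_mat(2) g(3) by (auto simp: extend_def zero_in_ell1_on)
qed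

end

lemma set_integral_shift:
  fixes g :: "real \<Rightarrow> 'b::{banach, second_countable_topology}"
  shows "(LBINT s:{x..y}. g (s + c)) = (LBINT s:{x + c..y + c}. g s)"
proof -
  have "(LBINT s:{x + c..y + c}. g s) = (LBINT s. indicator {x + c..y + c} (c + 1 * s) *\<^sub>R g (c + 1 * s))"
    unfolding set_lebesgue_integral_def by (subst lborel_integral_real_affine[of 1 _ c]) simp_all
  also have "\<dots> = (LBINT s:{x..y}. g (s + c))"
    unfolding set_lebesgue_integral_def
    by (rule Bochner_Integration.integral_cong) (auto simp: indicator_def add.commute)
  finally show ?thesis ..
qed

lemma antideriv_translate:
  assumes g: "g \<in> borel_measurable borel" "\<And>s. norm (g s) \<le> K" and "0 \<le> t" "0 \<le> s"
  shows "antideriv a g (t + s) = antideriv (antideriv a g t) (\<lambda>r. g (t + r)) s"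
proof -
  have "antideriv a g (t + s) = antideriv a g t + (LBINT r:{t..t + s}. g r)"
    using antideriv_diff[OF g, of t "t + s" a] assms(3,4) by (simp add: algebra_simps)
  also have "(LBINT r:{t..t + s}. g r) = (LBINT r:{0..s}. g (t + r))"
    using set_integral_shift[of 0 s g t] by (simp add: add.commute)
  finally show ?thesis by (simp add: antideriv_def)
qed

text \<open>The boundary condition makes the primitive of the extension obey the same rule: both
  \<open>F(x + 1)\<close> and \<open>B F(x)\<close> are primitives of \<open>B G\<close>, and they agree at 0.\<close>

lemma (in substochastic) antideriv_extend_shift:
  fixes g :: "real \<Rightarrow> 'a::{real_normed_field, euclidean_space} ell1"
  assumes g: "nice J K g" and bc: "antideriv a g 1 = mat a" and x: "0 \<le> x"
  shows "antideriv a (extend g) (x + 1) = mat (antideriv a (extend g) x)"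
    and "y \<le> 1 \<Longrightarrow> antideriv a (extend g) y = antideriv a g y"
proof -
  note G = niceD(1,2)[OF nice_extend[OF g]]
  show unit: "antideriv a (extend g) y = antideriv a g y" if "y \<le> 1" for y
  proof -
    have [measurable]: "g \<in> borel_measurable borel" "extend g \<in> borel_measurable borel"
      using g G by (auto dest: niceD)
    have "(LBINT r:{0..y}. extend g r) = (LBINT r:{0..y}. g r)"
      unfolding set_lebesgue_integral_def
    proof (rule integral_cong_AE)
      show "AE r in lborel. indicator {0..y} r *\<^sub>R extend g r = indicator {0..y} r *\<^sub>R g r"
        using AE_lborel_singleton[of 1]
        by eventually_elim (use that in \<open>auto simp: indicator_def extend_unit\<close>)
    qed measurable
    then show ?thesis by (simp add: antideriv_def)
  qed
  have "antideriv a (extend g) (x + 1) = antideriv a (extend g) 1 + (LBINT r:{1..x + 1}. extend g r)"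
    using antideriv_diff[OF G, of 1 "x + 1" a] x by (simp add: algebra_simps)
  also have "antideriv a (extend g) 1 = mat a" using unit[of 1] bc by simp
  also have "(LBINT r:{1..x + 1}. extend g r) = (LBINT r:{0..x}. extend g (r + 1))"
    using set_integral_shift[of 0 x "extend g" 1] by simp
  also have "\<dots> = (LBINT r. mat (indicator {0..x} r *\<^sub>R extend g r))"
    unfolding set_lebesgue_integral_def
    by (rule Bochner_Integration.integral_cong)
      (auto simp: indicator_def extend_shift linear_0[OF bounded_linear.linear[OF bounded_linear_mat]])
  also have "\<dots> = mat (LBINT r:{0..x}. extend g r)"
    using set_integrable_bounded[OF G, of 0 x]
    unfolding set_lebesgue_integral_def set_integrable_def
    by (rule integral_bounded_linear[OF bounded_linear_mat])
  finally show "antideriv a (extend g) (x + 1) = mat (antideriv a (extend g) x)"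
    by (simp add: antideriv_def linear_add[OF bounded_linear.linear[OF bounded_linear_mat]])
qed

section \<open>Translates of a primitive\<close>

lemma integral_translate_primitive:
  fixes h :: "real \<Rightarrow> 'a::euclidean_space"
  assumes h: "continuous_on {0..} h" and "0 \<le> t" "0 \<le> b"
  shows "integral {0..b} (\<lambda>s. h (t + s)) = integral {0..t + b} h - integral {0..t} h"
proof -
  have "integral {0..t} h + integral {t..t + b} h = integral {0..t + b} h"
    using assms by (intro Henstock_Kurzweil_Integration.integral_combine integrable_continuous_interval)
      (auto intro: continuous_on_subset)
  moreover have "integral {0..b} (\<lambda>s. h (t + s)) = integral {t..t + b} h"
    using integral_shift_real_ivl[of t t "t + b" h] by (simp add: add.commute)
  ultimately show ?thesis by (simp add: algebra_simps)
qed

lemma primitive_has_vector_derivative: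
  fixes h :: "real \<Rightarrow> 'a::euclidean_space"
  assumes h: "continuous_on {0..} h" and t: "0 \<le> t"
  shows "((\<lambda>x. integral {0..x} h) has_vector_derivative h t) (at t within {0..})"
proof -
  have "((\<lambda>x. integral {0..x} h) has_vector_derivative h t) (at t within {0..t + 1})"
    by (rule integral_has_vector_derivative) (use t in \<open>auto intro: continuous_on_subset[OF h]\<close>)
  moreover have "at t within {0..} = at t within {0..t + 1}"
    by (rule at_within_nhd[of t "{..<t + 1}"]) auto
  ultimately show ?thesis by simp
qed

lemma has_vector_derivative_iff_tendsto:
  "(f has_vector_derivative f') (at t within S) \<longleftrightarrow>
    ((\<lambda>r. (f r - f t) /\<^sub>R (r - t)) \<longlongrightarrow> f') (at t within S)"
proof -
  have norm_eq: "norm ((1 / norm (r - t)) *\<^sub>R (f r - (f t + (r - t) *\<^sub>R f')))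
      = norm ((f r - f t) /\<^sub>R (r - t) - f')" if "r \<noteq> t" for r
  proof -
    have "(1 / (r - t)) *\<^sub>R ((r - t) *\<^sub>R f') = f'" using that by simp
    then have "(f r - f t) /\<^sub>R (r - t) - f' = (1 / (r - t)) *\<^sub>R (f r - (f t + (r - t) *\<^sub>R f'))"
      by (simp only: diff_diff_eq[symmetric] scaleR_diff_right[of _ "f r - f t"] inverse_eq_divide)
    then show ?thesis by (simp only: norm_scaleR) simp
  qed
  have "(f has_vector_derivative f') (at t within S) \<longleftrightarrow>
      ((\<lambda>r. norm ((1 / norm (r - t)) *\<^sub>R (f r - (f t + (r - t) *\<^sub>R f')))) \<longlongrightarrow> 0) (at t within S)"
    unfolding tendsto_norm_zero_iff
    by (simp add: has_vector_derivative_def has_derivative_within bounded_linear_scaleR_left)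
  also have "\<dots> \<longleftrightarrow> ((\<lambda>r. norm ((f r - f t) /\<^sub>R (r - t) - f')) \<longlongrightarrow> 0) (at t within S)"
    by (rule tendsto_cong, unfold eventually_at_filter, intro always_eventually allI impI)
      (rule norm_eq)
  also have "\<dots> \<longleftrightarrow> ((\<lambda>r. (f r - f t) /\<^sub>R (r - t)) \<longlongrightarrow> f') (at t within S)"
    unfolding tendsto_norm_zero_iff by (rule LIM_zero_iff)
  finally show ?thesis .
qed

lemma continuous_on_ell1_nth:
  fixes f :: "'m::topological_space \<Rightarrow> 'a::real_normed_vector ell1"
  shows "continuous_on S f \<Longrightarrow> continuous_on S (\<lambda>x. ell1_nth (f x) j)"
  by (rule bounded_linear.continuous_on[OF bounded_linear_ell1_nth])

lemma coord_mean_continuous: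
  fixes f :: "real \<Rightarrow> 'a::{real_normed_field, euclidean_space} ell1"
  assumes f: "continuous_on {0..1} f" and b: "0 \<le> b" "b \<le> 1"
  shows "coord_mean f j b = integral {0..b} (\<lambda>s. ell1_nth (f s) j)"
proof -
  let ?h = "\<lambda>s. ell1_nth (f s) j"
  have cont: "continuous_on {0..b} ?h"
    using continuous_on_ell1_nth[OF f] by (rule continuous_on_subset) (use b in auto)
  have "set_integrable lborel {0..b} ?h" by (rule borel_integrable_atLeastAtMost'[OF cont])
  then have "integrable lebesgue (\<lambda>s. indicator {0..b} s *\<^sub>R ?h s)"
    unfolding set_integrable_def by (subst integrable_completion) auto
  then have int: "integrable (lebesgue_on {0..b}) ?h"
    by (subst integrable_restrict_space) auto
  have "coord_mean f j b = (LINT s|lebesgue. indicator {0..1} s *\<^sub>R (indicator {0..b} s *\<^sub>R ?h s))"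
    unfolding coord_mean_def by (rule integral_restrict_space) simp
  also have "\<dots> = (LINT s|lebesgue. indicator {0..b} s *\<^sub>R ?h s)"
    by (rule Bochner_Integration.integral_cong) (use b in \<open>auto simp: indicator_def\<close>)
  also have "\<dots> = (LINT s|lebesgue_on {0..b}. ?h s)"
    by (rule integral_restrict_space[symmetric]) simp
  also have "\<dots> = integral {0..b} ?h"
    by (rule lebesgue_integral_eq_integral[OF int]) simp
  finally show ?thesis .
qed

lemma coord_mean_diff:
  fixes f :: "real \<Rightarrow> 'a::{real_normed_field, euclidean_space} ell1"
  shows "f \<in> Linf J \<Longrightarrow> f' \<in> Linf J \<Longrightarrow> coord_mean (\<lambda>s. f s - f' s) j b = coord_mean f j b - coord_mean f' j b"
  unfolding coord_mean_eq_pairing by (intro Linf_pairing_diff_left integrable_indicator_unit_c0)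

lemma coord_mean_scaleR: "coord_mean (\<lambda>s. r *\<^sub>R f s) j b = r *\<^sub>R coord_mean f j b"
  unfolding coord_mean_eq_pairing by (rule Linf_pairing_scaleR_left)

lemma coord_mean_cong_AE:
  fixes f :: "real \<Rightarrow> 'a::{real_normed_field, euclidean_space} ell1"
  shows "f \<in> Linf J \<Longrightarrow> f' \<in> Linf J \<Longrightarrow> AE s in unit_interval. f s = f' s \<Longrightarrow> coord_mean f j b = coord_mean f' j b"
  unfolding coord_mean_eq_pairing by (intro Linf_pairing_cong_AE integrable_indicator_unit_c0)

text \<open>The translates \<open>t \<mapsto> F(t + \<cdot>)\<close> of a primitive \<open>F\<close> of \<open>G\<close>, as a curve in \<open>L\<^sup>\<infinity>\<close>.\<close>

locale primitive_curve =
  fixes J :: "nat set" and K :: real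
    and G :: "real \<Rightarrow> 'a::{real_normed_field, euclidean_space} ell1" and a :: "'a ell1"
  assumes G: "nice J K G" and a: "a \<in> ell1_on J"
begin

definition F :: "real \<Rightarrow> 'a ell1" where "F = antideriv a G"

lemma K_nonneg: "0 \<le> K" using order_trans[OF norm_ge_zero niceD(2)[OF G]] .

lemma F_Lipschitz: "norm (F y - F x) \<le> K * \<bar>y - x\<bar>"
  unfolding F_def by (rule antideriv_Lipschitz[OF niceD(1,2)[OF G]])

lemma continuous_on_F: "continuous_on S F"
  unfolding F_def by (rule continuous_on_antideriv[OF niceD(1,2)[OF G]])

lemma borel_measurable_F [measurable]: "F \<in> borel_measurable borel"
  unfolding F_def by (rule borel_measurable_antideriv[OF niceD(1,2)[OF G]])

lemma F_ell1_on: "F x \<in> ell1_on J"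
  unfolding F_def by (rule antideriv_ell1_on[OF niceD[OF G] a])

lemma F_translate_bound: "0 \<le> s \<Longrightarrow> s \<le> 1 \<Longrightarrow> norm (F (t + s)) \<le> norm (F t) + K"
  using F_Lipschitz[of "t + s" t] norm_triangle_ineq2[of "F (t + s)" "F t"]
    mult_left_mono[of s 1 K] K_nonneg by simp

lemma F_translate_Linf: "(\<lambda>s. F (t + s)) \<in> Linf J"
proof -
  have "(\<lambda>s. F (t + s)) \<in> borel_measurable unit_interval"
    by (rule borel_measurable_unit_interval) measurable
  moreover have "AE s in unit_interval. norm (F (t + s)) \<le> norm (F t) + K"
    by (intro AE_unit_intervalI F_translate_bound)
  ultimately show ?thesis unfolding Linf_iff using F_ell1_on by auto
qed

lemma nice_translate: "nice J K (\<lambda>s. G (t + s))"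
proof -
  note [measurable] = niceD(1)[OF G]
  have "(\<lambda>s. G (t + s)) \<in> borel_measurable borel" by measurable
  then show ?thesis using niceD(2,3)[OF G] by (simp add: nice_def)
qed

lemma G_translate_Linf: "(\<lambda>s. G (t + s)) \<in> Linf J"
  by (rule nice_Linf[OF nice_translate])

lemma F_translate:
  assumes "0 \<le> t" "0 \<le> s"
  shows "F (t + s) = antideriv (F t) (\<lambda>r. G (t + r)) s"
  unfolding F_def by (rule antideriv_translate[OF niceD(1,2)[OF G] assms])

lemma weak_deriv_translate:
  assumes t: "0 \<le> t"
  shows "is_weak_deriv J (\<lambda>s. F (t + s)) (\<lambda>s. G (t + s))"
proof (rule is_weak_deriv_cong_AE)
  show "is_weak_deriv J (antideriv (F t) (\<lambda>s. G (t + s))) (\<lambda>s. G (t + s))"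
       "antideriv (F t) (\<lambda>s. G (t + s)) \<in> Linf J"
    by (rule is_weak_deriv_antideriv[OF nice_translate F_ell1_on])+
  show "AE s in unit_interval. antideriv (F t) (\<lambda>s. G (t + s)) s = F (t + s)"
    by (intro AE_unit_intervalI) (simp add: F_translate[OF t])
qed (auto intro: F_translate_Linf G_translate_Linf)

lemma coord_mean_G:
  assumes "0 \<le> t" "0 \<le> b" "b \<le> 1"
  shows "coord_mean (\<lambda>s. G (t + s)) j b = ell1_nth (F (t + b)) j - ell1_nth (F t) j"
proof -
  note n = niceD(1,2)[OF nice_translate[of t]]
  note [measurable] = n(1)
  have "coord_mean (\<lambda>s. G (t + s)) j b = (LBINT s:{0..b}. ell1_nth (G (t + s)) j)"
    unfolding coord_mean_def by (rule unit_interval_indicator_integral) (use assms in measurable)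
  also have "\<dots> = ell1_nth (LBINT s:{0..b}. G (t + s)) j"
    by (rule ell1_nth_set_integral[OF n, symmetric])
  finally show ?thesis
    using F_translate[OF assms(1,2)] by (simp add: antideriv_def plus_ell1.rep_eq)
qed

text \<open>A primitive of the \<open>j\<close>-th coordinate of \<open>F\<close>; its differences are the coordinate means of the
  translates.\<close>

definition P :: "nat \<Rightarrow> real \<Rightarrow> 'a" where "P j x = integral {0..x} (\<lambda>s. ell1_nth (F s) j)"

lemma P_has_vector_derivative:
  "0 \<le> t \<Longrightarrow> (P j has_vector_derivative ell1_nth (F t) j) (at t within {0..})"
  unfolding P_def[abs_def]
  by (rule primitive_has_vector_derivative[OF continuous_on_ell1_nth[OF continuous_on_F]])

lemma coord_mean_F:
  assumes "0 \<le> t" "0 \<le> b" "b \<le> 1"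
  shows "coord_mean (\<lambda>s. F (t + s)) j b = P j (t + b) - P j t"
proof -
  have "continuous_on {0..1} (\<lambda>s. F (t + s))"
    by (rule continuous_on_compose2[OF continuous_on_F]) (auto intro!: continuous_intros)
  then have "coord_mean (\<lambda>s. F (t + s)) j b = integral {0..b} (\<lambda>s. ell1_nth (F (t + s)) j)"
    using assms by (intro coord_mean_continuous)
  also have "\<dots> = P j (t + b) - P j t"
    unfolding P_def using assms
    by (intro integral_translate_primitive continuous_on_ell1_nth[OF continuous_on_F])
  finally show ?thesis .
qed

lemma coord_mean_F_has_vector_derivative:
  assumes t: "0 \<le> t" and b: "0 \<le> b" "b \<le> 1"
  shows "((\<lambda>r. coord_mean (\<lambda>s. F (r + s)) j b) has_vector_derivative coord_mean (\<lambda>s. G (t + s)) j b)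
    (at t within {0..})"
proof -
  have "((P j \<circ> (\<lambda>r. r + b)) has_vector_derivative 1 *\<^sub>R ell1_nth (F (t + b)) j) (at t within {0..})"
  proof (rule vector_diff_chain_within)
    show "((\<lambda>r. r + b) has_vector_derivative 1) (at t within {0..})"
      by (auto intro!: derivative_eq_intros)
    have "(P j has_vector_derivative ell1_nth (F (t + b)) j) (at (t + b) within {0..})"
      using t b by (intro P_has_vector_derivative) simp
    then show "(P j has_vector_derivative ell1_nth (F (t + b)) j) (at (t + b) within (\<lambda>r. r + b) ` {0..})"
      by (rule has_vector_derivative_within_subset) (use b in auto)
  qed
  from has_vector_derivative_diff[OF this P_has_vector_derivative[OF t, of j]]
  have "((\<lambda>r. P j (r + b) - P j r) has_vector_derivative coord_mean (\<lambda>s. G (t + s)) j b) (at t within {0..})"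
    by (simp add: coord_mean_G[OF t b] o_def)
  then show ?thesis
    by (rule has_vector_derivative_transform[rotated 2]) (use t b in \<open>auto simp: coord_mean_F\<close>)
qed

text \<open>The difference quotients are bounded by the Lipschitz constant of \<open>F\<close>, so it suffices to
  differentiate the coordinate means.\<close>

lemma weak_star_deriv_translate: "weak_star_deriv J (\<lambda>t s. F (t + s)) (\<lambda>t s. G (t + s))"
  unfolding weak_star_deriv_def limitin_weak_star_iff
proof (intro allI impI conjI ballI)
  fix t :: real assume t: "0 \<le> t"
  show "(\<lambda>s. G (t + s)) \<in> Linf J" by (rule G_translate_Linf)
  let ?q = "\<lambda>r s. (F (r + s) - F (t + s)) /\<^sub>R (r - t)"
  have q: "?q r \<in> Linf J" for r
    by (intro Linf_scaleR Linf_diff F_translate_Linf)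
  then show "eventually (\<lambda>r. ?q r \<in> Linf J) (at t within {0..})" by simp
  fix g :: "real \<Rightarrow> 'a c0" assume "g \<in> L1_c0 J"
  then have g: "integrable unit_interval g" by (simp add: L1_c0_def)
  have "((\<lambda>r. Linf_pairing (\<lambda>s. ?q r s - G (t + s)) g) \<longlongrightarrow> 0) (at t within {0..})"
  proof (rule tendsto_Linf_pairing_zero[where K = "K + K", OF _ _ _ g])
    show "(\<lambda>s. ?q r s - G (t + s)) \<in> Linf J" for r
      by (intro Linf_diff q G_translate_Linf)
    show "AE s in unit_interval. norm (?q r s - G (t + s)) \<le> K + K" for r
    proof (rule AE_I2)
      fix s
      have "norm (?q r s) \<le> K"
      proof (cases "r = t")
        case False
        have "norm (?q r s) = norm (F (r + s) - F (t + s)) / \<bar>r - t\<bar>"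
          by (simp add: divide_inverse mult.commute)
        then show ?thesis
          using F_Lipschitz[of "r + s" "t + s"] False by (simp add: pos_divide_le_eq)
      qed (simp add: K_nonneg)
      then show "norm (?q r s - G (t + s)) \<le> K + K"
        using niceD(2)[OF G, of "t + s"] norm_triangle_ineq4[of "?q r s" "G (t + s)"] by linarith
    qed
    fix j b assume b: "0 \<le> (b::real)" "b \<le> 1"
    let ?W = "\<lambda>r. coord_mean (\<lambda>s. F (r + s)) j b" and ?W' = "coord_mean (\<lambda>s. G (t + s)) j b"
    have "((\<lambda>r. (?W r - ?W t) /\<^sub>R (r - t)) \<longlongrightarrow> ?W') (at t within {0..})"
      using coord_mean_F_has_vector_derivative[OF t b, of j]
      by (simp add: has_vector_derivative_iff_tendsto)
    from LIM_zero[OF this]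
    show "((\<lambda>r. coord_mean (\<lambda>s. ?q r s - G (t + s)) j b) \<longlongrightarrow> 0) (at t within {0..})"
      by (simp add: coord_mean_diff[OF q G_translate_Linf] coord_mean_scaleR
          coord_mean_diff[OF F_translate_Linf F_translate_Linf])
  qed
  then show "((\<lambda>r. Linf_pairing (?q r) g) \<longlongrightarrow> Linf_pairing (\<lambda>s. G (t + s)) g) (at t within {0..})"
    unfolding Linf_pairing_diff_left[OF q G_translate_Linf g] by (rule LIM_zero_cancel)
qed

lemma continuous_map_F: "continuous_map (top_of_set {0..}) (weak_star J) (\<lambda>t s. F (t + s))"
  unfolding continuous_map_weak_star_iff
proof (intro conjI ballI F_translate_Linf)
  fix g :: "real \<Rightarrow> 'a c0" assume "g \<in> L1_c0 J"
  then have g: "integrable unit_interval g" by (simp add: L1_c0_def)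
  let ?p = "\<lambda>t. Linf_pairing (\<lambda>s. F (t + s)) g"
  have "lipschitz_on (K * (LINT s|unit_interval. norm (g s))) {0..} ?p"
  proof (rule lipschitz_onI)
    fix t r :: real
    have "norm (Linf_pairing (\<lambda>s. F (t + s) - F (r + s)) g) \<le> (K * \<bar>t - r\<bar>) * (LINT s|unit_interval. norm (g s))"
    proof (rule norm_Linf_pairing_le[OF Linf_diff[OF F_translate_Linf F_translate_Linf] _ g])
      show "AE s in unit_interval. norm (F (t + s) - F (r + s)) \<le> K * \<bar>t - r\<bar>"
      proof (rule AE_I2)
        fix s show "norm (F (t + s) - F (r + s)) \<le> K * \<bar>t - r\<bar>"
          using F_Lipschitz[of "t + s" "r + s"] by simp
      qed
    qed
    then show "dist (?p t) (?p r) \<le> K * (LINT s|unit_interval. norm (g s)) * dist t r"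
      by (simp add: dist_norm Linf_pairing_diff_left[OF F_translate_Linf F_translate_Linf g] mult_ac)
  qed (simp add: K_nonneg)
  then show "continuous_on {0..} ?p" by (rule lipschitz_on_continuous_on)
qed

lemma continuous_map_G: "continuous_map (top_of_set {0..}) (weak_star J) (\<lambda>t s. G (t + s))"
  unfolding continuous_map_weak_star_iff
proof (intro conjI ballI G_translate_Linf)
  fix g :: "real \<Rightarrow> 'a c0" assume "g \<in> L1_c0 J"
  then have g: "integrable unit_interval g" by (simp add: L1_c0_def)
  show "continuous_on {0..} (\<lambda>t. Linf_pairing (\<lambda>s. G (t + s)) g)"
    unfolding continuous_on_def
  proof
    fix t :: real assume "t \<in> {0..}"
    then have t: "0 \<le> t" by simp
    have "((\<lambda>r. Linf_pairing (\<lambda>s. G (r + s) - G (t + s)) g) \<longlongrightarrow> 0) (at t within {0..})"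
    proof (rule tendsto_Linf_pairing_zero[where K = "K + K", OF _ _ _ g])
      show "(\<lambda>s. G (r + s) - G (t + s)) \<in> Linf J" for r
        by (intro Linf_diff G_translate_Linf)
      show "AE s in unit_interval. norm (G (r + s) - G (t + s)) \<le> K + K" for r
        by (rule AE_I2) (meson G add_mono niceD(2) norm_triangle_ineq4 order_trans)
      fix j b assume b: "0 \<le> (b::real)" "b \<le> 1"
      let ?W = "\<lambda>r. ell1_nth (F (r + b)) j - ell1_nth (F r) j"
      have cont: "continuous_on {0..} (\<lambda>r. ?W r - ?W t)"
        by (intro continuous_intros continuous_on_ell1_nth continuous_on_compose2[OF continuous_on_F[of UNIV]]) auto
      have "((\<lambda>r. ?W r - ?W t) \<longlongrightarrow> 0) (at t within {0..})"
        using cont[unfolded continuous_on_def, rule_format, of t] t by simp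
      moreover have "eventually (\<lambda>r. ?W r - ?W t = coord_mean (\<lambda>s. G (r + s) - G (t + s)) j b) (at t within {0..})"
        unfolding coord_mean_diff[OF G_translate_Linf G_translate_Linf]
        using t b by (auto simp: eventually_at_filter coord_mean_G)
      ultimately show "((\<lambda>r. coord_mean (\<lambda>s. G (r + s) - G (t + s)) j b) \<longlongrightarrow> 0) (at t within {0..})"
        by (rule Lim_transform_eventually)
    qed
    then show "((\<lambda>r. Linf_pairing (\<lambda>s. G (r + s)) g) \<longlongrightarrow> Linf_pairing (\<lambda>s. G (t + s)) g) (at t within {0..})"
      unfolding Linf_pairing_diff_left[OF G_translate_Linf G_translate_Linf g] by (rule LIM_zero_cancel)
  qed
qed

lemma locally_norm_bounded_F: "locally_norm_bounded (\<lambda>t s. F (t + s))"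
  unfolding locally_norm_bounded_def
proof (intro allI impI)
  fix C :: "real set" assume C: "compact C \<and> C \<subseteq> {0..}"
  then obtain L where L: "\<forall>x\<in>F ` C. norm x \<le> L"
    using compact_imp_bounded[OF compact_continuous_image[OF continuous_on_F]] unfolding bounded_iff by blast
  have "Linf_norm (\<lambda>s. F (t + s)) \<le> ereal (L + K)" if "t \<in> C" for t
  proof -
    have "AE s in unit_interval. norm (F (t + s)) \<le> L + K"
    proof (rule AE_unit_intervalI)
      fix s :: real assume "0 \<le> s" "s \<le> 1"
      from F_translate_bound[OF this, of t] L that show "norm (F (t + s)) \<le> L + K" by force
    qed
    then show ?thesis using Linf_norm_le_iff[OF Linf_measurable[OF F_translate_Linf]] by blast
  qed
  then show "\<exists>L'. \<forall>t\<in>C. Linf_norm (\<lambda>s. F (t + s)) \<le> ereal L'" by blast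
qed

lemma locally_norm_bounded_G: "locally_norm_bounded (\<lambda>t s. G (t + s))"
  unfolding locally_norm_bounded_def
  using Linf_norm_le_iff[OF Linf_measurable[OF G_translate_Linf]] niceD(2)[OF G] by (metis AE_I2)

end

context substochastic
begin

lemma flow_domain_antideriv:
  fixes f :: "real \<Rightarrow> 'a::{real_normed_field, euclidean_space} ell1"
  assumes "f \<in> flow_domain J B"
  obtains K g a where "nice J K g" "a \<in> ell1_on J" "antideriv a g 1 = mat a"
    "AE s in unit_interval. f s = antideriv a g s"
proof -
  from assms obtain g0 c where f: "f \<in> Linf J" and g0: "is_weak_deriv J f g0" and c: "continuous_rep f c"
    and bc: "\<forall>j\<in>J. ell1_nth (c 1) j = (\<Sum>\<^sub>\<infinity>k\<in>J. B j k *\<^sub>R ell1_nth (c 0) k)"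
    unfolding flow_domain_def W1inf_def by blast
  have g0L: "g0 \<in> Linf J" using g0 by (simp add: is_weak_deriv_def)
  then obtain K where "AE s in unit_interval. norm (g0 s) \<le> K" by (auto simp: Linf_iff)
  then have "AE s in unit_interval. norm (g0 s) \<le> \<bar>K\<bar>" by eventually_elim simp
  then obtain g where g: "nice J \<bar>K\<bar> g" "AE s in unit_interval. g0 s = g s"
    using Linf_nice_representative[OF g0L] abs_ge_zero by metis
  obtain a where a: "a \<in> ell1_on J" "AE s in unit_interval. f s = antideriv a g s"
    using weak_deriv_imp_antideriv[OF f g0 g] by blast
  have eq: "c s = antideriv a g s" if "0 \<le> s" "s \<le> 1" for s
  proof (rule continuous_AE_eq_imp_eq[OF _ _ _ that])
    show "continuous_on {0..1} c" using c by (simp add: continuous_rep_def)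
    show "continuous_on {0..1} (antideriv a g)" by (rule continuous_on_antideriv[OF niceD(1,2)[OF g(1)]])
    have "AE s in unit_interval. f s = c s" using c by (simp add: continuous_rep_def)
    with a(2) show "AE s in unit_interval. c s = antideriv a g s" by eventually_elim simp
  qed
  have "antideriv a g 1 = mat a"
    using bc ell1_eq_mat_iff[of "antideriv a g 1" a] antideriv_ell1_on[OF niceD[OF g(1)] a(1)]
    by (simp add: eq antideriv_0)
  then show ?thesis using that g(1) a by blast
qed

lemma flow_solution_exists:
  fixes f :: "real \<Rightarrow> 'a::{real_normed_field, euclidean_space} ell1"
  assumes f: "f \<in> flow_domain J B"
  obtains F where "is_solution J (flow_domain J B) (flow_operator J) f (\<lambda>t s. F (t + s))"
    "continuous_on UNIV F" "AE s in unit_interval. f s = F s" "\<And>x. F x \<in> ell1_on J"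
    "\<And>x. 0 \<le> x \<Longrightarrow> F (x + 1) = mat (F x)"
proof -
  obtain K g a where g: "nice J K g" and a: "a \<in> ell1_on J" and bc: "antideriv a g 1 = mat a"
    and fg: "AE s in unit_interval. f s = antideriv a g s"
    using flow_domain_antideriv[OF f] by blast
  interpret C: primitive_curve J K "extend g" a
    by unfold_locales (rule nice_extend[OF g] a)+
  have shift: "C.F (x + 1) = mat (C.F x)" if "0 \<le> x" for x
    unfolding C.F_def by (rule antideriv_extend_shift(1)[OF g bc that])
  have init: "AE s in unit_interval. f s = C.F s"
  proof -
    have "AE s in unit_interval. C.F s = antideriv a g s"
      unfolding C.F_def using antideriv_extend_shift(2)[OF g bc order_refl] by (intro AE_unit_intervalI)
    with fg show ?thesis by eventually_elim simp
  qed
  have dom: "(\<lambda>s. C.F (t + s)) \<in> flow_domain J B" if t: "0 \<le> t" for t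
    unfolding flow_domain_def W1inf_def
  proof (intro CollectI conjI exI)
    show "(\<lambda>s. C.F (t + s)) \<in> Linf J" by (rule C.F_translate_Linf)
    show "is_weak_deriv J (\<lambda>s. C.F (t + s)) (\<lambda>s. extend g (t + s))" by (rule C.weak_deriv_translate[OF t])
    show "continuous_rep (\<lambda>s. C.F (t + s)) (\<lambda>s. C.F (t + s))"
      unfolding continuous_rep_def
      by (auto intro!: continuous_on_compose2[OF C.continuous_on_F[of UNIV]] continuous_intros)
    show "\<forall>j\<in>J. ell1_nth (C.F (t + 1)) j = (\<Sum>\<^sub>\<infinity>k\<in>J. B j k *\<^sub>R ell1_nth (C.F (t + 0)) k)"
      by (simp add: infsum_row shift[OF t])
  qed
  have op: "AE s in unit_interval. extend g (t + s) = flow_operator J (\<lambda>s. C.F (t + s)) s" if t: "0 \<le> t" for t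
    unfolding flow_operator_def
    by (rule weak_deriv_unique[OF C.weak_deriv_translate[OF t] someI[of "is_weak_deriv J _"]])
      (rule C.weak_deriv_translate[OF t])
  have "is_solution J (flow_domain J B) (flow_operator J) f (\<lambda>t s. C.F (t + s))"
    unfolding is_solution_def
  proof (intro conjI allI impI exI)
    show "AE s in unit_interval. C.F (0 + s) = f s" using init by eventually_elim simp
  qed (use dom op C.locally_norm_bounded_F C.locally_norm_bounded_G C.continuous_map_F
         C.continuous_map_G C.weak_star_deriv_translate in blast)+
  then show ?thesis
    by (rule that[OF _ C.continuous_on_F init C.F_ell1_on shift])
qed

end

section \<open>The transport equation along characteristics\<close>

text \<open>In the application \<open>v t\<close> is a coordinate of the continuous representative of a solution at
  time \<open>t\<close>. The time derivative of its integral over \<open>[0,x]\<close> is the one given by the equation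
  \<open>\<partial>\<^sub>t v = \<partial>\<^sub>x v\<close>; no differentiability of \<open>v\<close> itself is assumed.\<close>

locale transport =
  fixes v :: "real \<Rightarrow> real \<Rightarrow> 'a::euclidean_space"
  assumes cont: "0 \<le> t \<Longrightarrow> continuous_on {0..1} (v t)"
    and Lipschitz: "\<exists>C. \<forall>t\<in>{0..T}. \<forall>x\<in>{0..1}. \<forall>y\<in>{0..1}. norm (v t x - v t y) \<le> C * \<bar>x - y\<bar>"
    and deriv_t: "0 \<le> t \<Longrightarrow> 0 \<le> x \<Longrightarrow> x \<le> 1 \<Longrightarrow>
      ((\<lambda>t. integral {0..x} (v t)) has_vector_derivative (v t x - v t 0)) (at t within {0..})"
    and cont_diff: "0 \<le> x \<Longrightarrow> x \<le> 1 \<Longrightarrow> continuous_on {0..} (\<lambda>t. v t x - v t 0)"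
begin

text \<open>The integral of \<open>v t\<close> over \<open>[0,x]\<close>, which is differentiable in both variables.\<close>

definition \<Phi> :: "real \<Rightarrow> real \<Rightarrow> 'a" where "\<Phi> t x = integral {0..x} (v t)"

lemma Lipschitz_nonneg:
  obtains C where "0 \<le> C" "\<And>t x y. 0 \<le> t \<Longrightarrow> t \<le> T \<Longrightarrow> 0 \<le> x \<Longrightarrow> x \<le> 1 \<Longrightarrow> 0 \<le> y \<Longrightarrow> y \<le> 1 \<Longrightarrow>
      norm (v t x - v t y) \<le> C * \<bar>x - y\<bar>"
proof -
  obtain C where C: "\<forall>t\<in>{0..T}. \<forall>x\<in>{0..1}. \<forall>y\<in>{0..1}. norm (v t x - v t y) \<le> C * \<bar>x - y\<bar>"
    using Lipschitz by blast
  have "norm (v t x - v t y) \<le> \<bar>C\<bar> * \<bar>x - y\<bar>"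
    if "0 \<le> t" "t \<le> T" "0 \<le> x" "x \<le> 1" "0 \<le> y" "y \<le> 1" for t x y
  proof -
    have "norm (v t x - v t y) \<le> C * \<bar>x - y\<bar>" using C that by simp
    also have "\<dots> \<le> \<bar>C\<bar> * \<bar>x - y\<bar>" by (intro mult_right_mono) auto
    finally show ?thesis .
  qed
  then show ?thesis using that[of "\<bar>C\<bar>"] by simp
qed

lemma continuous_on_\<Phi>: "0 \<le> x \<Longrightarrow> x \<le> 1 \<Longrightarrow> continuous_on {0..} (\<lambda>t. \<Phi> t x)"
  unfolding \<Phi>_def
  by (auto simp: continuous_on_eq_continuous_within intro!: has_vector_derivative_continuous[OF deriv_t])

text \<open>By the Lipschitz condition, the boundary values at 0 are limits of the means over
  \<open>[0,\<epsilon>]\<close>, uniformly for \<open>t\<close> in a compact interval.\<close>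

lemma continuous_on_boundary: "continuous_on {0..T} (\<lambda>t. v t 0)"
proof -
  obtain C where C: "0 \<le> C" "\<And>t x y. 0 \<le> t \<Longrightarrow> t \<le> T \<Longrightarrow> 0 \<le> x \<Longrightarrow> x \<le> 1 \<Longrightarrow> 0 \<le> y \<Longrightarrow> y \<le> 1 \<Longrightarrow>
      norm (v t x - v t y) \<le> C * \<bar>x - y\<bar>"
    using Lipschitz_nonneg by blast
  define e where "e n = 1 / real (Suc n)" for n
  have e: "0 < e n" "e n \<le> 1" for n by (auto simp: e_def)
  define w where "w n t = (1 / e n) *\<^sub>R \<Phi> t (e n)" for n t
  have close: "norm (w n t - v t 0) \<le> C * e n" if t: "0 \<le> t" "t \<le> T" for n t
  proof -
    have int: "v t integrable_on {0..e n}"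
      by (rule integrable_continuous_interval[OF continuous_on_subset[OF cont[OF t(1)]]]) (use e in auto)
    have "\<Phi> t (e n) - e n *\<^sub>R v t 0 = integral {0..e n} (\<lambda>s. v t s - v t 0)"
      unfolding \<Phi>_def using e[of n] int
      by (subst Henstock_Kurzweil_Integration.integral_diff) auto
    moreover have "norm (integral {0..e n} (\<lambda>s. v t s - v t 0)) \<le> (C * e n) * (e n - 0)"
    proof (rule integral_bound)
      show "continuous_on {0..e n} (\<lambda>s. v t s - v t 0)"
        by (intro continuous_intros continuous_on_subset[OF cont[OF t(1)]]) (use e in auto)
      fix s assume "s \<in> {0..e n}"
      then have "norm (v t s - v t 0) \<le> C * \<bar>s - 0\<bar>" using e[of n] t by (intro C(2)) auto
      also have "\<dots> \<le> C * e n" using \<open>s \<in> {0..e n}\<close> C(1) by (intro mult_left_mono) auto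
      finally show "norm (v t s - v t 0) \<le> C * e n" .
    qed (use e[of n] in simp)
    ultimately have "norm (\<Phi> t (e n) - e n *\<^sub>R v t 0) \<le> C * e n * e n" by simp
    moreover have "w n t - v t 0 = (1 / e n) *\<^sub>R (\<Phi> t (e n) - e n *\<^sub>R v t 0)"
      using e[of n] by (simp add: w_def scaleR_diff_right)
    ultimately show ?thesis using e[of n] by (simp add: divide_le_eq)
  qed
  have "(\<lambda>n. C * e n) \<longlonglongrightarrow> C * 0"
    unfolding e_def by (intro tendsto_intros LIMSEQ_Suc[OF lim_1_over_n])
  then have lim: "(\<lambda>n. C * e n) \<longlonglongrightarrow> 0" by simp
  have "uniform_limit {0..T} w (\<lambda>t. v t 0) sequentially"
  proof (rule uniform_limitI)
    fix \<epsilon> :: real assume "\<epsilon> > 0"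
    then have "eventually (\<lambda>n. C * e n < \<epsilon>) sequentially" using order_tendstoD(2)[OF lim] by blast
    then show "eventually (\<lambda>n. \<forall>t\<in>{0..T}. dist (w n t) (v t 0) < \<epsilon>) sequentially"
      by eventually_elim (auto simp: dist_norm intro: le_less_trans[OF close])
  qed
  moreover have "continuous_on {0..T} (w n)" for n
    unfolding w_def
    by (intro continuous_intros continuous_on_subset[OF continuous_on_\<Phi>]) (use e[of n] in auto)
  ultimately show ?thesis
    by (intro uniform_limit_theorem[where F = sequentially]) auto
qed

lemma continuous_on_v:
  assumes "0 \<le> x" "x \<le> 1" shows "continuous_on {0..T} (\<lambda>t. v t x)"
  using continuous_on_add[OF continuous_on_subset[OF cont_diff[OF assms]] continuous_on_boundary[of T]]
  by (auto simp: subset_eq)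

lemma jointly_continuous: "continuous_on ({0..T} \<times> {0..1}) (\<lambda>(t, x). v t x)"
proof -
  obtain C where C: "0 \<le> C" "\<And>t x y. 0 \<le> t \<Longrightarrow> t \<le> T \<Longrightarrow> 0 \<le> x \<Longrightarrow> x \<le> 1 \<Longrightarrow> 0 \<le> y \<Longrightarrow> y \<le> 1 \<Longrightarrow>
      norm (v t x - v t y) \<le> C * \<bar>x - y\<bar>"
    using Lipschitz_nonneg by blast
  have "((\<lambda>(t, x). v t x) \<longlongrightarrow> v t x) (at (t, x) within {0..T} \<times> {0..1})"
    if tx: "t \<in> {0..T}" "x \<in> {0..1}" for t x
  proof -
    let ?at = "at (t, x) within {0..T} \<times> {0..1}"
    have "continuous_on ({0..T} \<times> {0..1}) (\<lambda>p. v (fst p) x)"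
      by (rule continuous_on_compose2[OF continuous_on_v[of x T] continuous_on_fst[OF continuous_on_id]])
        (use tx in auto)
    then have A: "((\<lambda>p. v (fst p) x) \<longlongrightarrow> v t x) ?at"
      unfolding continuous_on_def using tx by fastforce
    have "((\<lambda>p. C * \<bar>snd p - x\<bar>) \<longlongrightarrow> C * \<bar>snd (t, x) - x\<bar>) ?at"
      by (intro tendsto_intros)
    then have "((\<lambda>p. C * \<bar>snd p - x\<bar>) \<longlongrightarrow> 0) ?at" by simp
    then have "((\<lambda>p. (\<lambda>(t, x). v t x) p - v (fst p) x) \<longlongrightarrow> 0) ?at"
    proof (rule Lim_null_comparison[rotated])
      show "eventually (\<lambda>p. norm ((\<lambda>(t, x). v t x) p - v (fst p) x) \<le> C * \<bar>snd p - x\<bar>) ?at"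
        unfolding eventually_at_filter by (intro always_eventually) (use tx C(2) in auto)
    qed
    from tendsto_add[OF A this] show ?thesis by (simp add: case_prod_unfold)
  qed
  then show ?thesis unfolding continuous_on_def by auto
qed

lemma \<Phi>_has_derivative:
  assumes "t \<in> {0..T}" "x \<in> {0..1}"
  shows "((\<lambda>(t, x). \<Phi> t x) has_derivative
      (\<lambda>(dt, dx). dt *\<^sub>R (v t x - v t 0) + blinfun_scaleR_left (v t x) dx)) (at (t, x) within {0..T} \<times> {0..1})"
proof (rule has_derivative_partialsI)
  show "((\<lambda>t. \<Phi> t x) has_derivative (\<lambda>dt. dt *\<^sub>R (v t x - v t 0))) (at t within {0..T})"
    using deriv_t[of t x] assms unfolding \<Phi>_def has_vector_derivative_def
    by (auto elim: has_derivative_subset)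
  show "((\<lambda>x. \<Phi> t x) has_derivative blinfun_apply (blinfun_scaleR_left (v t x))) (at x within {0..1})"
    if "t \<in> {0..T}" "x \<in> {0..1}" for t x
    using integral_has_vector_derivative[of 0 1 "v t" x] cont[of t] that
    unfolding \<Phi>_def has_vector_derivative_def by simp
  have "continuous_on ({0..T} \<times> {0..1}) (\<lambda>p. blinfun_scaleR_left ((\<lambda>(t, x). v t x) p))"
    by (intro bounded_linear.continuous_on[OF bounded_linear_blinfun_scaleR_left] jointly_continuous)
  then show "continuous (at (t, x) within {0..T} \<times> {0..1}) (\<lambda>(t, x). blinfun_scaleR_left (v t x))"
    using assms by (auto simp: continuous_on_eq_continuous_within case_prod_unfold)
qed (use assms in auto)

lemma \<Phi>_characteristic_derivative:
  assumes "0 \<le> t" "0 \<le> y" "y \<le> x" "x \<le> 1" "h \<in> {0..y}"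
  shows "((\<lambda>h. \<Phi> (t + h) (x - h)) has_derivative (\<lambda>d. - d *\<^sub>R v (t + h) 0)) (at h within {0..y})"
proof -
  let ?T = "t + 1"
  have "((\<lambda>h. (\<lambda>(t, x). \<Phi> t x) (t + h, x - h)) has_derivative
      (\<lambda>d. (\<lambda>(dt, dx). dt *\<^sub>R (v (t + h) (x - h) - v (t + h) 0)
        + blinfun_scaleR_left (v (t + h) (x - h)) dx) (d, - d))) (at h within {0..y})"
  proof (rule has_derivative_in_compose[where f = "\<lambda>h. (t + h, x - h)" and f' = "\<lambda>d. (d, - d)"
        and g = "\<lambda>(t, x). \<Phi> t x"])
    show "((\<lambda>h. (t + h, x - h)) has_derivative (\<lambda>d. (d, - d))) (at h within {0..y})"
      by (auto intro!: derivative_eq_intros)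
    show "((\<lambda>(t, x). \<Phi> t x) has_derivative
        (\<lambda>(dt, dx). dt *\<^sub>R (v (t + h) (x - h) - v (t + h) 0) + blinfun_scaleR_left (v (t + h) (x - h)) dx))
        (at (t + h, x - h) within (\<lambda>h. (t + h, x - h)) ` {0..y})"
      by (rule has_derivative_subset[OF \<Phi>_has_derivative[of "t + h" ?T "x - h"]]) (use assms in auto)
  qed
  then show ?thesis by (simp add: algebra_simps)
qed

text \<open>Along a characteristic the derivative of \<open>\<Phi>\<close> depends on \<open>t + h\<close> only, so it cancels in the
  difference along two characteristics that start at the same time.\<close>

lemma \<Phi>_shift:
  assumes "0 \<le> t" "0 \<le> y" "y \<le> x" "x \<le> 1"
  shows "\<Phi> t x - \<Phi> t y = \<Phi> (t + y) (x - y)"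
proof -
  have "((\<lambda>h. \<Phi> (t + h) (x - h) - \<Phi> (t + h) (y - h)) has_derivative (\<lambda>_. 0)) (at h within {0..y})"
    if h: "h \<in> {0..y}" for h
    using has_derivative_diff[OF \<Phi>_characteristic_derivative[OF assms h]
        \<Phi>_characteristic_derivative[OF assms(1,2) order_refl _ h]] assms by simp
  then have "\<exists>c. \<forall>h\<in>{0..y}. \<Phi> (t + h) (x - h) - \<Phi> (t + h) (y - h) = c"
    by (intro has_derivative_zero_constant) auto
  then obtain c where c: "\<And>h. h \<in> {0..y} \<Longrightarrow> \<Phi> (t + h) (x - h) - \<Phi> (t + h) (y - h) = c" by blast
  have "\<Phi> (t + 0) (x - 0) - \<Phi> (t + 0) (y - 0) = \<Phi> (t + y) (x - y) - \<Phi> (t + y) (y - y)"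
    using c[of 0] c[of y] assms(2) by simp
  then show ?thesis by (simp add: \<Phi>_def)
qed

text \<open>Both sides of the preceding identity are differentiated with respect to \<open>x\<close> at \<open>x = y\<close>, from the
  right. At \<open>y = 1\<close> this is impossible, and continuity is used instead.\<close>

lemma v_eq_boundary_interior:
  assumes "0 \<le> t" "0 \<le> y" "y < 1"
  shows "v t y = v (t + y) 0"
proof -
  have 1: "((\<lambda>x. \<Phi> t x - \<Phi> t y) has_vector_derivative v t y - 0) (at y within {y..1})"
  proof (intro has_vector_derivative_diff has_vector_derivative_const)
    have "((\<lambda>x. integral {0..x} (v t)) has_vector_derivative v t y) (at y within {0..1})"
      by (rule integral_has_vector_derivative) (use cont assms in auto)
    then show "((\<lambda>x. \<Phi> t x) has_vector_derivative v t y) (at y within {y..1})"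
      unfolding \<Phi>_def by (rule has_vector_derivative_within_subset) (use assms in auto)
  qed
  have "((\<Phi> (t + y) \<circ> (\<lambda>x. x - y)) has_vector_derivative 1 *\<^sub>R v (t + y) (y - y)) (at y within {y..1})"
  proof (rule vector_diff_chain_within)
    show "((\<lambda>x. x - y) has_vector_derivative 1) (at y within {y..1})"
      by (auto intro!: derivative_eq_intros)
    have "((\<lambda>x. integral {0..x} (v (t + y))) has_vector_derivative v (t + y) 0) (at 0 within {0..1})"
      by (rule integral_has_vector_derivative) (use cont assms in auto)
    then show "(\<Phi> (t + y) has_vector_derivative v (t + y) (y - y)) (at (y - y) within (\<lambda>x. x - y) ` {y..1})"
      unfolding \<Phi>_def[abs_def] diff_self by (rule has_vector_derivative_within_subset) (use assms in auto)
  qed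
  then have "((\<lambda>x. \<Phi> (t + y) (x - y)) has_vector_derivative v (t + y) 0) (at y within {y..1})"
    by (simp add: o_def)
  then have 2: "((\<lambda>x. \<Phi> t x - \<Phi> t y) has_vector_derivative v (t + y) 0) (at y within {y..1})"
    by (rule has_vector_derivative_transform[rotated 2]) (use assms in \<open>auto simp: \<Phi>_shift\<close>)
  show ?thesis
    using vector_derivative_unique_within_closed_interval[of y 1 y, unfolded cbox_interval, OF _ _ 1 2] assms
    by simp
qed

lemma v_eq_boundary:
  assumes t: "0 \<le> t" and y: "0 \<le> y" "y \<le> 1"
  shows "v t y = v (t + y) 0"
proof (rule continuous_AE_eq_imp_eq[OF cont[OF t] _ _ y])
  show "continuous_on {0..1} (\<lambda>y. v (t + y) 0)"
    by (rule continuous_on_compose2[OF continuous_on_boundary[of "t + 1"]])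
      (use t in \<open>auto intro!: continuous_intros\<close>)
  show "AE s in unit_interval. v t s = v (t + s) 0"
    unfolding AE_unit_interval_iff using AE_lborel_singleton[of 1]
    by eventually_elim (use v_eq_boundary_interior[OF t] in auto)
qed

end

section \<open>Every solution is a translate\<close>

lemma Linf_cong_AE:
  assumes "f \<in> Linf J" "AE s in unit_interval. f s = f' s" "f' \<in> borel_measurable unit_interval"
  shows "f' \<in> Linf J"
proof -
  obtain K where "AE s in unit_interval. norm (f s) \<le> K" using assms(1) by (auto simp: Linf_iff)
  with assms(2) have "AE s in unit_interval. norm (f' s) \<le> K" by eventually_elim simp
  moreover have "AE s in unit_interval. f s \<in> ell1_on J" using assms(1) by (simp add: Linf_iff)
  with assms(2) have "AE s in unit_interval. f' s \<in> ell1_on J" by eventually_elim simp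
  ultimately show ?thesis using assms(3) by (auto simp: Linf_iff)
qed

lemma continuous_rep_Linf: "f \<in> Linf J \<Longrightarrow> continuous_rep f c \<Longrightarrow> c \<in> Linf J"
  by (rule Linf_cong_AE) (auto simp: continuous_rep_def intro!: continuous_imp_measurable_on_sets_lebesgue)

text \<open>The continuous representative is the primitive of the weak derivative, hence Lipschitz and
  \<open>\<ell>\<^sup>1(J)\<close>-valued, with increments given by the coordinate means of the derivative.\<close>

lemma continuous_rep_weak_deriv:
  fixes f :: "real \<Rightarrow> 'a::{real_normed_field, euclidean_space} ell1"
  assumes f: "f \<in> Linf J" and g: "is_weak_deriv J f g"
    and K: "AE s in unit_interval. norm (g s) \<le> K" "0 \<le> K" and c: "continuous_rep f c"
    and x: "0 \<le> x" "x \<le> 1"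
  shows "c x \<in> ell1_on J"
    and "0 \<le> y \<Longrightarrow> y \<le> 1 \<Longrightarrow> norm (c x - c y) \<le> K * \<bar>x - y\<bar>"
    and "coord_mean g j x = ell1_nth (c x) j - ell1_nth (c 0) j"
proof -
  have gL: "g \<in> Linf J" using g by (simp add: is_weak_deriv_def)
  obtain g' where g': "nice J K g'" "AE s in unit_interval. g s = g' s"
    using Linf_nice_representative[OF gL K] by blast
  obtain a where a: "a \<in> ell1_on J" "AE s in unit_interval. f s = antideriv a g' s"
    using weak_deriv_imp_antideriv[OF f g g'] by blast
  interpret C: primitive_curve J K g' a by unfold_locales (rule g' a)+
  have eq: "c s = C.F s" if "0 \<le> s" "s \<le> 1" for s
  proof (rule continuous_AE_eq_imp_eq[OF _ C.continuous_on_F _ that])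
    show "continuous_on {0..1} c" using c by (simp add: continuous_rep_def)
    have "AE s in unit_interval. f s = c s" using c by (simp add: continuous_rep_def)
    with a(2) show "AE s in unit_interval. c s = C.F s" by eventually_elim (simp add: C.F_def)
  qed
  show "c x \<in> ell1_on J" by (simp add: eq x C.F_ell1_on)
  show "norm (c x - c y) \<le> K * \<bar>x - y\<bar>" if "0 \<le> y" "y \<le> 1"
    using C.F_Lipschitz by (simp add: eq x that)
  have "coord_mean g j x = coord_mean g' j x"
    by (rule coord_mean_cong_AE[OF gL nice_Linf[OF g'(1)] g'(2)])
  also have "\<dots> = ell1_nth (c x) j - ell1_nth (c 0) j"
    using C.coord_mean_G[of 0 x j] x by (simp add: eq)
  finally show "coord_mean g j x = ell1_nth (c x) j - ell1_nth (c 0) j" .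
qed

context substochastic
begin

text \<open>The weak-star differential equation, tested with \<open>1\<^bsub>[0,x]\<^esub> e\<^sub>j\<close>, gives the hypotheses of
  the transport locale for each coordinate \<open>j \<in> J\<close>.\<close>

lemma solution_transport:
  fixes f :: "real \<Rightarrow> 'a::{real_normed_field, euclidean_space} ell1"
  assumes sol: "is_solution J (flow_domain J B) (flow_operator J) f u"
  obtains c where "\<And>t. 0 \<le> t \<Longrightarrow> continuous_rep (u t) (c t)" "\<And>t. 0 \<le> t \<Longrightarrow> c t 1 = mat (c t 0)"
    "\<And>t x. 0 \<le> t \<Longrightarrow> 0 \<le> x \<Longrightarrow> x \<le> 1 \<Longrightarrow> c t x = c (t + x) 0"
proof -
  from sol obtain u' where dom: "\<And>t. 0 \<le> t \<Longrightarrow> u t \<in> flow_domain J B"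
    and deriv: "weak_star_deriv J u u'" and cont': "continuous_map (top_of_set {0..}) (weak_star J) u'"
    and bdd: "locally_norm_bounded u'"
    and op: "\<And>t. 0 \<le> t \<Longrightarrow> AE s in unit_interval. u' t s = flow_operator J (u t) s"
    unfolding is_solution_def by blast
  have uL: "u t \<in> Linf J" if "0 \<le> t" for t
    using dom[OF that] by (simp add: flow_domain_def W1inf_def)
  have u'L: "u' t \<in> Linf J" if "0 \<le> t" for t
    using cont' that by (simp add: continuous_map_weak_star_iff)
  have wd: "is_weak_deriv J (u t) (u' t)" if t: "0 \<le> t" for t
  proof (rule is_weak_deriv_cong_AE[OF _ _ _ uL[OF t] uL[OF t] u'L[OF t]])
    have "\<exists>g. is_weak_deriv J (u t) g" using dom[OF t] by (simp add: flow_domain_def W1inf_def)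
    then show "is_weak_deriv J (u t) (flow_operator J (u t))"
      unfolding flow_operator_def by (rule someI_ex)
    show "AE s in unit_interval. flow_operator J (u t) s = u' t s"
      using op[OF t] by eventually_elim simp
  qed simp
  have "\<exists>c. continuous_rep (u t) c \<and> (\<forall>j\<in>J. ell1_nth (c 1) j = (\<Sum>\<^sub>\<infinity>k\<in>J. B j k *\<^sub>R ell1_nth (c 0) k))"
    if "0 \<le> t" for t using dom[OF that] by (simp add: flow_domain_def)
  then obtain c where c: "\<And>t. 0 \<le> t \<Longrightarrow> continuous_rep (u t) (c t)"
    and bc: "\<And>t. 0 \<le> t \<Longrightarrow> \<forall>j\<in>J. ell1_nth (c t 1) j = (\<Sum>\<^sub>\<infinity>k\<in>J. B j k *\<^sub>R ell1_nth (c t 0) k)"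
    by metis
  have bound: "\<exists>K\<ge>0. \<forall>t\<in>{0..T}. AE s in unit_interval. norm (u' t s) \<le> K" for T
  proof -
    have "compact {0..T} \<and> {0..T} \<subseteq> {0..}" by auto
    then obtain K where K: "\<forall>t\<in>{0..T}. Linf_norm (u' t) \<le> ereal K"
      using bdd unfolding locally_norm_bounded_def by meson
    have "AE s in unit_interval. norm (u' t s) \<le> \<bar>K\<bar>" if "t \<in> {0..T}" for t
    proof -
      have "AE s in unit_interval. norm (u' t s) \<le> K"
        using K that Linf_norm_le_iff[OF Linf_measurable[OF u'L]] by simp
      then show ?thesis by eventually_elim simp
    qed
    then show ?thesis by (intro exI[of _ "\<bar>K\<bar>"]) simp
  qed
  have rep: "c t x \<in> ell1_on J" "coord_mean (u' t) j x = ell1_nth (c t x) j - ell1_nth (c t 0) j"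
    if "0 \<le> t" "0 \<le> x" "x \<le> 1" for t x j
  proof -
    obtain K where K: "0 \<le> K" "\<forall>t\<in>{0..t}. AE s in unit_interval. norm (u' t s) \<le> K"
      using bound by blast
    from K(2) that(1) have "AE s in unit_interval. norm (u' t s) \<le> K" by simp
    from continuous_rep_weak_deriv(1,3)[OF uL wd this K(1) c] that
    show "c t x \<in> ell1_on J" "coord_mean (u' t) j x = ell1_nth (c t x) j - ell1_nth (c t 0) j" by auto
  qed
  have char: "ell1_nth (c t x) j = ell1_nth (c (t + x) 0) j"
    if j: "j \<in> J" and tx: "0 \<le> t" "0 \<le> x" "x \<le> 1" for t x j
  proof -
    interpret transport "\<lambda>t x. ell1_nth (c t x) j"
    proof
      fix t :: real assume t: "0 \<le> t"
      show "continuous_on {0..1} (\<lambda>x. ell1_nth (c t x) j)"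
        using c[OF t] by (intro continuous_on_ell1_nth) (simp add: continuous_rep_def)
    next
      fix T
      obtain K where K: "0 \<le> K" "\<forall>t\<in>{0..T}. AE s in unit_interval. norm (u' t s) \<le> K"
        using bound by blast
      have "norm (ell1_nth (c t x) j - ell1_nth (c t y) j) \<le> K * \<bar>x - y\<bar>"
        if "t \<in> {0..T}" "x \<in> {0..1}" "y \<in> {0..1}" for t x y
      proof -
        have "norm (ell1_nth (c t x) j - ell1_nth (c t y) j) \<le> norm (c t x - c t y)"
          using norm_ell1_nth_le[of "c t x - c t y" j] by (simp add: minus_ell1.rep_eq)
        also have "\<dots> \<le> K * \<bar>x - y\<bar>"
          using that K by (intro continuous_rep_weak_deriv(2)[OF uL wd _ _ c]) auto
        finally show ?thesis .
      qed
      then show "\<exists>C. \<forall>t\<in>{0..T}. \<forall>x\<in>{0..1}. \<forall>y\<in>{0..1}.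
          norm (ell1_nth (c t x) j - ell1_nth (c t y) j) \<le> C * \<bar>x - y\<bar>" by blast
    next
      fix x :: real assume x: "0 \<le> x" "x \<le> 1"
      have "continuous_on {0..} (\<lambda>t. coord_mean (u' t) j x)"
        unfolding coord_mean_eq_pairing
        using cont' indicator_unit_c0_in_L1_c0[OF j] by (auto simp: continuous_map_weak_star_iff)
      then show "continuous_on {0..} (\<lambda>t. ell1_nth (c t x) j - ell1_nth (c t 0) j)"
        by (rule continuous_on_eq) (simp add: rep(2) x)
      fix t :: real assume t: "0 \<le> t"
      let ?g = "\<lambda>s. indicator {0..x} s *\<^sub>R (unit_c0 j :: 'a c0)"
      have "((\<lambda>r. Linf_pairing (\<lambda>s. (u r s - u t s) /\<^sub>R (r - t)) ?g) \<longlongrightarrow> Linf_pairing (u' t) ?g) (at t within {0..})"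
        using deriv t indicator_unit_c0_in_L1_c0[OF j]
        unfolding weak_star_deriv_def limitin_weak_star_iff by blast
      then have "((\<lambda>r. coord_mean (\<lambda>s. (u r s - u t s) /\<^sub>R (r - t)) j x) \<longlongrightarrow> coord_mean (u' t) j x)
          (at t within {0..})"
        unfolding coord_mean_eq_pairing .
      then have "((\<lambda>r. (coord_mean (u r) j x - coord_mean (u t) j x) /\<^sub>R (r - t)) \<longlongrightarrow> coord_mean (u' t) j x)
          (at t within {0..})"
      proof (rule Lim_transform_eventually)
        show "eventually (\<lambda>r. coord_mean (\<lambda>s. (u r s - u t s) /\<^sub>R (r - t)) j x
            = (coord_mean (u r) j x - coord_mean (u t) j x) /\<^sub>R (r - t)) (at t within {0..})"
          unfolding coord_mean_scaleR
          using t by (auto simp: eventually_at_filter coord_mean_diff[OF uL uL])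
      qed
      then have "((\<lambda>r. coord_mean (u r) j x) has_vector_derivative coord_mean (u' t) j x) (at t within {0..})"
        by (simp add: has_vector_derivative_iff_tendsto)
      moreover have "coord_mean (u r) j x = integral {0..x} (\<lambda>s. ell1_nth (c r s) j)" if "0 \<le> r" for r
      proof -
        have "coord_mean (u r) j x = coord_mean (c r) j x"
          by (rule coord_mean_cong_AE[OF uL continuous_rep_Linf[OF uL]])
            (use c that in \<open>auto simp: continuous_rep_def\<close>)
        also have "\<dots> = integral {0..x} (\<lambda>s. ell1_nth (c r s) j)"
          using c[OF that] x by (intro coord_mean_continuous) (auto simp: continuous_rep_def)
        finally show ?thesis .
      qed
      ultimately show "((\<lambda>t. integral {0..x} (\<lambda>x. ell1_nth (c t x) j)) has_vector_derivative
          (ell1_nth (c t x) j - ell1_nth (c t 0) j)) (at t within {0..})"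
        unfolding rep(2)[OF t x] using t
        by (auto elim!: has_vector_derivative_transform[rotated 2])
    qed
    show ?thesis by (rule v_eq_boundary[OF tx])
  qed
  show ?thesis
  proof (rule that[of c, OF c])
    show "c t 1 = mat (c t 0)" if "0 \<le> t" for t
      using bc[OF that] ell1_eq_mat_iff[OF rep(1)[OF that, of 1], of "c t 0"] by simp
    show "c t x = c (t + x) 0" if "0 \<le> t" "0 \<le> x" "x \<le> 1" for t x
    proof (rule ell1_eqI)
      fix j show "ell1_nth (c t x) j = ell1_nth (c (t + x) 0) j"
        using char[of j t x] rep(1)[of t x] rep(1)[of "t + x" 0] that by (cases "j \<in> J") (auto simp: ell1_on_def)
    qed
  qed
qed

lemma solution_eq_translate:
  fixes f :: "real \<Rightarrow> 'a::{real_normed_field, euclidean_space} ell1"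
  assumes sol: "is_solution J (flow_domain J B) (flow_operator J) f u"
    and F: "continuous_on UNIV F" "AE s in unit_interval. f s = F s" "\<And>x. 0 \<le> x \<Longrightarrow> F (x + 1) = mat (F x)"
    and t: "0 \<le> t"
  shows "AE s in unit_interval. u t s = F (t + s)"
proof -
  obtain c where c: "\<And>t. 0 \<le> t \<Longrightarrow> continuous_rep (u t) (c t)" "\<And>t. 0 \<le> t \<Longrightarrow> c t 1 = mat (c t 0)"
    "\<And>t x. 0 \<le> t \<Longrightarrow> 0 \<le> x \<Longrightarrow> x \<le> 1 \<Longrightarrow> c t x = c (t + x) 0"
    using solution_transport[OF sol] by blast
  have init: "c 0 x = F x" if "0 \<le> x" "x \<le> 1" for x
  proof (rule continuous_AE_eq_imp_eq[OF _ continuous_on_subset[OF F(1)] _ that])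
    show "continuous_on {0..1} (c 0)" using c(1)[of 0] by (simp add: continuous_rep_def)
    have "AE s in unit_interval. u 0 s = c 0 s" using c(1)[of 0] by (simp add: continuous_rep_def)
    moreover have "AE s in unit_interval. u 0 s = f s" using sol by (simp add: is_solution_def)
    ultimately show "AE s in unit_interval. c 0 s = F s" using F(2) by eventually_elim simp
  qed simp
  have boundary: "0 \<le> x \<Longrightarrow> x \<le> real n + 1 \<Longrightarrow> c x 0 = F x" for n x
  proof (induction n arbitrary: x)
    case 0
    then show ?case using c(3)[of 0 x] init[of x] by simp
  next
    case (Suc n)
    show ?case
    proof (cases "x \<le> 1")
      case True
      then show ?thesis using Suc.prems c(3)[of 0 x] init[of x] by simp
    next
      case False
      then have "c x 0 = c (x - 1) 1" using c(3)[of "x - 1" 1] by simp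
      also have "\<dots> = mat (F (x - 1))" using False Suc c(2)[of "x - 1"] by simp
      also have "\<dots> = F x" using False F(3)[of "x - 1"] by simp
      finally show ?thesis .
    qed
  qed
  have "c t s = F (t + s)" if "0 \<le> s" "s \<le> 1" for s
  proof -
    obtain n where "t + s \<le> real n" using real_arch_simple by blast
    then show ?thesis using c(3)[OF t that] boundary[of "t + s" n] t that by simp
  qed
  then have "AE s in unit_interval. c t s = F (t + s)" by (rule AE_unit_intervalI)
  moreover have "AE s in unit_interval. u t s = c t s" using c(1)[OF t] by (simp add: continuous_rep_def)
  ultimately show ?thesis by eventually_elim simp
qed

end

section \<open>Continuous dependence on the initial data\<close>

lemma eventually_prod_principal_iff:
  "eventually P (Fl \<times>\<^sub>F principal S) \<longleftrightarrow> eventually (\<lambda>n. \<forall>t\<in>S. P (n, t)) Fl"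
  unfolding eventually_prod_filter eventually_principal
proof safe
  fix Pf Pg assume "eventually Pf Fl" "\<forall>x\<in>S. Pg x" "\<forall>x y. Pf x \<longrightarrow> Pg y \<longrightarrow> P (x, y)"
  then show "eventually (\<lambda>n. \<forall>t\<in>S. P (n, t)) Fl" by (auto elim: eventually_mono)
next
  assume "eventually (\<lambda>n. \<forall>t\<in>S. P (n, t)) Fl"
  then show "\<exists>Pf Pg. eventually Pf Fl \<and> (\<forall>x\<in>S. Pg x) \<and> (\<forall>x y. Pf x \<longrightarrow> Pg y \<longrightarrow> P (x, y))"
    by (intro exI[of _ "\<lambda>n. \<forall>t\<in>S. P (n, t)"] exI[of _ "\<lambda>t. t \<in> S"]) auto
qed

lemma equi_Lipschitz_uniformly_small:
  fixes p :: "nat \<Rightarrow> real \<Rightarrow> 'b::real_normed_vector"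
  assumes Lip: "\<And>n x y. x \<in> {0..T} \<Longrightarrow> y \<in> {0..T} \<Longrightarrow> norm (p n x - p n y) \<le> C * \<bar>x - y\<bar>"
    and lim: "\<And>x. x \<in> {0..T} \<Longrightarrow> (\<lambda>n. p n x) \<longlonglongrightarrow> 0" and e: "e > 0"
  shows "eventually (\<lambda>n. \<forall>x\<in>{0..T}. norm (p n x) < e) sequentially"
proof -
  define d where "d = e / (2 * (\<bar>C\<bar> + 1))"
  have d: "d > 0" using e by (simp add: d_def)
  have "seq_compact {0..T}" by (simp add: compact_imp_seq_compact)
  then obtain D where D: "finite D" "D \<subseteq> {0..T}" "{0..T} \<subseteq> (\<Union>x\<in>D. ball x d)"
    using seq_compact_imp_totally_bounded d by metis
  have "eventually (\<lambda>n. \<forall>x\<in>D. norm (p n x) < e / 2) sequentially"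
  proof (rule eventually_ball_finite[OF D(1)], intro ballI)
    fix x assume "x \<in> D"
    then have "(\<lambda>n. p n x) \<longlonglongrightarrow> 0" using D(2) lim by blast
    from tendstoD[OF this, of "e / 2"] e show "eventually (\<lambda>n. norm (p n x) < e / 2) sequentially" by simp
  qed
  then show ?thesis
  proof eventually_elim
    case (elim n)
    show ?case
    proof
      fix x assume x: "x \<in> {0..T}"
      then obtain y where y: "y \<in> D" "\<bar>x - y\<bar> < d" using D(3) by (auto simp: dist_real_def abs_minus_commute)
      have "norm (p n x - p n y) \<le> C * \<bar>x - y\<bar>" using x y D(2) by (intro Lip) auto
      also have "\<dots> \<le> (\<bar>C\<bar> + 1) * d" using y(2) by (intro mult_mono) auto
      also have "\<dots> = e / 2" using e by (simp add: d_def field_simps)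
      finally show "norm (p n x) < e"
        using elim y(1) norm_triangle_sub[of "p n x" "p n y"] by force
    qed
  qed
qed

context substochastic
begin

lemma flow_bound:
  fixes F :: "real \<Rightarrow> 'a::{real_normed_field, euclidean_space} ell1"
  assumes F: "continuous_on UNIV F" "\<And>x. 0 \<le> x \<Longrightarrow> F (x + 1) = mat (F x)"
    and C: "AE s in unit_interval. norm (F s) \<le> C" and x: "0 \<le> x"
  shows "norm (F x) \<le> C"
proof -
  have init: "norm (F x) \<le> C" if "0 \<le> x" "x \<le> 1" for x
  proof -
    have "max (norm (F x)) C = C"
    proof (rule continuous_AE_eq_imp_eq[OF _ continuous_on_const _ that])
      show "continuous_on {0..1} (\<lambda>x. max (norm (F x)) C)"
        by (intro continuous_intros continuous_on_subset[OF F(1)]) simp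
      show "AE s in unit_interval. max (norm (F s)) C = C" using C by eventually_elim simp
    qed
    then show ?thesis by linarith
  qed
  have "0 \<le> x \<Longrightarrow> x \<le> real n + 1 \<Longrightarrow> norm (F x) \<le> C" for n x
  proof (induction n arbitrary: x)
    case (Suc n)
    show ?case
    proof (cases "x \<le> 1")
      case False
      then have "norm (F x) \<le> norm (F (x - 1))" using F(2)[of "x - 1"] norm_mat_le[of "F (x - 1)"] by simp
      also have "\<dots> \<le> C" using False Suc by simp
      finally show ?thesis .
    qed (use Suc.prems init in simp)
  qed (use init in simp)
  moreover obtain n where "x \<le> real n" using real_arch_simple by blast
  ultimately show ?thesis using x by (meson add_increasing2 zero_le_one)
qed

text \<open>Here the finiteness of the rows is essential: by \<open>F(x + 1) = B F(x)\<close>, convergence of the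
  coordinates on \<open>[0,m]\<close> passes to \<open>[1,m + 1]\<close> through a finite sum.\<close>

lemma flow_primitive_tendsto_0:
  fixes F :: "nat \<Rightarrow> real \<Rightarrow> 'a::{real_normed_field, euclidean_space} ell1"
  assumes F: "\<And>n. continuous_on UNIV (F n)" "\<And>n x. 0 \<le> x \<Longrightarrow> F n (x + 1) = mat (F n x)"
    and init: "\<And>j x. j \<in> J \<Longrightarrow> 0 \<le> x \<Longrightarrow> x \<le> 1 \<Longrightarrow> (\<lambda>n. integral {0..x} (\<lambda>s. ell1_nth (F n s) j)) \<longlonglongrightarrow> 0"
    and j: "j \<in> J" and x: "0 \<le> x"
  shows "(\<lambda>n. integral {0..x} (\<lambda>s. ell1_nth (F n s) j)) \<longlonglongrightarrow> 0"
proof -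
  have cont: "continuous_on S (\<lambda>s. ell1_nth (F n s) j)" for n j S
    by (intro continuous_on_ell1_nth continuous_on_subset[OF F(1)]) simp
  have int: "(\<lambda>s. ell1_nth (F n s) j) integrable_on {y..z}" for n j y z
    by (rule integrable_continuous_interval[OF cont])
  have "j \<in> J \<Longrightarrow> 0 \<le> x \<Longrightarrow> x \<le> real m + 1 \<Longrightarrow> (\<lambda>n. integral {0..x} (\<lambda>s. ell1_nth (F n s) j)) \<longlonglongrightarrow> 0" for m x j
  proof (induction m arbitrary: x j)
    case (Suc m)
    show ?case
    proof (cases "x \<le> 1")
      case False
      let ?I = "\<lambda>n j x. integral {0..x} (\<lambda>s. ell1_nth (F n s) j)"
      have "?I n j x = ?I n j 1 + (\<Sum>k\<in>row j. B j k *\<^sub>R ?I n k (x - 1))" for n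
      proof -
        have "?I n j x = ?I n j 1 + integral {1..x} (\<lambda>s. ell1_nth (F n s) j)"
          using False by (intro Henstock_Kurzweil_Integration.integral_combine[symmetric] int) auto
        also have "integral {1..x} (\<lambda>s. ell1_nth (F n s) j) = integral {0..x - 1} (\<lambda>s. ell1_nth (F n (s + 1)) j)"
          using integral_shift_real_ivl[of 1 1 x "\<lambda>s. ell1_nth (F n s) j"] by simp
        also have "\<dots> = integral {0..x - 1} (\<lambda>s. \<Sum>k\<in>row j. B j k *\<^sub>R ell1_nth (F n s) k)"
          by (rule Henstock_Kurzweil_Integration.integral_cong) (simp add: F(2) mat_nth mat_seq_def Suc.prems(1))
        also have "\<dots> = (\<Sum>k\<in>row j. B j k *\<^sub>R ?I n k (x - 1))"
          by (subst Henstock_Kurzweil_Integration.integral_sum)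
            (auto intro!: integrable_cmul int simp: row(1)[OF Suc.prems(1)])
        finally show ?thesis .
      qed
      moreover have "(\<lambda>n. ?I n j 1 + (\<Sum>k\<in>row j. B j k *\<^sub>R ?I n k (x - 1))) \<longlonglongrightarrow> 0 + (\<Sum>k\<in>row j. B j k *\<^sub>R 0)"
        by (intro tendsto_add tendsto_sum tendsto_scaleR tendsto_const init Suc.IH)
          (use Suc.prems False row(2) in auto)
      ultimately show ?thesis by simp
    qed (use Suc.prems init in simp)
  qed (use init in simp)
  moreover obtain m where "x \<le> real m" using real_arch_simple by blast
  ultimately show ?thesis using j x by (meson add_increasing2 zero_le_one)
qed

lemma flow_weak_star_continuous_dependence:
  fixes f :: "nat \<Rightarrow> real \<Rightarrow> 'a::{real_normed_field, euclidean_space} ell1"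
  assumes f: "\<And>n. f n \<in> flow_domain J B" and C: "\<And>n. Linf_norm (f n) \<le> ereal C"
    and lim: "limitin (weak_star J) f (\<lambda>_. 0) sequentially"
    and sol: "\<And>n. is_solution J (flow_domain J B) (flow_operator J) (f n) (u n)"
    and U: "openin (weak_star J) U" "(\<lambda>_. 0) \<in> U"
  shows "eventually (\<lambda>n. \<forall>t\<in>{0..T}. u n t \<in> U) sequentially"
proof -
  have "\<exists>F. continuous_on UNIV F \<and> (AE s in unit_interval. f n s = F s) \<and> (\<forall>x\<ge>0. F (x + 1) = mat (F x))" for n
    using flow_solution_exists[OF f[of n]] by metis
  then obtain F where F: "\<And>n. continuous_on UNIV (F n)" "\<And>n. AE s in unit_interval. f n s = F n s"
      "\<And>n x. 0 \<le> x \<Longrightarrow> F n (x + 1) = mat (F n x)"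
    by metis
  have fL: "f n \<in> Linf J" for n using f[of n] by (simp add: flow_domain_def W1inf_def)
  have uL: "u n t \<in> Linf J" if "0 \<le> t" for n t
    using sol[of n] that by (simp add: is_solution_def flow_domain_def W1inf_def)
  have u: "AE s in unit_interval. u n t s = F n (t + s)" if "0 \<le> t" for n t
    by (rule solution_eq_translate[OF sol F that])
  have bound: "norm (F n x) \<le> C" if "0 \<le> x" for n x
  proof (rule flow_bound[OF F(1,3) _ that])
    have "AE s in unit_interval. norm (f n s) \<le> C"
      using C[of n] Linf_norm_le_iff[OF Linf_measurable[OF fL]] by blast
    with F(2)[of n] show "AE s in unit_interval. norm (F n s) \<le> C" by eventually_elim simp
  qed
  define P where "P n j x = integral {0..x} (\<lambda>s. ell1_nth (F n s) j)" for n j x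
  have cont: "continuous_on S (\<lambda>s. ell1_nth (F n s) j)" for n j S
    by (intro continuous_on_ell1_nth continuous_on_subset[OF F(1)]) simp
  have mean: "coord_mean (u n t) j b = P n j (t + b) - P n j t" if "0 \<le> t" "0 \<le> b" "b \<le> 1" for n t j b
  proof -
    have cF: "continuous_on {0..1} (\<lambda>s. F n (t + s))"
      by (rule continuous_on_compose2[OF F(1)]) (auto intro!: continuous_intros)
    then have "continuous_rep (u n t) (\<lambda>s. F n (t + s))" using u[OF that(1)] by (simp add: continuous_rep_def)
    from continuous_rep_Linf[OF uL[OF that(1)] this]
    have "coord_mean (u n t) j b = coord_mean (\<lambda>s. F n (t + s)) j b"
      using u[OF that(1)] by (intro coord_mean_cong_AE[OF uL[OF that(1)]])
    also have "\<dots> = integral {0..b} (\<lambda>s. ell1_nth (F n (t + s)) j)"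
      by (rule coord_mean_continuous[OF cF that(2,3)])
    also have "\<dots> = P n j (t + b) - P n j t"
      unfolding P_def by (rule integral_translate_primitive[OF cont that(1,2)])
    finally show ?thesis .
  qed
  have P_lim: "(\<lambda>n. P n j x) \<longlonglongrightarrow> 0" if "j \<in> J" "0 \<le> x" for j x
    unfolding P_def
  proof (rule flow_primitive_tendsto_0[OF F(1,3) _ that])
    fix j x assume j: "j \<in> J" and x: "0 \<le> x" "x \<le> (1::real)"
    have "(\<lambda>n. coord_mean (f n) j x) \<longlonglongrightarrow> coord_mean (\<lambda>_. 0) j x"
      unfolding coord_mean_eq_pairing
      using lim[unfolded limitin_weak_star_iff] indicator_unit_c0_in_L1_c0[OF j] by blast
    moreover have "coord_mean (\<lambda>_. 0 :: 'a ell1) j x = 0" by (simp add: coord_mean_def zero_ell1.rep_eq)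
    moreover have "coord_mean (f n) j x = integral {0..x} (\<lambda>s. ell1_nth (F n s) j)" for n
    proof -
      have cF: "continuous_on {0..1} (F n)" by (rule continuous_on_subset[OF F(1)]) simp
      then have "continuous_rep (f n) (F n)" using F(2) by (simp add: continuous_rep_def)
      from continuous_rep_Linf[OF fL this] F(2)[of n]
      have "coord_mean (f n) j x = coord_mean (F n) j x" by (intro coord_mean_cong_AE[OF fL])
      then show ?thesis using coord_mean_continuous[OF cF x] by simp
    qed
    ultimately show "(\<lambda>n. integral {0..x} (\<lambda>s. ell1_nth (F n s) j)) \<longlonglongrightarrow> 0" by simp
  qed
  have P_Lip: "norm (P n j x - P n j y) \<le> C * \<bar>x - y\<bar>" if "0 \<le> x" "0 \<le> y" for n j x y
  proof -
    have *: "norm (P n j y - P n j x) \<le> C * (y - x)" if "0 \<le> x" "x \<le> y" for x y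
    proof -
      have "P n j x + integral {x..y} (\<lambda>s. ell1_nth (F n s) j) = P n j y"
        unfolding P_def using that
        by (intro Henstock_Kurzweil_Integration.integral_combine integrable_continuous_interval cont) auto
      moreover have "norm (integral {x..y} (\<lambda>s. ell1_nth (F n s) j)) \<le> C * (y - x)"
        using that by (intro integral_bound cont) (auto intro: order_trans[OF norm_ell1_nth_le bound])
      ultimately show ?thesis by (metis add_diff_cancel_left')
    qed
    show ?thesis
      using *[of x y] *[of y x] that by (cases "x \<le> y") (auto simp: norm_minus_commute)
  qed
  \<comment> \<open>Convergence to 0 uniformly in \<open>t\<close> is convergence along a product filter in the pair \<open>(n, t)\<close>.
    Negative times, where nothing is known about \<open>u n t\<close>, are given the value 0.\<close>
  define q where "q i = (case i of (n, t) \<Rightarrow> if 0 \<le> t then u n t else (\<lambda>_. 0))" for i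
  let ?Fl = "sequentially \<times>\<^sub>F principal {0..T}"
  have zero: "(\<lambda>_. 0) \<in> Linf J"
    by (auto simp: Linf_iff zero_in_ell1_on intro!: exI[of _ 0])
  have qL: "q i \<in> Linf J" for i by (auto simp: q_def uL zero split: prod.split)
  have q_bound: "AE s in unit_interval. norm (q i s) \<le> C" for i
  proof -
    obtain n t where i: "i = (n, t)" by (cases i)
    have C0: "0 \<le> C" using bound[of 0 0] norm_ge_zero order_trans by blast
    show ?thesis
    proof (cases "0 \<le> t")
      case True
      have "AE s in unit_interval. norm (F n (t + s)) \<le> C"
        using True by (intro AE_unit_intervalI bound) simp
      with u[OF True, of n] have "AE s in unit_interval. norm (u n t s) \<le> C" by eventually_elim simp
      then show ?thesis using True by (simp add: i q_def)
    qed (simp add: i q_def C0)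
  qed
  have "limitin (weak_star J) q (\<lambda>_. 0) ?Fl"
    unfolding limitin_weak_star_iff
  proof (intro conjI ballI zero)
    show "eventually (\<lambda>i. q i \<in> Linf J) ?Fl" by (simp add: qL)
    fix h :: "real \<Rightarrow> 'a c0" assume "h \<in> L1_c0 J"
    then have h: "integrable unit_interval h" by (simp add: L1_c0_def)
    have "((\<lambda>i. Linf_pairing (q i) h) \<longlongrightarrow> 0) ?Fl"
    proof (rule tendsto_Linf_pairing_zero[OF qL q_bound _ h])
      fix j b assume j: "j \<in> J" and b: "0 \<le> b" "b \<le> (1::real)"
      show "((\<lambda>i. coord_mean (q i) j b) \<longlongrightarrow> 0) ?Fl"
      proof (rule tendstoI)
        fix e :: real assume "e > 0"
        then have "eventually (\<lambda>n. \<forall>x\<in>{0..T + 1}. norm (P n j x) < e / 2) sequentially"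
          by (intro equi_Lipschitz_uniformly_small[where C = C] P_Lip P_lim j) auto
        then show "eventually (\<lambda>i. dist (coord_mean (q i) j b) 0 < e) ?Fl"
          unfolding eventually_prod_principal_iff
        proof eventually_elim
          case (elim n)
          show ?case
          proof
            fix t assume t: "t \<in> {0..T}"
            have "norm (P n j (t + b) - P n j t) \<le> norm (P n j (t + b)) + norm (P n j t)"
              by (rule norm_triangle_ineq4)
            also have "\<dots> < e / 2 + e / 2" using elim t b by (intro add_strict_mono) auto
            finally show "dist (coord_mean (q (n, t)) j b) 0 < e"
              using t b by (simp add: q_def mean)
          qed
        qed
      qed
    qed
    then show "((\<lambda>i. Linf_pairing (q i) h) \<longlongrightarrow> Linf_pairing (\<lambda>_. 0) h) ?Fl"
      by (simp add: Linf_pairing_def ell1_c0.zero_left)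
  qed
  then have "eventually (\<lambda>i. q i \<in> U) ?Fl" using U by (simp add: limitin_def)
  then show ?thesis
    unfolding eventually_prod_principal_iff by eventually_elim (auto simp: q_def)
qed

lemma flow_well_posed:
  "well_posed J (flow_domain J B :: (real \<Rightarrow> 'a::{real_normed_field, euclidean_space} ell1) set) (flow_operator J)"
  unfolding well_posed_def
proof (intro conjI ballI allI impI; (elim conjE)?)
  fix f :: "real \<Rightarrow> 'a ell1" assume f: "f \<in> flow_domain J B"
  obtain F where "is_solution J (flow_domain J B) (flow_operator J) f (\<lambda>t s. F (t + s))"
    by (rule flow_solution_exists[OF f])
  then show "\<exists>u. is_solution J (flow_domain J B) (flow_operator J) f u" by blast
  fix u v and t :: real
  assume u: "is_solution J (flow_domain J B) (flow_operator J) f u"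
    and v: "is_solution J (flow_domain J B) (flow_operator J) f v" and t: "0 \<le> t"
  obtain F where F: "continuous_on UNIV F" "AE s in unit_interval. f s = F s" "\<And>x. 0 \<le> x \<Longrightarrow> F (x + 1) = mat (F x)"
    using flow_solution_exists[OF f] by metis
  have "AE s in unit_interval. u t s = F (t + s)"
    by (rule solution_eq_translate[OF u F t])
  moreover have "AE s in unit_interval. v t s = F (t + s)"
    by (rule solution_eq_translate[OF v F t])
  ultimately show "AE s in unit_interval. u t s = v t s" by eventually_elim simp
next
  fix f :: "nat \<Rightarrow> real \<Rightarrow> 'a ell1" and u and T :: real and U :: "(real \<Rightarrow> 'a ell1) set"
  assume f: "\<forall>n. f n \<in> flow_domain J B" and C: "\<exists>C::real. \<forall>n. Linf_norm (f n) \<le> ereal C"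
    and lim: "limitin (weak_star J) f (\<lambda>_. 0) sequentially"
    and sol: "\<forall>n. is_solution J (flow_domain J B) (flow_operator J) (f n) (u n)"
    and U: "openin (weak_star J) U" "(\<lambda>_. 0) \<in> U"
  from C obtain C :: real where C: "\<And>n. Linf_norm (f n) \<le> ereal C" by blast
  show "eventually (\<lambda>n. \<forall>t\<in>{0..T}. u n t \<in> U) sequentially"
    by (rule flow_weak_star_continuous_dependence[OF f[rule_format] C lim sol[rule_format] U])
qed

end

section \<open>The adjacency matrix of the line graph\<close>

text \<open>Row \<open>i\<close> is supported on the edges that end in the tail of \<open>i\<close>, of which there are finitely many.\<close>

lemma substochastic_line_adjacency:
  assumes "wf_digraph G" "locally_finite G" "edge_weights G w"
  shows "substochastic (arcs G) (line_adjacency G w)"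
proof
  interpret wf_digraph G by fact
  show "0 \<le> line_adjacency G w i k" if "i \<in> arcs G" "k \<in> arcs G" for i k
    using assms(3) that by (simp add: line_adjacency_def edge_weights_def)
  show "finite {k \<in> arcs G. line_adjacency G w i k \<noteq> 0}" if "i \<in> arcs G" for i
  proof (rule finite_subset)
    show "{k \<in> arcs G. line_adjacency G w i k \<noteq> 0}
        \<subseteq> {e \<in> arcs G. tail G e = tail G i \<or> head G e = tail G i}"
      by (auto simp: line_adjacency_def split: if_splits)
    show "finite {e \<in> arcs G. tail G e = tail G i \<or> head G e = tail G i}"
      using assms(2) tail_in_verts[OF that] by (simp add: locally_finite_def)
  qed
  show "(\<Sum>i\<in>A. line_adjacency G w i k) \<le> 1" if "k \<in> arcs G" "finite A" "A \<subseteq> arcs G" for k A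
  proof -
    have "(\<Sum>i\<in>A. line_adjacency G w i k) \<le> (\<Sum>i\<in>A. w i k)"
      using assms(3) that by (intro sum_mono) (auto simp: line_adjacency_def edge_weights_def)
    also have "\<dots> \<le> 1"
      by (rule finite_sum_le_has_sum[where A = "arcs G"])
        (use assms(3) that in \<open>auto simp: edge_weights_def\<close>)
    finally show ?thesis .
  qed
qed

theorem corollary1:
  fixes G :: "(nat, nat) pre_digraph" and w :: "nat \<Rightarrow> nat \<Rightarrow> real"
  assumes "loopfree_digraph G" and "nomulti_digraph G" and "locally_finite G"
    and "edge_weights G w"
  shows "well_posed (arcs G)
    (flow_domain (arcs G) (line_adjacency G w)
      :: (real \<Rightarrow> 'a::{real_normed_field, euclidean_space} ell1) set)
    (flow_operator (arcs G))"
proof -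
  have "wf_digraph G" using assms(1) by (simp add: loopfree_digraph_def)
  from substochastic.flow_well_posed[OF substochastic_line_adjacency[OF this assms(3,4)]]
  show ?thesis .
qed

end
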